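(* Let $(R,\mathfrak m,k)$ be a Noetherian local ring of positive dimension $d$ with infinite residue field $k$. Let $M_1\subseteq F_1,\dots,M_q\subseteq F_q$ be $R$-submodules of finite colength in free $R$-modules $F_1,\dots,F_q$ of finite ranks $r_1,\dots,r_q\ge 1$. If $q\ge d$, then there exists a joint reduction $(B_1,\dots,B_q)$ of $(M_1,\dots,M_q)$. More precisely, fix a basis of each $F_i$ and identify $M_i$ with an $r_i\times m_i$ matrix over $R$ whose columns are generators of $M_i$. Then there is a non-empty Zariski open subset $U$ of $M_{m_1\times r_1}(k)\times\cdots\times M_{m_q\times r_q}(k)$ such that whenever $A_i\in M_{m_i\times r_i}(R)$ ($1\le i\le q$) have reductions $\overline{A}_i\in M_{m_i\times r_i}(k)$ modulo $\mathfrak m$ with $(\overline{A}_1,\dots,\overline{A}_q)\in U$, and $B_i$ is the submodule of $M_i$ generated by the columns of the matrix product $M_iA_i$, the collection $(B_1,\dots,B_q)$ is a joint reduction of $(M_1,\dots,M_q)$.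
   Context: Finite colength of $M_i$ in $F_i$ means $F_i/M_i$ has finite length (possibly zero, i.e. $M_i=F_i$ is allowed). $S(F)$ denotes the symmetric algebra of $F=F_1\oplus\cdots\oplus F_q$, which is $\mathbb N^q$-graded (a polynomial ring); $S_n(M_i)$ denotes the image in $S_n(F_i)$ of the $n$th symmetric power of $M_i$, and products of such modules are taken in $S(F)$ (the $R$-submodule generated by products of elements). Joint reduction: submodules $B_i\subseteq M_i$ ($1\le i\le q$) form a joint reduction $(B_1,\dots,B_q)$ of $(M_1,\dots,M_q)$ if each $B_i$ can be generated by $r_i=\operatorname{rank}F_i$ elements and, for some integer $n\ge 0$, $$\prod_{j=1}^q S_{n+1}(M_j)=\sum_{i=1}^q B_i\,S_n(M_i)\prod_{j\ne i}S_{n+1}(M_j).$$ *)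

theory Defs
  imports
    "HOL-Library.Extended_Nat"
    "HOL-Library.Poly_Mapping"
    "HOL-Library.FuncSet"
    "HOL-Algebra.Algebraic_Closure_Type"
    "Jordan_Normal_Form.Matrix"
begin

text \<open>
  Both HOL-Algebra and HOL define a locale called module.  Modules over the type-class ring
  \<open>'a\<close> are those of theory Modules throughout, hence the qualified names.
\<close>

text \<open>Supremum of the lengths \<open>n\<close> of strict chains \<open>P 0 \<subset> \<dots> \<subset> P n\<close> of prime ideals.\<close>

definition krull_dim :: "('a, 'b) ring_scheme \<Rightarrow> enat" where
  "krull_dim R = Sup {enat n | n. \<exists>P :: nat \<Rightarrow> 'a set.
     (\<forall>i\<le>n. primeideal (P i) R) \<and> (\<forall>i<n. P i \<subset> P (Suc i))}"

text \<open>
  The Noetherian local ring \<open>(R, \<mm>, k)\<close>, where \<open>R\<close> is the type \<open>'a\<close> and the residue field is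
  given as a field \<open>'k\<close> with a surjective ring homomorphism \<open>\<pi>\<close> from \<open>R\<close> whose kernel is \<open>\<mm>\<close>.
\<close>

definition noetherian_local_ring :: "'a::comm_ring_1 set \<Rightarrow> ('a \<Rightarrow> 'k::field) \<Rightarrow> bool" where
  "noetherian_local_ring \<mm> \<pi> \<longleftrightarrow>
     noetherian_ring (ring_of_type_algebra :: 'a ring) \<and>
     maximalideal \<mm> (ring_of_type_algebra :: 'a ring) \<and>
     (\<forall>J. maximalideal J (ring_of_type_algebra :: 'a ring) \<longrightarrow> J = \<mm>) \<and>
     comm_ring_hom \<pi> \<and> surj \<pi> \<and> {x. \<pi> x = 0} = \<mm>"

text \<open>
  The length of the quotient module \<open>F / M\<close>: the submodules of \<open>F / M\<close> are the \<open>N / M\<close> with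
  \<open>M \<subseteq> N \<subseteq> F\<close>, so this is the supremum of the lengths of strict chains of such \<open>N\<close>.
\<close>

definition quotient_length ::
    "('a::comm_ring_1 \<Rightarrow> 'f::ab_group_add \<Rightarrow> 'f) \<Rightarrow> 'f set \<Rightarrow> 'f set \<Rightarrow> enat" where
  "quotient_length scale F M = Sup {enat n | n. \<exists>N :: nat \<Rightarrow> 'f set.
     (\<forall>i\<le>n. Modules.module.subspace scale (N i) \<and> M \<subseteq> N i \<and> N i \<subseteq> F) \<and>
     (\<forall>i<n. N i \<subset> N (Suc i))}"

definition finite_colength_submodule ::
    "('a::comm_ring_1 \<Rightarrow> 'f::ab_group_add \<Rightarrow> 'f) \<Rightarrow> 'f set \<Rightarrow> 'f set \<Rightarrow> bool" where
  "finite_colength_submodule scale F M \<longleftrightarrow>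
     Modules.module.subspace scale M \<and> M \<subseteq> F \<and> quotient_length scale F M \<noteq> \<infinity>"

text \<open>\<open>F\<close> is free of rank \<open>r\<close> with ordered basis \<open>e 0, \<dots>, e (r - 1)\<close>.\<close>

definition free_module_basis ::
    "('a::comm_ring_1 \<Rightarrow> 'f::ab_group_add \<Rightarrow> 'f) \<Rightarrow> 'f set \<Rightarrow> nat \<Rightarrow> (nat \<Rightarrow> 'f) \<Rightarrow> bool" where
  "free_module_basis scale F r e \<longleftrightarrow>
     inj_on e {..<r} \<and> \<not> Modules.module.dependent scale (e ` {..<r}) \<and>
     Modules.module.span scale (e ` {..<r}) = F"

text \<open>Polynomials are finitely supported functions from monomials (exponent vectors).\<close>

type_synonym ('v, 'a) mpoly = "('v \<Rightarrow>\<^sub>0 nat) \<Rightarrow>\<^sub>0 'a"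

definition mpoly_const :: "'a::comm_ring_1 \<Rightarrow> ('v, 'a) mpoly" where
  "mpoly_const c = Poly_Mapping.single 0 c"

definition mpoly_var :: "'v \<Rightarrow> ('v, 'a::comm_ring_1) mpoly" where
  "mpoly_var v = Poly_Mapping.single (Poly_Mapping.single v 1) 1"

definition mpoly_scale :: "'a::comm_ring_1 \<Rightarrow> ('v, 'a) mpoly \<Rightarrow> ('v, 'a) mpoly" where
  "mpoly_scale c f = mpoly_const c * f"

lemma module_mpoly_scale:
  "Modules.module (mpoly_scale :: 'a::comm_ring_1 \<Rightarrow> ('v, 'a) mpoly \<Rightarrow> ('v, 'a) mpoly)"
  by unfold_locales
    (simp_all add: mpoly_scale_def mpoly_const_def algebra_simps single_add mult_single
      flip: mult.assoc)

text \<open>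
  \<open>S(F)\<close> for \<open>F = F\<^sub>0 \<oplus> \<dots> \<oplus> F\<^sub>q\<^sub>-\<^sub>1\<close> (external direct sum), where \<open>F\<^sub>i\<close> has basis \<open>e i a\<close>, \<open>a < r i\<close>,
  is the polynomial ring over \<open>R\<close> in the variables \<open>(i, a)\<close>, the variable \<open>(i, a)\<close> being \<open>e i a\<close>.
  An element of \<open>F\<^sub>i\<close> becomes the linear form with its coordinates as coefficients.
\<close>

definition sym_embed ::
    "('a::comm_ring_1 \<Rightarrow> 'f::ab_group_add \<Rightarrow> 'f) \<Rightarrow> (nat \<Rightarrow> nat) \<Rightarrow> (nat \<Rightarrow> nat \<Rightarrow> 'f)
      \<Rightarrow> nat \<Rightarrow> 'f \<Rightarrow> (nat \<times> nat, 'a) mpoly" where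
  "sym_embed scale r e i v =
     (\<Sum>a<r i. mpoly_scale (Modules.module.representation scale (e i ` {..<r i}) v (e i a))
                (mpoly_var (i, a)))"

text \<open>The product of the submodules \<open>P j\<close>, \<open>j \<in> J\<close>, of \<open>S(F)\<close>; it is \<open>R\<close> itself if \<open>J = {}\<close>.\<close>

definition submodule_prod :: "'j set \<Rightarrow> ('j \<Rightarrow> ('v, 'a::comm_ring_1) mpoly set) \<Rightarrow> ('v, 'a) mpoly set"
  where
  "submodule_prod J P = Modules.module.span mpoly_scale {\<Prod>j\<in>J. f j | f. \<forall>j\<in>J. f j \<in> P j}"

definition submodule_mult ::
    "('v, 'a::comm_ring_1) mpoly set \<Rightarrow> ('v, 'a) mpoly set \<Rightarrow> ('v, 'a) mpoly set" where
  "submodule_mult P Q = Modules.module.span mpoly_scale {f * g | f g. f \<in> P \<and> g \<in> Q}"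

definition submodule_sum ::
    "'j set \<Rightarrow> ('j \<Rightarrow> ('v, 'a::comm_ring_1) mpoly set) \<Rightarrow> ('v, 'a) mpoly set" where
  "submodule_sum J P = {\<Sum>j\<in>J. f j | f. \<forall>j\<in>J. f j \<in> P j}"

text \<open>\<open>S\<^sub>n(M\<^sub>i)\<close>: the submodule of \<open>S\<^sub>n(F\<^sub>i)\<close> generated by the \<open>n\<close>-fold products of elements of \<open>M\<^sub>i\<close>.\<close>

definition sym_power_image ::
    "('a::comm_ring_1 \<Rightarrow> 'f::ab_group_add \<Rightarrow> 'f) \<Rightarrow> (nat \<Rightarrow> nat) \<Rightarrow> (nat \<Rightarrow> nat \<Rightarrow> 'f)
      \<Rightarrow> nat \<Rightarrow> nat \<Rightarrow> 'f set \<Rightarrow> (nat \<times> nat, 'a) mpoly set" where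
  "sym_power_image scale r e i n M =
     submodule_prod {..<n} (\<lambda>_. sym_embed scale r e i ` M)"

definition joint_reduction ::
    "('a::comm_ring_1 \<Rightarrow> 'f::ab_group_add \<Rightarrow> 'f) \<Rightarrow> nat \<Rightarrow> (nat \<Rightarrow> nat) \<Rightarrow> (nat \<Rightarrow> nat \<Rightarrow> 'f)
      \<Rightarrow> (nat \<Rightarrow> 'f set) \<Rightarrow> (nat \<Rightarrow> 'f set) \<Rightarrow> bool" where
  "joint_reduction scale q r e M B \<longleftrightarrow>
     (\<forall>i<q. Modules.module.subspace scale (B i) \<and> B i \<subseteq> M i \<and>
        (\<exists>g :: nat \<Rightarrow> 'f. B i = Modules.module.span scale (g ` {..<r i}))) \<and>
     (\<exists>n. submodule_prod {..<q} (\<lambda>j. sym_power_image scale r e j (n + 1) (M j)) =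
        submodule_sum {..<q} (\<lambda>i.
          submodule_mult
            (submodule_mult (sym_embed scale r e i ` B i) (sym_power_image scale r e i n (M i)))
            (submodule_prod ({..<q} - {i}) (\<lambda>j. sym_power_image scale r e j (n + 1) (M j)))))"

text \<open>
  The submodule generated by the columns of a matrix, a column being the coordinate vector of an
  element with respect to the basis \<open>e 0, e 1, \<dots>\<close>.
\<close>

definition column_module ::
    "('a::comm_ring_1 \<Rightarrow> 'f::ab_group_add \<Rightarrow> 'f) \<Rightarrow> (nat \<Rightarrow> 'f) \<Rightarrow> 'a mat \<Rightarrow> 'f set" where
  "column_module scale e G = Modules.module.span scale
     ((\<lambda>j. \<Sum>a<dim_row G. scale (G $$ (a, j)) (e a)) ` {..<dim_col G})"

definition mpoly_eval :: "('v \<Rightarrow> 'a) \<Rightarrow> ('v, 'a::comm_ring_1) mpoly \<Rightarrow> 'a" where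
  "mpoly_eval x f =
     (\<Sum>t\<in>Poly_Mapping.keys f. Poly_Mapping.lookup f t *
        (\<Prod>v\<in>Poly_Mapping.keys t. x v ^ Poly_Mapping.lookup t v))"

definition matrix_tuples ::
    "nat \<Rightarrow> (nat \<Rightarrow> nat) \<Rightarrow> (nat \<Rightarrow> nat) \<Rightarrow> (nat \<Rightarrow> 'k mat) set" where
  "matrix_tuples q nr nc = (\<Pi>\<^sub>E i\<in>{..<q}. carrier_mat (nr i) (nc i))"

text \<open>
  Polynomials on the space of matrix tuples have the variables \<open>(i, a, b)\<close>, for the \<open>(a, b)\<close> entry
  of the \<open>i\<close>-th matrix.  Only index triples in range are allowed, as the library leaves the
  entries of a matrix outside its dimensions unspecified.
\<close>

definition zariski_open ::
    "nat \<Rightarrow> (nat \<Rightarrow> nat) \<Rightarrow> (nat \<Rightarrow> nat) \<Rightarrow> (nat \<Rightarrow> 'k::field mat) set \<Rightarrow> bool" where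
  "zariski_open q nr nc U \<longleftrightarrow>
     (\<exists>P :: (nat \<times> nat \<times> nat, 'k) mpoly set.
        (\<forall>f\<in>P. \<forall>t\<in>Poly_Mapping.keys f.
           Poly_Mapping.keys t \<subseteq> {(i, a, b). i < q \<and> a < nr i \<and> b < nc i}) \<and>
        U = {Z \<in> matrix_tuples q nr nc. \<exists>f\<in>P. mpoly_eval (\<lambda>(i, a, b). Z i $$ (a, b)) f \<noteq> 0})"

end

theory Submission
  imports Defs "HOL-Library.Function_Algebras"
begin

text \<open>
  The Zariski open set is cut out by finitely many polynomials \<open>h\<close> over \<open>R\<close> with a unit
  coefficient, so it suffices to find them such that the columns of the \<open>M\<^sub>iA\<^sub>i\<close> form a joint
  reduction whenever all \<open>h(A)\<close> are units. By Nakayama's lemma the latter has to be tested modulo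
  \<open>\<mm>\<close>, and only for powers of the products \<open>y\<close> of one generator from each \<open>M\<^sub>i\<close>.

  For fixed \<open>y\<close>, solve the equations saying that the columns of all \<open>M\<^sub>iA\<^sub>i\<close> vanish where \<open>y\<close> is
  invertible; they are linear in \<open>A\<close>, and the solution has coordinates \<open>u/y\<close> with \<open>u\<close> in the diagonal
  degree \<open>(1, \<dots>, 1)\<close> of the Rees algebra, depending on all but \<open>\<Sum> r\<^sub>i\<close> of the entries of \<open>A\<close>. Let \<open>p\<close> be
  one of \<open>d\<close> elements generating an ideal \<open>Q\<close> that contains a power of \<open>\<mm>\<close>. Products of a power
  \<open>p ^ a\<close> with a form in the \<open>u\<close> and \<open>y\<close> are counted against the length of \<open>S(F)\<close> modulo a power of
  \<open>Q\<close> in the same degree; because \<open>M\<^sub>i\<close> has finite colength, that power of \<open>Q\<close> may be chosen linear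
  in the degree, and \<open>d \<le> q\<close> makes the products outnumber the length. This gives a form \<open>f\<close> with a unit
  coefficient such that \<open>p ^ a f(u, y)\<close> lies in \<open>Q ^ (a + 1)\<close> times the Rees algebra. Multiplying
  these \<open>f\<close> over the \<open>d\<close> parameters, a Cayley--Hamilton argument shows that a power of the product
  lies in \<open>\<mm>\<close> times the Rees algebra, the error term being nilpotent because \<open>d > 0\<close>.
  Specialised to a matrix tuple \<open>A\<close>, the form \<open>f(u, y)\<close> is congruent to \<open>f(A, 1)\<close> times a power of
  \<open>y\<close> modulo the columns of the \<open>M\<^sub>iA\<^sub>i\<close>, so that \<open>h(A) = f(A, 1)\<close> does what is needed.
\<close>

section \<open>Systems of parameters\<close>

text \<open>The count is a comparison of exponents. Let e be the number of matrix entries. Forms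
  with all exponents below n, times p^a with a < n, number n^(e+1). On the other side, with N linear
  in n, the monomials of S(F) of multidegree (N, ..., N) contribute order n^(R - q) where R is the
  sum of the r_i, the e - R remaining entries of A contribute n^(e - R), and the monomials in d
  parameters of degree linear in n contribute n^d. The total exponent e - q + d is at most e. The
  decisive additional factor n comes from the powers of p, so the relation controls f only after
  multiplication by p^a. This is why a relation is needed for every parameter: a long word in the
  parameters contains some p_i at least a_i times. The entries of A stay indeterminate during the
  count, because a relation whose coefficients depended on A would not define one open set. Finally,
  a product is expressed through later products in a suitable order, not merely through others. This
  yields a coefficient 1, so the polynomial is nonzero modulo the maximal ideal and the infinite
  residue field supplies a point of the open set.\<close>

interpretation rg: Modules.module "(*) :: 'a::comm_ring_1 \<Rightarrow> 'a \<Rightarrow> 'a"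
  by unfold_locales (simp_all add: algebra_simps)

declare rg.scale_scale [simp del]

text \<open>Ideals become submodules of the ring over itself, so that \<open>rg.span\<close> serves
  for generated ideals and closure arguments are the same for ideals and modules.\<close>

lemma ideal_type_algebra_iff:
  "ideal I (ring_of_type_algebra :: 'a::comm_ring_1 ring) \<longleftrightarrow> rg.subspace I"
proof
  assume "ideal I (ring_of_type_algebra :: 'a ring)"
  then interpret ideal I "ring_of_type_algebra :: 'a ring" .
  show "rg.subspace I"
  proof (rule rg.subspaceI)
    show "0 \<in> I" using additive_subgroup.zero_closed[OF is_additive_subgroup] by (simp add: ring_of_type_algebra_def)
    show "x + y \<in> I" if "x \<in> I" "y \<in> I" for x y
      using additive_subgroup.a_closed[OF is_additive_subgroup, of x y] that by (simp add: ring_of_type_algebra_def)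
    show "c * x \<in> I" if "x \<in> I" for c x
      using I_l_closed[of x c] that by (simp add: ring_of_type_algebra_def)
  qed
next
  assume I: "rg.subspace I"
  have inv: "inv\<^bsub>add_monoid (ring_of_type_algebra :: 'a ring)\<^esub> x = - x" for x :: 'a
  proof -
    interpret ring "ring_of_type_algebra :: 'a ring" by (rule ring_from_type_algebra)
    have "\<ominus>\<^bsub>(ring_of_type_algebra :: 'a ring)\<^esub> x = - x"
      by (rule minus_equality) (simp_all add: ring_of_type_algebra_def)
    then show ?thesis by (simp add: a_inv_def)
  qed
  show "ideal I (ring_of_type_algebra :: 'a ring)"
  proof (rule idealI)
    show "ring (ring_of_type_algebra :: 'a ring)" by (rule ring_from_type_algebra)
    show "subgroup I (add_monoid (ring_of_type_algebra :: 'a ring))"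
    proof
      show "I \<subseteq> carrier (add_monoid (ring_of_type_algebra :: 'a ring))"
        by (simp add: ring_of_type_algebra_def)
      show "x \<otimes>\<^bsub>add_monoid (ring_of_type_algebra :: 'a ring)\<^esub> y \<in> I" if "x \<in> I" "y \<in> I" for x y
        using that rg.subspace_add[OF I] by (simp add: ring_of_type_algebra_def)
      show "\<one>\<^bsub>add_monoid (ring_of_type_algebra :: 'a ring)\<^esub> \<in> I"
        using rg.subspace_0[OF I] by (simp add: ring_of_type_algebra_def)
      show "inv\<^bsub>add_monoid (ring_of_type_algebra :: 'a ring)\<^esub> x \<in> I" if "x \<in> I" for x
        using rg.subspace_neg[OF I that] by (simp only: inv)
    qed
    show "x \<otimes>\<^bsub>ring_of_type_algebra\<^esub> a \<in> I" "a \<otimes>\<^bsub>ring_of_type_algebra\<^esub> x \<in> I" if "a \<in> I" for a x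
      using rg.subspace_scale[OF I that, of x] by (simp_all add: ring_of_type_algebra_def mult.commute)
  qed
qed

section \<open>Prime ideals of a Noetherian ring: products of primes and prime avoidance\<close>

definition prime_ideal :: "'a::comm_ring_1 set \<Rightarrow> bool" where
  "prime_ideal P \<longleftrightarrow> rg.subspace P \<and> 1 \<notin> P \<and> (\<forall>a b. a * b \<in> P \<longrightarrow> a \<in> P \<or> b \<in> P)"

lemma subspace_eq_UNIV_iff: "rg.subspace I \<Longrightarrow> I = UNIV \<longleftrightarrow> 1 \<in> I"
  using rg.subspace_scale[of I 1] by auto

lemma primeideal_type_algebra_iff:
  "primeideal P (ring_of_type_algebra :: 'a::comm_ring_1 ring) \<longleftrightarrow> prime_ideal P"
  using subspace_eq_UNIV_iff[of P] cring_from_type_algebra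
  by (auto simp: primeideal_def primeideal_axioms_def ideal_type_algebra_iff prime_ideal_def)
     (auto simp: ring_of_type_algebra_def)

lemma prime_ideal_prod_list:
  assumes "prime_ideal P" "prod_list xs \<in> P"
  shows "\<exists>x\<in>set xs. x \<in> P"
  using assms by (induction xs) (auto simp: prime_ideal_def)

lemma noetherian_fin_gen:
  assumes "noetherian_ring (ring_of_type_algebra :: 'a::comm_ring_1 ring)" "rg.subspace (I :: 'a set)"
  shows "\<exists>A. finite A \<and> I = rg.span A"
proof -
  interpret noetherian_ring "ring_of_type_algebra :: 'a ring" by fact
  obtain A where A: "finite A" "I = Idl\<^bsub>ring_of_type_algebra\<^esub> A"
    using finetely_gen assms(2) unfolding ideal_type_algebra_iff by blast
  moreover have "Idl\<^bsub>ring_of_type_algebra\<^esub> A = rg.span A"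
    by (auto simp: genideal_def ideal_type_algebra_iff rg.span_def hull_def)
  ultimately show ?thesis by blast
qed

text \<open>The relation is oriented so that induction at an ideal gives the hypothesis for all
  strictly larger ideals, and minimal elements are inclusion-maximal ideals. The union of an
  ascending chain is an ideal whose finitely many generators already lie in one member.\<close>

lemma noetherian_wf:
  assumes "noetherian_ring (ring_of_type_algebra :: 'a::comm_ring_1 ring)"
  shows "wf {(J :: 'a set, I). rg.subspace I \<and> rg.subspace J \<and> I \<subset> J}"
  unfolding wf_iff_no_infinite_down_chain
proof
  assume "\<exists>f. \<forall>i. (f (Suc i), f i) \<in> {(J :: 'a set, I). rg.subspace I \<and> rg.subspace J \<and> I \<subset> J}"
  then obtain f :: "nat \<Rightarrow> 'a set" where f: "\<And>i. rg.subspace (f i)" "\<And>i. f i \<subset> f (Suc i)"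
    unfolding mem_Collect_eq prod.case by blast
  have mono: "i \<le> j \<Longrightarrow> f i \<subseteq> f j" for i j by (rule lift_Suc_mono_le[of f]) (use f in auto)
  have sub: "rg.subspace (\<Union>i. f i)"
  proof (rule rg.subspaceI)
    show "0 \<in> (\<Union>i. f i)" using f rg.subspace_0 by blast
    fix x y assume "x \<in> (\<Union>i. f i)" "y \<in> (\<Union>i. f i)"
    then obtain i j where "x \<in> f i" "y \<in> f j" by auto
    then have "x \<in> f (max i j)" "y \<in> f (max i j)"
      using mono[of i "max i j"] mono[of j "max i j"] by auto
    then show "x + y \<in> (\<Union>i. f i)" using rg.subspace_add f by blast
  next
    fix c x :: 'a assume "x \<in> (\<Union>i. f i)"
    then show "c * x \<in> (\<Union>i. f i)" using rg.subspace_scale f by blast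
  qed
  obtain A where A: "finite A" "(\<Union>i. f i) = rg.span A" using noetherian_fin_gen[OF assms sub] by blast
  have "\<exists>n. B \<subseteq> f n" if "finite B" "B \<subseteq> (\<Union>i. f i)" for B
    using that
  proof (induction B)
    case (insert b B)
    then obtain n m where "B \<subseteq> f n" "b \<in> f m" by auto
    then have "insert b B \<subseteq> f (max n m)" using mono[of n "max n m"] mono[of m "max n m"] by auto
    then show ?case by blast
  qed auto
  then obtain n where "A \<subseteq> f n" using A rg.span_superset by metis
  then have "(\<Union>i. f i) \<subseteq> f n" unfolding A(2) using rg.span_minimal f by blast
  then show False using f(2)[of n] by blast
qed

text \<open>Noetherian induction: if \<open>a * b\<close> lies in the ideal but neither factor does,
  the lists found for the ideals enlarged by \<open>a\<close> and by \<open>b\<close> are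
  concatenated. This takes the place of minimal primes.\<close>

lemma ideal_contains_prime_product:
  assumes "noetherian_ring (ring_of_type_algebra :: 'a::comm_ring_1 ring)" "rg.subspace (I :: 'a set)"
  shows "\<exists>Ps. (\<forall>P\<in>set Ps. prime_ideal P \<and> I \<subseteq> P) \<and> (\<forall>xs. list_all2 (\<in>) xs Ps \<longrightarrow> prod_list xs \<in> I)"
  using assms(2)
proof (induction I rule: wf_induct_rule[OF noetherian_wf[OF assms(1)]])
  case (1 I)
  consider "1 \<in> I" | "prime_ideal I" | a b where "a * b \<in> I" "a \<notin> I" "b \<notin> I"
    using 1(2) by (auto simp: prime_ideal_def)
  then show ?case
  proof cases
    case 1 then show ?thesis by (intro exI[of _ "[]"]) auto
  next
    case 2 then show ?thesis by (intro exI[of _ "[I]"]) (auto simp: list_all2_Cons2)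
  next
    case 3
    have *: "\<exists>Ps. (\<forall>P\<in>set Ps. prime_ideal P \<and> I \<subseteq> P) \<and>
        (\<forall>xs. list_all2 (\<in>) xs Ps \<longrightarrow> prod_list xs \<in> rg.span (insert x I))" if "x \<notin> I" for x
    proof -
      have "I \<subset> rg.span (insert x I)" using that rg.span_superset[of "insert x I"] by auto
      then have "\<exists>Ps. (\<forall>P\<in>set Ps. prime_ideal P \<and> rg.span (insert x I) \<subseteq> P) \<and>
          (\<forall>xs. list_all2 (\<in>) xs Ps \<longrightarrow> prod_list xs \<in> rg.span (insert x I))"
        using 1(2) by (intro 1(1)) auto
      then show ?thesis using \<open>I \<subset> rg.span (insert x I)\<close> by (meson order.trans psubset_imp_subset)
    qed
    from *[OF 3(2)] *[OF 3(3)] obtain Ps Qs where PQ: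
      "\<forall>P\<in>set Ps. prime_ideal P \<and> I \<subseteq> P" "\<forall>P\<in>set Qs. prime_ideal P \<and> I \<subseteq> P"
      "\<And>xs. list_all2 (\<in>) xs Ps \<Longrightarrow> prod_list xs \<in> rg.span (insert a I)"
      "\<And>xs. list_all2 (\<in>) xs Qs \<Longrightarrow> prod_list xs \<in> rg.span (insert b I)" by blast
    have "prod_list xs \<in> I" if xs: "list_all2 (\<in>) xs (Ps @ Qs)" for xs
    proof -
      obtain us vs where "xs = us @ vs" "list_all2 (\<in>) us Ps" "list_all2 (\<in>) vs Qs"
        using xs unfolding list_all2_append2 by blast
      then have "prod_list us \<in> rg.span (insert a I)" "prod_list vs \<in> rg.span (insert b I)"
        using PQ(3,4) by simp_all
      moreover have "rg.span I = I" using 1(2) by simp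
      ultimately obtain k l where "prod_list us - k * a \<in> I" "prod_list vs - l * b \<in> I"
        unfolding rg.span_breakdown_eq by auto
      note kl = this \<open>xs = us @ vs\<close>
      have "prod_list xs = prod_list vs * (prod_list us - k * a) + k * a * (prod_list vs - l * b) + (k * l) * (a * b)"
        unfolding kl(3) by (simp add: algebra_simps)
      then show ?thesis
        by (simp only:) (intro rg.subspace_add rg.subspace_scale 1(2) kl(1,2) 3(1))
    qed
    then show ?thesis using PQ by (intro exI[of _ "Ps @ Qs"]) auto
  qed
qed

text \<open>In a counterexample, induction provides for each prime an element of \<open>I\<close>
  that lies in this prime and in no other. With at least two primes, one such element plus the
  product of all the others lies in none of them.\<close>

lemma prime_avoidance:
  assumes "finite \<P>" "\<And>P. P \<in> \<P> \<Longrightarrow> prime_ideal P" "rg.subspace I" "\<And>P. P \<in> \<P> \<Longrightarrow> \<not> I \<subseteq> P"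
  shows "\<exists>x\<in>I. \<forall>P\<in>\<P>. x \<notin> P"
  using assms
proof (induction "card \<P>" arbitrary: \<P> rule: less_induct)
  case (less \<P>)
  show ?case
  proof (rule ccontr)
    assume neg: "\<not> ?case"
    have "\<exists>x\<in>I. x \<in> P \<and> (\<forall>P'\<in>\<P> - {P}. x \<notin> P')" if "P \<in> \<P>" for P
    proof -
      have "card (\<P> - {P}) < card \<P>" using that less.prems(1) by (meson card_Diff1_less)
      from less.hyps[OF this] have "\<exists>x\<in>I. \<forall>P'\<in>\<P> - {P}. x \<notin> P'" using less.prems by auto
      then show ?thesis using neg by auto
    qed
    then obtain x where x: "\<And>P. P \<in> \<P> \<Longrightarrow> x P \<in> I \<and> x P \<in> P \<and> (\<forall>P'\<in>\<P> - {P}. x P \<notin> P')" by metis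
    show False
    proof (cases "\<P> = {}")
      case True then show ?thesis using neg rg.subspace_0[OF less.prems(3)] by auto
    next
      case False
      then obtain P where P: "P \<in> \<P>" by auto
      let ?X = "\<P> - {P}"
      have prP: "prime_ideal P" using less.prems P by auto
      have "prod x ?X \<notin> P"
      proof -
        have "finite ?X" using less.prems by auto
        moreover have "\<forall>Q\<in>?X. x Q \<notin> P" using x P by auto
        ultimately show ?thesis
          by (induction rule: finite_induct) (use prP in \<open>auto simp: prime_ideal_def\<close>)
      qed
      obtain z where z: "z \<in> I" "z \<notin> P" using less.prems P by blast
      define w where "w = (if ?X = {} then z else x P + prod x ?X)"
      show False
      proof (cases "?X = {}")
        case True
        then show ?thesis using neg z P by auto
      next
        case False
        then obtain Q where Q: "Q \<in> ?X" by auto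
        have pX: "prod x ?X \<in> J" if J: "rg.subspace J" "\<exists>Q\<in>?X. x Q \<in> J" for J
        proof -
          obtain Q where "Q \<in> ?X" "x Q \<in> J" using J(2) by blast
          then have "prod x ?X = prod x (?X - {Q}) * x Q"
            using less.prems(1) by (subst prod.remove[of ?X Q]) (auto simp: mult.commute)
          then show ?thesis using J \<open>x Q \<in> J\<close> rg.subspace_scale by auto
        qed
        have "x P + prod x ?X \<in> I" using pX[of I] x P Q less.prems(3) by (auto intro!: rg.subspace_add)
        moreover have "x P + prod x ?X \<notin> P'" if "P' \<in> \<P>" for P'
        proof
          assume a: "x P + prod x ?X \<in> P'"
          have sub: "rg.subspace P'" using less.prems that by (auto simp: prime_ideal_def)
          show False
          proof (cases "P' = P")
            case True
            then have "prod x ?X \<in> P" using rg.subspace_diff[OF sub a, of "x P"] x P by simp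
            then show ?thesis using \<open>prod x ?X \<notin> P\<close> by simp
          next
            case False
            then have "prod x ?X \<in> P'" using pX[OF sub] x that by blast
            then have "x P \<in> P'" using rg.subspace_diff[OF sub a, of "prod x ?X"] by simp
            then show ?thesis using x P that False by auto
          qed
        qed
        ultimately show False using neg by blast
      qed
    qed
  qed
qed


section \<open>Local rings\<close>

lemma proper_ideal_subset_local:
  assumes "noetherian_local_ring (\<mm> :: 'a::comm_ring_1 set) \<pi>" "rg.subspace J" "1 \<notin> J"
  shows "J \<subseteq> \<mm>"
proof -
  note nl = assms(1)[unfolded noetherian_local_ring_def]
  let ?S = "{K. rg.subspace K \<and> 1 \<notin> K \<and> J \<subseteq> K}"
  have noeth: "noetherian_ring (ring_of_type_algebra :: 'a ring)" using nl by blast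
  have J: "J \<in> ?S" using assms by blast
  \<comment> \<open>Minimality for the reversed inclusion makes \<open>K\<close> maximal among the
    proper ideals above \<open>J\<close>, hence a maximal ideal.\<close>
  obtain K where K: "K \<in> ?S"
    "\<And>L. (L, K) \<in> {(J, I). rg.subspace I \<and> rg.subspace J \<and> I \<subset> J} \<Longrightarrow> L \<notin> ?S"
    by (rule wfE_min[OF noetherian_wf[OF noeth] J]) (rule that)
  have "maximalideal K (ring_of_type_algebra :: 'a ring)"
  proof (rule maximalidealI)
    show "ideal K (ring_of_type_algebra :: 'a ring)" using K(1) by (simp add: ideal_type_algebra_iff)
    show "carrier (ring_of_type_algebra :: 'a ring) \<noteq> K"
      using K(1) by (auto simp: ring_of_type_algebra_def)
    fix L assume L: "ideal L (ring_of_type_algebra :: 'a ring)" "K \<subseteq> L"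
    then have "rg.subspace L" by (simp add: ideal_type_algebra_iff)
    then show "L = K \<or> L = carrier (ring_of_type_algebra :: 'a ring)"
      using K L(2) subspace_eq_UNIV_iff[of L] by (auto simp: ring_of_type_algebra_def)
  qed
  then show ?thesis using nl K(1) by auto
qed

lemma local_unit:
  assumes "noetherian_local_ring (\<mm> :: 'a::comm_ring_1 set) \<pi>" "x \<notin> \<mm>"
  shows "\<exists>y. x * y = 1"
proof (rule ccontr)
  assume "\<nexists>y. x * y = 1"
  then have "1 \<notin> rg.span {x}" by (auto simp: rg.span_singleton mult.commute)
  then show False
    using proper_ideal_subset_local[OF assms(1) rg.subspace_span] assms(2) rg.span_base[of x "{x}"] by blast
qed

lemma local_prime_ideal:
  assumes "noetherian_local_ring (\<mm> :: 'a::comm_ring_1 set) \<pi>"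
  shows "prime_ideal \<mm>"
proof -
  note nl = assms(1)[unfolded noetherian_local_ring_def]
  interpret comm_ring_hom \<pi> using nl by simp
  have *: "x \<in> \<mm> \<longleftrightarrow> \<pi> x = 0" for x using nl by auto
  show ?thesis
    by (auto simp: prime_ideal_def rg.subspace_def * hom_add hom_mult)
qed

lemma prime_subset_local:
  assumes "noetherian_local_ring (\<mm> :: 'a::comm_ring_1 set) \<pi>" "prime_ideal P"
  shows "P \<subseteq> \<mm>"
  using proper_ideal_subset_local[OF assms(1)] assms(2) by (auto simp: prime_ideal_def)

section \<open>Chains of primes, dimension and parameters\<close>

definition prime_chain_to :: "nat \<Rightarrow> 'a::comm_ring_1 set \<Rightarrow> bool" where
  "prime_chain_to j P \<longleftrightarrow> (\<exists>C. (\<forall>i\<le>j. prime_ideal (C i)) \<and> (\<forall>i<j. C i \<subset> C (Suc i)) \<and> C j = P)"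

lemma prime_chain_to_Suc:
  assumes "prime_chain_to j P'" "P' \<subset> P" "prime_ideal P"
  shows "prime_chain_to (Suc j) P"
proof -
  obtain C where C: "\<forall>i\<le>j. prime_ideal (C i)" "\<forall>i<j. C i \<subset> C (Suc i)" "C j = P'"
    using assms(1) by (auto simp: prime_chain_to_def)
  then show ?thesis unfolding prime_chain_to_def using assms(2,3)
    by (intro exI[of _ "C(Suc j := P)"]) (auto simp: le_Suc_eq less_Suc_eq)
qed

lemma krull_dim_chain_bound:
  assumes "krull_dim (ring_of_type_algebra :: 'a::comm_ring_1 ring) = enat d"
    and "prime_chain_to j (P :: 'a set)"
  shows "j \<le> d"
proof -
  have "enat j \<le> krull_dim (ring_of_type_algebra :: 'a ring)"
    unfolding krull_dim_def using assms(2)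
    by (intro Sup_upper) (auto simp: prime_chain_to_def primeideal_type_algebra_iff)
  then show ?thesis using assms(1) by simp
qed

lemma prime_contains_factor:
  assumes "prime_ideal P" "\<And>xs. list_all2 (\<in>) xs Ps \<Longrightarrow> prod_list xs \<in> P"
  shows "\<exists>P'\<in>set Ps. P' \<subseteq> P"
proof (rule ccontr)
  assume "\<not> ?thesis"
  then have "\<forall>P'\<in>set Ps. \<exists>x. x \<in> P' \<and> x \<notin> P" by blast
  then obtain x where x: "\<And>P'. P' \<in> set Ps \<Longrightarrow> x P' \<in> P' \<and> x P' \<notin> P" by metis
  then have "list_all2 (\<in>) (map x Ps) Ps" by (auto simp: list_all2_conv_all_nth)
  from prime_ideal_prod_list[OF assms(1) assms(2)[OF this]] show False using x by auto
qed

text \<open>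
  Each \<open>p j\<close> avoids the primes other than \<open>\<mm>\<close> of a product contained in \<open>(p 0, \<dots>, p (j - 1))\<close>, so
  that the primes above the latter ideal are ends of chains of length \<open>j\<close>; only chains of length
  at most \<open>d\<close> exist. This direction of the theory of systems of parameters does not use Krull's
  height theorem.
\<close>

lemma system_of_parameters:
  assumes nl: "noetherian_local_ring (\<mm> :: 'a::comm_ring_1 set) \<pi>"
    and kd: "krull_dim (ring_of_type_algebra :: 'a ring) = enat d"
  obtains p c where "\<And>i. i < d \<Longrightarrow> p i \<in> \<mm>"
    "\<And>w. set w \<subseteq> \<mm> \<Longrightarrow> length w = c \<Longrightarrow> prod_list w \<in> rg.span (p ` {..<d})"
proof -
  have noeth: "noetherian_ring (ring_of_type_algebra :: 'a ring)"
    using nl by (simp add: noetherian_local_ring_def)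
  have prm: "prime_ideal \<mm>" by (rule local_prime_ideal[OF nl])
  then have subm: "rg.subspace \<mm>" by (simp add: prime_ideal_def)
  have all_m: "\<exists>c. \<forall>w. set w \<subseteq> \<mm> \<and> length w = c \<longrightarrow> prod_list w \<in> I"
    if "\<And>xs. list_all2 (\<in>) xs Ps \<Longrightarrow> prod_list xs \<in> I" "set Ps \<subseteq> {\<mm>}" for Ps I
  proof (intro exI allI impI)
    fix w assume w: "set w \<subseteq> \<mm> \<and> length w = length Ps"
    have "w ! i \<in> Ps ! i" if "i < length w" for i
    proof -
      have "Ps ! i = \<mm>" using that w \<open>set Ps \<subseteq> {\<mm>}\<close> by (metis nth_mem singletonD subsetD)
      then show ?thesis using that w by (metis nth_mem subsetD)
    qed
    with w that(1)[of w] show "prod_list w \<in> I" by (auto simp: list_all2_conv_all_nth)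
  qed
  \<comment> \<open>Either a power of the maximal ideal is already reached, which persists when the
    sequence is padded with 0, or each parameter so far has lengthened the chains below by one
    prime.\<close>
  have step: "\<exists>p. (\<forall>i<j. p i \<in> \<mm>) \<and>
      ((\<exists>c. \<forall>w. set w \<subseteq> \<mm> \<and> length w = c \<longrightarrow> prod_list w \<in> rg.span (p ` {..<j})) \<or>
       (\<forall>P. prime_ideal P \<and> rg.span (p ` {..<j}) \<subseteq> P \<longrightarrow> prime_chain_to j P))" for j
  proof (induction j)
    case 0
    have "prime_chain_to 0 P" if "prime_ideal P" for P :: "'a set"
      unfolding prime_chain_to_def by (rule exI[of _ "\<lambda>_. P"]) (use that in auto)
    then show ?case by auto
  next
    case (Suc j)
    then obtain p where p: "\<forall>i<j. p i \<in> \<mm>" and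
      alt: "(\<exists>c. \<forall>w. set w \<subseteq> \<mm> \<and> length w = c \<longrightarrow> prod_list w \<in> rg.span (p ` {..<j})) \<or>
       (\<forall>P. prime_ideal P \<and> rg.span (p ` {..<j}) \<subseteq> P \<longrightarrow> prime_chain_to j P)" by blast
    have sp: "rg.span (p ` {..<j}) \<subseteq> rg.span (p(j := x) ` {..<Suc j})" for x
      by (rule rg.span_mono) force
    have px: "\<forall>i<Suc j. (p(j := x)) i \<in> \<mm>" if "x \<in> \<mm>" for x using p that by (auto simp: less_Suc_eq)
    obtain Ps where Ps: "\<forall>P\<in>set Ps. prime_ideal P \<and> rg.span (p ` {..<j}) \<subseteq> P"
      "\<And>xs. list_all2 (\<in>) xs Ps \<Longrightarrow> prod_list xs \<in> rg.span (p ` {..<j})"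
      using ideal_contains_prime_product[OF noeth rg.subspace_span[of "p ` {..<j}"]] by blast
    show ?case
    proof (cases "(\<exists>c. \<forall>w. set w \<subseteq> \<mm> \<and> length w = c \<longrightarrow> prod_list w \<in> rg.span (p ` {..<j}))")
      case True
      then show ?thesis using px[OF rg.subspace_0[OF subm]] sp[of 0] by (intro exI[of _ "p(j := 0)"]) blast
    next
      case False
      then have chain: "\<And>P. prime_ideal P \<Longrightarrow> rg.span (p ` {..<j}) \<subseteq> P \<Longrightarrow> prime_chain_to j P"
        using alt by blast
      have ne: "\<not> set Ps \<subseteq> {\<mm>}" using all_m[OF Ps(2)] False by blast
      have "\<not> \<mm> \<subseteq> P" if "P \<in> set Ps - {\<mm>}" for P
        using that Ps(1) prime_subset_local[OF nl, of P] by blast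
      then have "\<exists>x\<in>\<mm>. \<forall>P\<in>set Ps - {\<mm>}. x \<notin> P"
        using Ps(1) subm by (intro prime_avoidance) auto
      then obtain x where x: "x \<in> \<mm>" "\<And>P. P \<in> set Ps \<Longrightarrow> P \<noteq> \<mm> \<Longrightarrow> x \<notin> P" by blast
      have "prime_chain_to (Suc j) P"
        if P: "prime_ideal P" "rg.span (p(j := x) ` {..<Suc j}) \<subseteq> P" for P
      proof -
        have "\<exists>P'\<in>set Ps. P' \<subseteq> P"
          by (rule prime_contains_factor[OF P(1)]) (use Ps(2) P(2) sp in blast)
        then obtain P' where P': "P' \<in> set Ps" "P' \<subseteq> P" by blast
        have xP: "x \<in> P" using P(2) rg.span_base[of x "p(j := x) ` {..<Suc j}"] by auto
        have "\<exists>P''\<in>set Ps. P'' \<subset> P"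
        \<comment> \<open>The new parameter avoids only the primes other than \<open>\<mm>\<close>.
          If the prime found below \<open>P\<close> is \<open>\<mm>\<close> itself, then
          \<open>P = \<mm>\<close>, and by \<open>ne\<close> some other prime of the list is
          strictly smaller.\<close>
        proof (cases "P' = \<mm>")
          case True
          then have "P = \<mm>" using P'(2) prime_subset_local[OF nl P(1)] by (intro subset_antisym) simp_all
          moreover obtain P'' where "P'' \<in> set Ps" "P'' \<noteq> \<mm>" using ne by blast
          moreover have "P'' \<subseteq> \<mm>"
            using Ps(1) \<open>P'' \<in> set Ps\<close> prime_subset_local[OF nl] by simp
          ultimately show ?thesis by blast
        next
          case False
          then show ?thesis using x P' xP by blast
        qed
        then show ?thesis using prime_chain_to_Suc[OF chain] Ps P(1) by blast
      qed
      then show ?thesis using px[OF x(1)] by blast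
    qed
  qed
  obtain p where p: "\<forall>i<d. p i \<in> \<mm>" and
    alt: "(\<exists>c. \<forall>w. set w \<subseteq> \<mm> \<and> length w = c \<longrightarrow> prod_list w \<in> rg.span (p ` {..<d})) \<or>
       (\<forall>P. prime_ideal P \<and> rg.span (p ` {..<d}) \<subseteq> P \<longrightarrow> prime_chain_to d P)"
    using step[of d] by blast
  have "\<exists>c. \<forall>w. set w \<subseteq> \<mm> \<and> length w = c \<longrightarrow> prod_list w \<in> rg.span (p ` {..<d})"
  proof (rule ccontr)
    assume neg: "\<not> ?thesis"
    obtain Ps where Ps: "\<forall>P\<in>set Ps. prime_ideal P \<and> rg.span (p ` {..<d}) \<subseteq> P"
      "\<And>xs. list_all2 (\<in>) xs Ps \<Longrightarrow> prod_list xs \<in> rg.span (p ` {..<d})"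
      using ideal_contains_prime_product[OF noeth rg.subspace_span[of "p ` {..<d}"]] by blast
    \<comment> \<open>A list consisting of \<open>\<mm>\<close> only would mean that a power of
      \<open>\<mm>\<close> is reached. Any other prime of the list ends a chain of length
      \<open>d\<close>, which \<open>\<mm>\<close> prolongs beyond the dimension.\<close>
    have "\<not> set Ps \<subseteq> {\<mm>}" using all_m[OF Ps(2)] neg by blast
    then obtain P where P: "P \<in> set Ps" "P \<noteq> \<mm>" by blast
    then have "P \<subset> \<mm>" "prime_chain_to d P" using Ps alt neg prime_subset_local[OF nl] by blast+
    then have "prime_chain_to (Suc d) \<mm>" using prime_chain_to_Suc prm by blast
    from krull_dim_chain_bound[OF kd this] show False by simp
  qed
  then obtain c where "\<And>w. set w \<subseteq> \<mm> \<Longrightarrow> length w = c \<Longrightarrow> prod_list w \<in> rg.span (p ` {..<d})" by blast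
  with p show ?thesis by (intro that[of p c]) simp_all
qed

text \<open>If all products of \<open>N\<close> elements of \<open>\<mm>\<close> vanished, every
  prime would contain the powers \<open>x ^ N\<close> for x in \<open>\<mm>\<close>, hence
  \<open>\<mm>\<close>; there would be a single prime and the dimension would be 0.\<close>

lemma local_not_nilpotent:
  assumes nl: "noetherian_local_ring (\<mm> :: 'a::comm_ring_1 set) \<pi>"
    and kd: "krull_dim (ring_of_type_algebra :: 'a ring) = enat d" and "d > 0"
  shows "\<exists>w. set w \<subseteq> \<mm> \<and> length w = N \<and> prod_list w \<noteq> 0"
proof (rule ccontr)
  assume neg: "\<not> ?thesis"
  have all_eq: "P = \<mm>" if P: "prime_ideal P" for P
  proof
    show "P \<subseteq> \<mm>" by (rule prime_subset_local[OF nl P])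
    show "\<mm> \<subseteq> P"
    proof
      fix x assume "x \<in> \<mm>"
      then have "prod_list (replicate N x) = 0" using neg by (metis length_replicate set_replicate_conv_if
            empty_subsetI insert_subset)
      then have "prod_list (replicate N x) \<in> P"
        using P rg.subspace_0 by (auto simp: prime_ideal_def)
      from prime_ideal_prod_list[OF P this] show "x \<in> P" by auto
    qed
  qed
  have "enat 1 \<le> krull_dim (ring_of_type_algebra :: 'a ring)" using kd \<open>d > 0\<close> by simp
  moreover have "krull_dim (ring_of_type_algebra :: 'a ring) \<le> 0"
    unfolding krull_dim_def
  proof (rule Sup_least, clarsimp simp: primeideal_type_algebra_iff)
    fix n C assume C: "\<forall>i\<le>n. prime_ideal (C i :: 'a set)" "\<forall>i<n. C i \<subset> C (Suc i)"
    show "enat n = 0"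
    proof (cases n)
      case (Suc k)
      then have "C 0 \<subset> C 1" "C 0 = \<mm>" "C 1 = \<mm>" using C all_eq by auto
      then show ?thesis by simp
    qed (simp add: enat_0)
  qed
  ultimately have "enat 1 \<le> 0" by (rule order.trans)
  then show False unfolding zero_enat_def enat_ord_simps by simp
qed

section \<open>Modules over a local ring\<close>

text \<open>A length argument without lengths: filtered by \<open>wt\<close>, the module generated
  by the \<open>n i\<close> modulo \<open>N\<close> has at most \<open>card I\<close> simple
  factors, so the spans of the tails of a longer sequence cannot all descend strictly. The order on
  \<open>J\<close> will encode the powers of a parameter.\<close>

lemma (in Modules.module) exists_mem_span_later:
  fixes n :: "'i \<Rightarrow> 'b" and v :: "'j::linorder \<Rightarrow> 'b" and wt :: "'i \<Rightarrow> nat"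
  assumes unit: "\<And>x :: 'a. x \<notin> \<mm> \<Longrightarrow> \<exists>y. x * y = 1"
    and "finite I" "finite J" "card I < card J"
    and N: "subspace N"
    and "\<And>i x. i \<in> I \<Longrightarrow> x \<in> \<mm> \<Longrightarrow> x *s n i \<in> span (n ` {i' \<in> I. wt i < wt i'} \<union> N)"
    and "\<And>j. j \<in> J \<Longrightarrow> v j \<in> span (n ` I \<union> N)"
  shows "\<exists>j\<in>J. v j \<in> span (v ` {j' \<in> J. j < j'} \<union> N)"
  using assms(2-4,6,7)
proof (induction "card I" arbitrary: I J v)
  case 0
  then have "I = {}" "J \<noteq> {}" by auto
  then show ?case using 0 by (auto simp: span_eq_iff[THEN iffD2, OF N] intro: span_superset[THEN subsetD])
next
  case (Suc k)
  then have "I \<noteq> {}" by auto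
  \<comment> \<open>A lightest generator is eliminated, since it does not occur among the strictly
    heavier ones of any other generator; so the hypothesis on multiples by \<open>\<mm>\<close>
    survives its removal.\<close>
  have "Min (wt ` I) \<in> wt ` I" using \<open>I \<noteq> {}\<close> Suc.prems(1) by (intro Min_in) auto
  then obtain i0 where i0: "i0 \<in> I" "Min (wt ` I) = wt i0" by auto
  then have min: "wt i0 \<le> wt i" if "i \<in> I" for i
    using that Suc.prems(1) by (metis Min_le finite_imageI imageI)
  define I' where "I' = I - {i0}"
  have I': "finite I'" "card I' = k" "k < card J" using Suc.hyps(2) Suc.prems(1,3) i0 by (auto simp: I'_def)
  have insI: "n ` I \<union> N = insert (n i0) (n ` I' \<union> N)" using i0 by (auto simp: I'_def)
  let ?V = "span (n ` I' \<union> N)"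
  have "\<exists>w. v j - w *s n i0 \<in> ?V" if "j \<in> J" for j
    using Suc.prems(5)[OF that] unfolding insI span_breakdown_eq .
  then obtain w where w: "\<And>j. j \<in> J \<Longrightarrow> v j - w j *s n i0 \<in> ?V" by metis
  have wm: "v j \<in> ?V" if "j \<in> J" "w j \<in> \<mm>" for j
  proof -
    have "span (n ` {i' \<in> I. wt i0 < wt i'} \<union> N) \<subseteq> ?V" by (rule span_mono) (auto simp: I'_def)
    then have "w j *s n i0 \<in> ?V" using Suc.prems(4)[OF i0(1) that(2)] by blast
    from span_add[OF w[OF that(1)] this] show ?thesis by simp
  qed
  have step': "x *s n i \<in> span (n ` {i' \<in> I'. wt i < wt i'} \<union> N)" if "i \<in> I'" "x \<in> \<mm>" for i x
  proof -
    have "{i' \<in> I. wt i < wt i'} = {i' \<in> I'. wt i < wt i'}" using min[of i] that by (auto simp: I'_def)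
    then show ?thesis using Suc.prems(4)[of i x] that by (auto simp: I'_def)
  qed
  show ?case
  proof (cases "\<forall>j\<in>J. w j \<in> \<mm>")
    case True
    show ?thesis
      by (rule Suc.hyps(1)[OF I'(2)[symmetric] I'(1) Suc.prems(2)]) (use I' step' wm True in auto)
  next
    case False
    \<comment> \<open>The pivot is the last index with a unit coefficient. Later vectors have
      coefficient in \<open>\<mm>\<close> and already lie in \<open>?V\<close>; only earlier vectors
      are changed, by multiples of the later \<open>v j0\<close>, so relations for the new vectors
      still involve later indices only.\<close>
    define j0 where "j0 = Max {j \<in> J. w j \<notin> \<mm>}"
    have "j0 \<in> {j \<in> J. w j \<notin> \<mm>}" unfolding j0_def using False Suc.prems(2) by (intro Max_in) auto
    then have j0: "j0 \<in> J" "w j0 \<notin> \<mm>" by auto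
    have j0_max: "w j \<in> \<mm>" if "j \<in> J" "j0 < j" for j
    proof (rule ccontr)
      assume "w j \<notin> \<mm>"
      then have "j \<le> j0" unfolding j0_def using that Suc.prems(2) by (intro Max_ge) auto
      then show False using that by simp
    qed
    obtain u where u: "w j0 * u = 1" using unit j0 by blast
    define J' where "J' = J - {j0}"
    define v' where "v' j = (if j < j0 then v j - (w j * u) *s v j0 else v j)" for j
    have v': "v' j \<in> ?V" if "j \<in> J'" for j
    proof (cases "j < j0")
      case True
      have "w j * u * w j0 = w j" using u by (metis mult.assoc mult.commute mult.right_neutral)
      then have "v' j = (v j - w j *s n i0) - (w j * u) *s (v j0 - w j0 *s n i0)"
        using True by (simp add: v'_def scale_right_diff_distrib)
      then show ?thesis
        using w[of j] w[of j0] j0 that by (auto simp: J'_def intro!: span_diff span_scale)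
    next
      case False
      then have "j0 < j" using that by (auto simp: J'_def)
      then show ?thesis using wm[of j] j0_max[of j] that by (auto simp: J'_def v'_def)
    qed
    have "\<exists>j\<in>J'. v' j \<in> span (v' ` {j' \<in> J'. j < j'} \<union> N)"
      by (rule Suc.hyps(1)[OF I'(2)[symmetric] I'(1)])
        (use I' step' v' Suc.prems(2,3) Suc.hyps(2) j0 in \<open>auto simp: J'_def\<close>)
    then obtain j where j: "j \<in> J'" "v' j \<in> span (v' ` {j' \<in> J'. j < j'} \<union> N)" by blast
    let ?W = "span (v ` {j' \<in> J. j < j'} \<union> N)"
    have inW: "v j' \<in> ?W" if "j' \<in> J" "j < j'" for j' using that by (intro span_base) auto
    have v'W: "v' j' \<in> ?W" if "j' \<in> J'" "j < j'" for j'
      using that inW[of j'] inW[of j0] j0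
      by (auto simp: v'_def J'_def intro!: span_diff span_scale)
    have "span (v' ` {j' \<in> J'. j < j'} \<union> N) \<subseteq> ?W"
      by (rule span_minimal) (use v'W span_superset[of "v ` {j' \<in> J. j < j'} \<union> N"] in auto)
    then have "v' j \<in> ?W" using j by blast
    have "v j \<in> ?W"
    proof (cases "j < j0")
      case True
      then have "v j = v' j + (w j * u) *s v j0" by (simp add: v'_def)
      then show ?thesis using \<open>v' j \<in> ?W\<close> inW[OF j0(1) True] by (simp only: span_add span_scale)
    next
      case False
      then show ?thesis using \<open>v' j \<in> ?W\<close> by (simp add: v'_def)
    qed
    then show ?thesis using j by (auto simp: J'_def)
  qed
qed

text \<open>
  A graded form of the Cayley--Hamilton argument, proved by eliminating one generator \<open>P w\<close> after
  the other. The degrees are trivial when it is used for Nakayama's lemma.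
\<close>

lemma graded_elimination:
  fixes T I :: "nat \<Rightarrow> 'b::comm_ring_1 set"
  assumes T1: "1 \<in> T 0"
    and Tm: "\<And>m n x y. x \<in> T m \<Longrightarrow> y \<in> T n \<Longrightarrow> x * y \<in> T (m + n)"
    and Td: "\<And>n x y. x \<in> T n \<Longrightarrow> y \<in> T n \<Longrightarrow> x - y \<in> T n"
    and IT: "\<And>n. I n \<subseteq> T n" and I0: "\<And>n. 0 \<in> I n"
    and Id: "\<And>n x y. x \<in> I n \<Longrightarrow> y \<in> I n \<Longrightarrow> x - y \<in> I n"
    and Im: "\<And>m n x y. x \<in> I m \<Longrightarrow> y \<in> T n \<Longrightarrow> x * y \<in> I (m + n)"
    and N0: "0 \<in> N" and Na: "\<And>x y. x \<in> N \<Longrightarrow> y \<in> N \<Longrightarrow> x + y \<in> N"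
    and Nm: "\<And>n x y. x \<in> T n \<Longrightarrow> y \<in> N \<Longrightarrow> x * y \<in> N"
    and "finite W" "f \<in> T k"
    and "\<And>w. w \<in> W \<Longrightarrow> \<exists>a. (\<forall>w'\<in>W. a w' \<in> I k) \<and> f * P w - (\<Sum>w'\<in>W. a w' * P w') \<in> N"
  shows "\<exists>E g. g \<in> T (k * E) \<and> g - f ^ E \<in> I (k * E) \<and> (\<forall>w\<in>W. g * P w \<in> N)"
  using assms(11-13)
proof (induction W arbitrary: f k rule: finite_induct)
  case empty
  show ?case by (rule exI[of _ 0], rule exI[of _ 1]) (simp add: T1 I0)
next
  case (insert w0 W)
  have Ia: "x + y \<in> I n" if "x \<in> I n" "y \<in> I n" for n x y
    using Id[OF that(1) Id[OF I0 that(2)]] by simp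
  have Im': "y * x \<in> I (m + n)" if "x \<in> I m" "y \<in> T n" for m n x y
    using Im[OF that] by (simp add: mult.commute)
  have pw: "x ^ m \<in> T (j * m)" if "x \<in> T j" for x j m
  proof (induction m)
    case (Suc m)
    then show ?case using Tm[OF that Suc] by simp
  qed (simp add: T1)
  have Nsum: "sum h A \<in> N" if "\<And>x. x \<in> A \<Longrightarrow> h x \<in> N" for h and A :: "'c set"
    using that by (induction A rule: infinite_finite_induct) (auto simp: N0 Na)
  obtain a where a: "\<And>w w'. w \<in> insert w0 W \<Longrightarrow> w' \<in> insert w0 W \<Longrightarrow> a w w' \<in> I k"
    "\<And>w. w \<in> insert w0 W \<Longrightarrow> f * P w - (\<Sum>w'\<in>insert w0 W. a w w' * P w') \<in> N"
    using insert.prems(2) by metis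
  \<comment> \<open>Moving the diagonal coefficient to the left expresses \<open>e * P w0\<close>
    through the other generators. Multiplying the other relations by \<open>e\<close> then
    eliminates \<open>P w0\<close>, at the price of replacing \<open>f\<close> by
    \<open>e * f\<close> and the degree \<open>k\<close> by \<open>k + k\<close>.\<close>
  define e where "e = f - a w0 w0"
  have e: "e \<in> T k" unfolding e_def using a(1)[of w0 w0] IT insert.prems(1) by (intro Td) auto
  have ef: "e - f \<in> I k" unfolding e_def using Id[OF I0 a(1)[of w0 w0]] by simp
  define r where "r w = f * P w - (\<Sum>w'\<in>insert w0 W. a w w' * P w')" for w
  have r: "r w \<in> N" if "w \<in> insert w0 W" for w using a(2)[OF that] by (simp add: r_def)
  have eP: "e * P w0 = (\<Sum>w'\<in>W. a w0 w' * P w') + r w0"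
    using insert.hyps by (simp add: e_def r_def algebra_simps)
  have fP: "f * P w = a w w0 * P w0 + (\<Sum>w'\<in>W. a w w' * P w') + r w" for w
    using insert.hyps by (simp add: r_def algebra_simps)
  have "\<exists>b. (\<forall>w'\<in>W. b w' \<in> I (k + k)) \<and> e * f * P w - (\<Sum>w'\<in>W. b w' * P w') \<in> N" if w: "w \<in> W" for w
  proof (intro exI[of _ "\<lambda>w'. a w w0 * a w0 w' + e * a w w'"] conjI ballI)
    fix w' assume "w' \<in> W"
    then show "a w w0 * a w0 w' + e * a w w' \<in> I (k + k)"
      using a(1)[of w w0] a(1)[of w0 w'] a(1)[of w w'] w e IT by (intro Ia Im Im') auto
  next
    have "e * f * P w = e * (f * P w)" by (simp add: mult.assoc)
    also have "\<dots> = a w w0 * (e * P w0) + (\<Sum>w'\<in>W. e * a w w' * P w') + e * r w"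
      unfolding fP by (simp add: algebra_simps sum_distrib_left)
    also have "\<dots> = (\<Sum>w'\<in>W. (a w w0 * a w0 w' + e * a w w') * P w') + (a w w0 * r w0 + e * r w)"
      unfolding eP by (simp add: algebra_simps sum_distrib_left sum.distrib)
    finally have "e * f * P w - (\<Sum>w'\<in>W. (a w w0 * a w0 w' + e * a w w') * P w') = a w w0 * r w0 + e * r w"
      by simp
    moreover have "a w w0 * r w0 + e * r w \<in> N"
      using a(1)[of w w0] w IT e r by (intro Na Nm) auto
    ultimately show "e * f * P w - (\<Sum>w'\<in>W. (a w w0 * a w0 w' + e * a w w') * P w') \<in> N" by simp
  qed
  from insert.IH[OF Tm[OF e insert.prems(1)] this] obtain E g where g:
    "g \<in> T ((k + k) * E)" "g - (e * f) ^ E \<in> I ((k + k) * E)" "\<forall>w\<in>W. g * P w \<in> N" by blast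
  have diff: "e ^ m - f ^ m \<in> I (k * m)" for m
  proof (induction m)
    case (Suc m)
    have "e ^ Suc m - f ^ Suc m = e * (e ^ m - f ^ m) + (e - f) * f ^ m" by (simp add: algebra_simps)
    also have "\<dots> \<in> I (k + k * m)"
      using Im'[OF Suc e] Im[OF ef pw[OF insert.prems(1)]] by (intro Ia) (simp_all add: add.commute)
    finally show ?case by simp
  qed (simp add: I0)
  \<comment> \<open>The element for the larger set is \<open>e * g\<close>: the factor
    \<open>e\<close> turns \<open>P w0\<close> into a combination of generators that
    \<open>g\<close> sends into \<open>N\<close>. Since \<open>g\<close> is congruent to
    \<open>(e * f) ^ E\<close> and \<open>e\<close> to \<open>f\<close>, the exponent becomes
    \<open>2 * E + 1\<close>.\<close>
  have deg: "k + (k + k) * E = k * Suc (2 * E)" by (simp add: algebra_simps)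
  have "e * g \<in> T (k * Suc (2 * E))" using Tm[OF e g(1)] unfolding deg .
  moreover have "e * g - f ^ Suc (2 * E) \<in> I (k * Suc (2 * E))"
  proof -
    have "f ^ E * f ^ E = f ^ (2 * E)" by (simp add: mult_2 power_add)
    then have "e * g - f ^ Suc (2 * E) = (g - (e * f) ^ E) * e + (e ^ Suc E - f ^ Suc E) * f ^ E"
      by (simp add: algebra_simps power_mult_distrib)
    also have "\<dots> \<in> I (k * Suc (2 * E))"
    proof (rule Ia)
      show "(g - (e * f) ^ E) * e \<in> I (k * Suc (2 * E))"
        using Im[OF g(2) e] deg by (simp add: add.commute)
      have "k * Suc E + k * E = k * Suc (2 * E)" by (simp add: algebra_simps)
      then show "(e ^ Suc E - f ^ Suc E) * f ^ E \<in> I (k * Suc (2 * E))"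
        using Im[OF diff[of "Suc E"] pw[OF insert.prems(1), of E]] by (simp only:)
    qed
    finally show ?thesis .
  qed
  moreover have "e * g * P w \<in> N" if "w \<in> insert w0 W" for w
  proof (cases "w = w0")
    case True
    have "e * g * P w0 = g * (e * P w0)" by (simp add: algebra_simps)
    also have "\<dots> = (\<Sum>w'\<in>W. a w0 w' * (g * P w')) + g * r w0"
      unfolding eP by (simp add: algebra_simps sum_distrib_left)
    also have "\<dots> \<in> N"
    proof (intro Na Nsum)
      show "a w0 w' * (g * P w') \<in> N" if "w' \<in> W" for w'
        using a(1)[of w0 w'] IT[of k] g(3) that by (intro Nm[of "a w0 w'" k "g * P w'"]) auto
      show "g * r w0 \<in> N" using Nm[OF g(1) r] by simp
    qed
    finally show ?thesis using True by simp
  next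
    case False
    then show ?thesis using Nm[OF e] g(3) that by (simp add: mult.assoc)
  qed
  ultimately show ?case by blast
qed

text \<open>Apply longer and longer prefixes of \<open>w\<close> to \<open>v\<close> and adjoin the
  result to \<open>M\<close>. This is a chain between \<open>M\<close> and \<open>F\<close>, so
  among more letters than the colength two neighbours coincide. Nakayama's lemma for a cyclic module
  puts that prefix product into \<open>M\<close>, and all longer ones with it.\<close>

lemma (in Modules.module) finite_colength_absorbs:
  assumes unit: "\<And>x :: 'a. x \<notin> \<mm> \<Longrightarrow> \<exists>y. x * y = 1"
    and "rg.subspace \<mm>" "1 \<notin> \<mm>"
    and fc: "finite_colength_submodule scale F M" and F: "subspace F"
  shows "\<exists>c. \<forall>w v. set w \<subseteq> \<mm> \<longrightarrow> c \<le> length w \<longrightarrow> v \<in> F \<longrightarrow> prod_list w *s v \<in> M"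
proof -
  have M: "subspace M" "M \<subseteq> F" using fc by (auto simp: finite_colength_submodule_def)
  obtain l where l: "quotient_length scale F M = enat l"
    using fc by (auto simp: finite_colength_submodule_def)
  show ?thesis
  proof (intro exI[of _ "Suc l"] allI impI)
    fix w v assume w: "set w \<subseteq> \<mm>" "Suc l \<le> length w" and v: "v \<in> F"
    define pw where "pw j = prod_list (take j w) *s v" for j
    have pw_Suc: "pw (Suc j) = w ! j *s pw j" if "j < length w" for j
      using that by (simp add: pw_def take_Suc_conv_app_nth mult.commute)
    \<comment> \<open>Prefixes are taken in decreasing length, so that the chain ascends.\<close>
    define Q where "Q j = span (insert (pw (Suc l - j)) M)" for j
    have "Q i \<subseteq> F" for i unfolding Q_def
      by (rule span_minimal) (use M F v subspace_scale[OF F] in \<open>auto simp: pw_def\<close>)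
    moreover have "M \<subseteq> Q i" for i unfolding Q_def using span_superset by blast
    moreover have mono: "Q i \<subseteq> Q (Suc i)" if "i < Suc l" for i
    proof -
      have "pw (Suc (l - i)) = w ! (l - i) *s pw (l - i)" using that w(2) by (intro pw_Suc) auto
      moreover have "pw (l - i) \<in> Q (Suc i)" unfolding Q_def by (rule span_base) simp
      ultimately have "pw (Suc l - i) \<in> Q (Suc i)"
        using that by (simp add: Q_def Suc_diff_le span_scale)
      then show ?thesis unfolding Q_def[of i]
        by (intro span_minimal) (auto simp: Q_def intro: span_base)
    qed
    moreover have "\<not> (\<forall>i<Suc l. Q i \<subset> Q (Suc i))"
    proof
      assume "\<forall>i<Suc l. Q i \<subset> Q (Suc i)"
      then have "enat (Suc l) \<le> quotient_length scale F M"
        unfolding quotient_length_def using \<open>\<And>i. Q i \<subseteq> F\<close> \<open>\<And>i. M \<subseteq> Q i\<close>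
        by (intro Sup_upper CollectI exI[of _ "Suc l"] conjI exI[of _ Q]) (auto simp: Q_def)
      then show False using l by simp
    qed
    ultimately obtain i where i: "i < Suc l" "Q i = Q (Suc i)" by blast
    define k where "k = l - i"
    have k: "k < length w" using i w by (auto simp: k_def)
    have "pw k \<in> Q (Suc i)" using i by (auto simp: Q_def k_def intro: span_base)
    then have "pw k \<in> span (insert (pw (Suc k)) M)" using i by (simp add: Q_def k_def Suc_diff_le)
    then obtain b where "pw k - b *s pw (Suc k) \<in> M"
      unfolding span_breakdown_eq span_eq_iff[THEN iffD2, OF M(1)] by blast
    moreover have "pw k - b *s pw (Suc k) = (1 - b * w ! k) *s pw k"
      by (simp add: pw_Suc[OF k] scale_left_diff_distrib)
    moreover have "1 - b * w ! k \<notin> \<mm>"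
    proof
      have "w ! k \<in> \<mm>" using w k by (meson nth_mem subsetD)
      then have "b * w ! k \<in> \<mm>" using assms(2) by (simp add: rg.subspace_scale)
      moreover assume "1 - b * w ! k \<in> \<mm>"
      ultimately show False using rg.subspace_add[OF assms(2), of "1 - b * w ! k" "b * w ! k"] assms(3) by simp
    qed
    then obtain u where "(1 - b * w ! k) * u = 1" using unit by blast
    then have "pw k = u *s ((1 - b * w ! k) *s pw k)" by (simp add: mult.commute)
    ultimately have "pw k \<in> M" using subspace_scale[OF M(1)] by metis
    moreover have "prod_list w *s v = prod_list (drop k w) *s pw k"
      by (simp add: pw_def) (metis append_take_drop_id mult.commute prod_list.append)
    ultimately show "prod_list w *s v \<in> M" using subspace_scale[OF M(1)] by simp
  qed
qed

text \<open>Induction on the number of generators of the ambient module. The possible coefficients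
  of the last generator in elements of \<open>M\<close> form an ideal \<open>L\<close>; lifts of
  finitely many generators of \<open>L\<close>, together with generators of the part of
  \<open>M\<close> in the span of the earlier ones, generate \<open>M\<close>.\<close>

lemma (in Modules.module) noetherian_subspace_fin_gen:
  assumes "noetherian_ring (ring_of_type_algebra :: 'a ring)"
    and "subspace M" "M \<subseteq> span (e ` {..<r :: nat})"
  shows "\<exists>A. finite A \<and> M = span A"
  using assms(2,3)
proof (induction r arbitrary: M)
  case 0
  then have "M = span {}" using subspace_0 by auto
  then show ?case by blast
next
  case (Suc r)
  let ?V = "span (e ` {..<r})"
  define L where "L = {c. \<exists>v\<in>?V. c *s e r + v \<in> M}"
  have "rg.subspace L"
  proof (rule rg.subspaceI)
    show "0 \<in> L" using subspace_0[OF Suc.prems(1)] span_zero by (auto simp: L_def intro: bexI[of _ 0])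
    fix x y assume "x \<in> L" "y \<in> L"
    then obtain u v where "u \<in> ?V" "v \<in> ?V" "x *s e r + u \<in> M" "y *s e r + v \<in> M" by (auto simp: L_def)
    then show "x + y \<in> L" using subspace_add[OF Suc.prems(1), of "x *s e r + u" "y *s e r + v"]
      by (auto simp: L_def scale_left_distrib algebra_simps intro!: bexI[of _ "u + v"] span_add)
  next
    fix c x assume "x \<in> L"
    then obtain u where "u \<in> ?V" "x *s e r + u \<in> M" by (auto simp: L_def)
    then show "c * x \<in> L" using subspace_scale[OF Suc.prems(1), of "x *s e r + u" c]
      by (auto simp: L_def scale_right_distrib intro!: bexI[of _ "c *s u"] span_scale)
  qed
  then obtain A where A: "finite A" "L = rg.span A" using noetherian_fin_gen[OF assms(1)] by blast
  then have "\<forall>a\<in>A. \<exists>v. v \<in> ?V \<and> a *s e r + v \<in> M" using rg.span_superset[of A] unfolding L_def by blast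
  then obtain v where v: "\<And>a. a \<in> A \<Longrightarrow> v a \<in> ?V \<and> a *s e r + v a \<in> M" by metis
  define x where "x a = a *s e r + v a" for a
  have "subspace (M \<inter> ?V)" using Suc.prems(1) by (intro subspace_inter) auto
  from Suc.IH[OF this] obtain A' where A': "finite A'" "M \<inter> ?V = span A'" by auto
  have lift: "\<exists>y\<in>span (x ` A). y - c *s e r \<in> ?V" if "c \<in> rg.span A" for c
    using that
  proof (induction rule: rg.span_induct_alt)
    case base
    then show ?case using span_zero by (auto intro!: bexI[of _ 0])
  next
    case (step b a z)
    then obtain y where y: "y \<in> span (x ` A)" "y - z *s e r \<in> ?V" by blast
    have "b *s x a + y \<in> span (x ` A)"
      using step by (intro span_add[OF span_scale[OF span_base] y(1)]) auto
    moreover have "(b *s x a + y) - (b * a + z) *s e r = b *s v a + (y - z *s e r)"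
      by (simp add: x_def scale_left_distrib scale_right_distrib)
    moreover have "b *s v a + (y - z *s e r) \<in> ?V"
      using v step by (intro span_add[OF span_scale y(2)]) auto
    ultimately show ?case by (metis (no_types, lifting))
  qed
  have xM: "span (x ` A) \<subseteq> M" by (rule span_minimal) (use v Suc.prems(1) in \<open>auto simp: x_def\<close>)
  have "M = span (x ` A \<union> A')"
  proof
    have "A' \<subseteq> M" using A'(2) span_superset[of A'] by blast
    then show "span (x ` A \<union> A') \<subseteq> M"
      using xM span_superset[of "x ` A"] Suc.prems(1) by (intro span_minimal) auto
    show "M \<subseteq> span (x ` A \<union> A')"
    proof
      fix z assume z: "z \<in> M"
      have "e ` {..<Suc r} = insert (e r) (e ` {..<r})" by (auto simp: less_Suc_eq)
      then have "z \<in> span (insert (e r) (e ` {..<r}))" using z Suc.prems(2) by auto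
      then obtain c where c: "z - c *s e r \<in> ?V" unfolding span_breakdown_eq by blast
      then have "c \<in> L" using z by (auto simp: L_def intro!: bexI[of _ "z - c *s e r"])
      then obtain y where y: "y \<in> span (x ` A)" "y - c *s e r \<in> ?V" using lift A by blast
      have "y \<in> M" using xM y(1) by (rule subsetD)
      with Suc.prems(1) z have "z - y \<in> M" by (rule subspace_diff)
      moreover have "z - y \<in> ?V" using span_diff[OF c y(2)] by simp
      ultimately have "z - y \<in> span A'" using A' by blast
      then have "z - y \<in> span (x ` A \<union> A')" "y \<in> span (x ` A \<union> A')"
        using y(1) span_mono[of A' "x ` A \<union> A'"] span_mono[of "x ` A" "x ` A \<union> A'"] by blast+
      from span_add[OF this] show "z \<in> span (x ` A \<union> A')" by simp
    qed
  qed
  moreover have "finite (x ` A \<union> A')" using A A' by simp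
  ultimately show ?case by (intro exI[of _ "x ` A \<union> A'"] conjI)
qed

section \<open>Polynomial evaluation\<close>

definition monomial_eval :: "('v \<Rightarrow> 'a) \<Rightarrow> ('v \<Rightarrow>\<^sub>0 nat) \<Rightarrow> 'a::comm_ring_1" where
  "monomial_eval x t = (\<Prod>v\<in>Poly_Mapping.keys t. x v ^ Poly_Mapping.lookup t v)"

lemma monomial_eval_superset:
  assumes "finite V" "Poly_Mapping.keys t \<subseteq> V"
  shows "monomial_eval x t = (\<Prod>v\<in>V. x v ^ Poly_Mapping.lookup t v)"
  unfolding monomial_eval_def using assms
  by (intro prod.mono_neutral_left) (auto simp: in_keys_iff)

lemma monomial_eval_add: "monomial_eval x (s + t) = monomial_eval x s * monomial_eval x t"
proof -
  let ?V = "Poly_Mapping.keys s \<union> Poly_Mapping.keys t"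
  have "monomial_eval x (s + t) = (\<Prod>v\<in>?V. x v ^ Poly_Mapping.lookup (s + t) v)"
    by (intro monomial_eval_superset) (auto simp: keys_add)
  then show ?thesis
    by (simp add: monomial_eval_superset[of ?V s] monomial_eval_superset[of ?V t]
        lookup_add power_add prod.distrib)
qed

lemma mpoly_eval_superset:
  assumes "finite K" "Poly_Mapping.keys f \<subseteq> K"
  shows "mpoly_eval x f = (\<Sum>t\<in>K. Poly_Mapping.lookup f t * monomial_eval x t)"
  unfolding mpoly_eval_def monomial_eval_def[symmetric] using assms
  by (intro sum.mono_neutral_left) (auto simp: in_keys_iff)

lemma mpoly_eval_add: "mpoly_eval x (f + g) = mpoly_eval x f + mpoly_eval x g"
proof -
  let ?K = "Poly_Mapping.keys f \<union> Poly_Mapping.keys g"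
  have "mpoly_eval x (f + g) = (\<Sum>t\<in>?K. Poly_Mapping.lookup (f + g) t * monomial_eval x t)"
    by (intro mpoly_eval_superset) (auto simp: keys_add)
  then show ?thesis
    by (simp add: mpoly_eval_superset[of ?K f] mpoly_eval_superset[of ?K g]
        lookup_add distrib_right sum.distrib)
qed

lemma mpoly_eval_zero [simp]: "mpoly_eval x 0 = 0"
  by (simp add: mpoly_eval_def)

lemma mpoly_eval_sum: "mpoly_eval x (\<Sum>i\<in>A. f i) = (\<Sum>i\<in>A. mpoly_eval x (f i))"
  by (induction A rule: infinite_finite_induct) (auto simp: mpoly_eval_add)

lemma mpoly_eval_single: "mpoly_eval x (Poly_Mapping.single t c) = c * monomial_eval x t"
  by (simp add: mpoly_eval_superset[of "{t}"])

lemma mpoly_sum_singles: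
  assumes "finite K" "Poly_Mapping.keys f \<subseteq> K"
  shows "f = (\<Sum>t\<in>K. Poly_Mapping.single t (Poly_Mapping.lookup f t))"
proof (rule poly_mapping_eqI)
  fix s
  have "(\<Sum>t\<in>K. Poly_Mapping.lookup (Poly_Mapping.single t (Poly_Mapping.lookup f t)) s) =
      (\<Sum>t\<in>K. if t = s then Poly_Mapping.lookup f s else 0)"
    by (intro sum.cong) (auto simp: lookup_single when_def)
  then show "Poly_Mapping.lookup f s = Poly_Mapping.lookup (\<Sum>t\<in>K. Poly_Mapping.single t (Poly_Mapping.lookup f t)) s"
    using assms by (auto simp: lookup_sum in_keys_iff)
qed

lemma mpoly_eval_mult: "mpoly_eval x (f * g) = mpoly_eval x f * mpoly_eval x g"
proof -
  let ?f = "\<lambda>s. Poly_Mapping.lookup f s" and ?g = "\<lambda>t. Poly_Mapping.lookup g t"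
  have "f * g = (\<Sum>s\<in>Poly_Mapping.keys f. Poly_Mapping.single s (?f s)) *
      (\<Sum>t\<in>Poly_Mapping.keys g. Poly_Mapping.single t (?g t))"
    by (intro arg_cong2[where f = "(*)"] mpoly_sum_singles) auto
  then have "mpoly_eval x (f * g) = (\<Sum>s\<in>Poly_Mapping.keys f. \<Sum>t\<in>Poly_Mapping.keys g.
      ?f s * ?g t * (monomial_eval x s * monomial_eval x t))"
    by (simp only: sum_product mult_single mpoly_eval_sum mpoly_eval_single monomial_eval_add)
  also have "\<dots> = mpoly_eval x f * mpoly_eval x g"
    unfolding mpoly_eval_def monomial_eval_def[symmetric] sum_product
    by (intro sum.cong refl) (simp add: algebra_simps)
  finally show ?thesis .
qed

lemma mpoly_eval_one [simp]: "mpoly_eval x 1 = 1"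
  using mpoly_eval_single[of x 0 1] by (simp add: monomial_eval_def)

lemma mpoly_eval_prod: "mpoly_eval x (\<Prod>i\<in>A. f i) = (\<Prod>i\<in>A. mpoly_eval x (f i))"
  by (induction A rule: infinite_finite_induct) (auto simp: mpoly_eval_mult)

section \<open>Occurring variables, and points where finitely many polynomials are nonzero\<close>

definition mpoly_vars_in :: "'v set \<Rightarrow> ('v, 'a::comm_ring_1) mpoly \<Rightarrow> bool" where
  "mpoly_vars_in V f \<longleftrightarrow> (\<forall>t\<in>Poly_Mapping.keys f. Poly_Mapping.keys t \<subseteq> V)"

lemma mpoly_vars_in_mult: "mpoly_vars_in V f \<Longrightarrow> mpoly_vars_in V g \<Longrightarrow> mpoly_vars_in V (f * g)"
proof (unfold mpoly_vars_in_def, intro ballI)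
  fix t
  assume f: "\<forall>t\<in>Poly_Mapping.keys f. Poly_Mapping.keys t \<subseteq> V"
    and g: "\<forall>t\<in>Poly_Mapping.keys g. Poly_Mapping.keys t \<subseteq> V"
    and "t \<in> Poly_Mapping.keys (f * g)"
  then obtain a b where "t = a + b" "a \<in> Poly_Mapping.keys f" "b \<in> Poly_Mapping.keys g"
    using keys_mult[of f g] by blast
  then show "Poly_Mapping.keys t \<subseteq> V" using f g Poly_Mapping.keys_add[of a b] by blast
qed

lemma mpoly_vars_in_prod:
  "(\<And>i. i \<in> A \<Longrightarrow> mpoly_vars_in V (f i)) \<Longrightarrow> mpoly_vars_in V (\<Prod>i\<in>A. f i)"
proof (induction A rule: infinite_finite_induct)
  case (insert x F)
  then show ?case by (auto intro: mpoly_vars_in_mult)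
qed (auto simp: mpoly_vars_in_def)

text \<open>Partial evaluation at \<open>v = c\<close>. Distinct monomials may merge when
  \<open>v\<close> is removed, hence a sum of singles.\<close>

definition mpoly_subst_var :: "'v \<Rightarrow> 'a \<Rightarrow> ('v, 'a::comm_ring_1) mpoly \<Rightarrow> ('v, 'a) mpoly" where
  "mpoly_subst_var v c f = (\<Sum>t\<in>Poly_Mapping.keys f.
     Poly_Mapping.single (Poly_Mapping.update v 0 t) (Poly_Mapping.lookup f t * c ^ Poly_Mapping.lookup t v))"

lemma monomial_eval_update:
  "monomial_eval (x(v := c)) t = c ^ Poly_Mapping.lookup t v * monomial_eval x (Poly_Mapping.update v 0 t)"
proof -
  let ?V = "insert v (Poly_Mapping.keys t)"
  have "monomial_eval (x(v := c)) t = (\<Prod>w\<in>?V. (x(v := c)) w ^ Poly_Mapping.lookup t w)"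
    by (rule monomial_eval_superset) auto
  also have "\<dots> = c ^ Poly_Mapping.lookup t v *
      (\<Prod>w\<in>Poly_Mapping.keys t - {v}. (x(v := c)) w ^ Poly_Mapping.lookup t w)"
    by (subst prod.insert_remove) auto
  also have "(\<Prod>w\<in>Poly_Mapping.keys t - {v}. (x(v := c)) w ^ Poly_Mapping.lookup t w) =
      monomial_eval x (Poly_Mapping.update v 0 t)"
    unfolding monomial_eval_def
    by (intro prod.cong) (auto simp: keys_update lookup_update)
  finally show ?thesis .
qed

lemma mpoly_eval_subst_var: "mpoly_eval x (mpoly_subst_var v c f) = mpoly_eval (x(v := c)) f"
  unfolding mpoly_subst_var_def mpoly_eval_sum mpoly_eval_single mpoly_eval_def[of _ f]
    monomial_eval_def[symmetric] monomial_eval_update by (simp only: mult.assoc)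

lemma mpoly_vars_in_subst_var:
  assumes "mpoly_vars_in (insert v V) f"
  shows "mpoly_vars_in V (mpoly_subst_var v c f)"
  unfolding mpoly_vars_in_def
proof
  fix s assume "s \<in> Poly_Mapping.keys (mpoly_subst_var v c f)"
  then obtain t where "t \<in> Poly_Mapping.keys f" "s = Poly_Mapping.update v 0 t"
    unfolding mpoly_subst_var_def using keys_sum by (fastforce split: if_splits)
  then show "Poly_Mapping.keys s \<subseteq> V" using assms by (auto simp: mpoly_vars_in_def keys_update)
qed

text \<open>The terms of \<open>f\<close> that agree with a fixed term outside \<open>v\<close> form
  a nonzero univariate polynomial \<open>P\<close>, and every \<open>c\<close> for which the
  substitution gives 0 is a root of \<open>P\<close>.\<close>

lemma finite_mpoly_subst_var_eq_zero:
  fixes f :: "('v, 'k::field) mpoly"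
  assumes "f \<noteq> 0"
  shows "finite {c. mpoly_subst_var v c f = 0}"
proof -
  obtain t0 where t0: "t0 \<in> Poly_Mapping.keys f" using assms by (metis keys_eq_empty ex_in_conv)
  define S where "S = {t \<in> Poly_Mapping.keys f. Poly_Mapping.update v 0 t = Poly_Mapping.update v 0 t0}"
  define P where "P = (\<Sum>t\<in>S. monom (Poly_Mapping.lookup f t) (Poly_Mapping.lookup t v))"
  have eq: "t = t0" if "t \<in> S" "Poly_Mapping.lookup t v = Poly_Mapping.lookup t0 v" for t
  proof (rule poly_mapping_eqI)
    fix w
    have "Poly_Mapping.lookup (Poly_Mapping.update v 0 t) w = Poly_Mapping.lookup (Poly_Mapping.update v 0 t0) w"
      using that by (simp add: S_def)
    then show "Poly_Mapping.lookup t w = Poly_Mapping.lookup t0 w"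
      using that by (cases "w = v") (auto simp: lookup_update)
  qed
  have "coeff P (Poly_Mapping.lookup t0 v) = (\<Sum>t\<in>S. if t = t0 then Poly_Mapping.lookup f t0 else 0)"
    unfolding P_def coeff_sum using eq by (intro sum.cong) auto
  also have "\<dots> \<noteq> 0" using t0 by (auto simp: S_def in_keys_iff)
  finally have "P \<noteq> 0" by auto
  moreover have "poly P c = 0" if "mpoly_subst_var v c f = 0" for c
  proof -
    have "0 = Poly_Mapping.lookup (mpoly_subst_var v c f) (Poly_Mapping.update v 0 t0)" using that by simp
    also have "\<dots> = (\<Sum>t\<in>Poly_Mapping.keys f. if t \<in> S then Poly_Mapping.lookup f t * c ^ Poly_Mapping.lookup t v else 0)"
      unfolding mpoly_subst_var_def lookup_sum
      by (intro sum.cong) (auto simp: lookup_single when_def S_def)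
    also have "\<dots> = poly P c"
      unfolding P_def poly_sum poly_monom by (subst sum.inter_filter[symmetric]) (auto simp: S_def)
    finally show ?thesis by simp
  qed
  ultimately show ?thesis
    using poly_roots_finite[of P] by (auto intro: finite_subset[of _ "{c. poly P c = 0}"])
qed

text \<open>The variables are assigned one at a time. Each polynomial excludes finitely many values,
  so an infinite field has a value that is good for the whole family.\<close>

lemma common_nonvanishing_point:
  fixes \<F> :: "('v, 'k::field) mpoly set"
  assumes "infinite (UNIV :: 'k set)" "finite V" "finite \<F>" "0 \<notin> \<F>"
    and "\<And>f. f \<in> \<F> \<Longrightarrow> mpoly_vars_in V f"
  shows "\<exists>x. \<forall>f\<in>\<F>. mpoly_eval x f \<noteq> 0"
  using assms(2-5)
proof (induction V arbitrary: \<F> rule: finite_induct)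
  case empty
  have "mpoly_eval x f \<noteq> 0" if "f \<in> \<F>" for x f
  proof -
    have k: "Poly_Mapping.keys f \<subseteq> {0}" using empty(3)[OF that] by (auto simp: mpoly_vars_in_def)
    then have "mpoly_eval x f = Poly_Mapping.lookup f 0"
      by (subst mpoly_eval_superset[of "{0}"]) (auto simp: monomial_eval_def)
    moreover have "Poly_Mapping.lookup f 0 \<noteq> 0"
    proof
      assume "Poly_Mapping.lookup f 0 = 0"
      then have "0 \<notin> Poly_Mapping.keys f" by (simp add: in_keys_iff)
      then have "Poly_Mapping.keys f = {}" using k by blast
      then show False using empty(2) that by simp
    qed
    ultimately show ?thesis by simp
  qed
  then show ?case by blast
next
  case (insert v V)
  have "finite (\<Union>f\<in>\<F>. {c. mpoly_subst_var v c f = 0})"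
  proof (rule finite_UN_I[OF insert.prems(1)])
    fix f assume "f \<in> \<F>"
    then have "f \<noteq> 0" using insert.prems(2) by metis
    then show "finite {c. mpoly_subst_var v c f = 0}" by (rule finite_mpoly_subst_var_eq_zero)
  qed
  then obtain c where c: "c \<notin> (\<Union>f\<in>\<F>. {c. mpoly_subst_var v c f = 0})"
    using assms(1) ex_new_if_finite by blast
  have "\<exists>x. \<forall>f\<in>mpoly_subst_var v c ` \<F>. mpoly_eval x f \<noteq> 0"
  proof (rule insert.IH)
    show "finite (mpoly_subst_var v c ` \<F>)" using insert.prems(1) by simp
    show "0 \<notin> mpoly_subst_var v c ` \<F>" using c by fastforce
    show "mpoly_vars_in V f" if "f \<in> mpoly_subst_var v c ` \<F>" for f
      using that insert.prems(3) mpoly_vars_in_subst_var by fastforce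
  qed
  then show ?case by (auto simp: mpoly_eval_subst_var)
qed

section \<open>The multigraded Rees algebra\<close>

interpretation mp: Modules.module "mpoly_scale :: 'a::comm_ring_1 \<Rightarrow> ('v, 'a) mpoly \<Rightarrow> ('v, 'a) mpoly"
  by (rule module_mpoly_scale)

declare mp.scale_scale [simp del]

lemma mpoly_const_simps [simp]:
  "mpoly_const 0 = 0" "mpoly_const 1 = 1"
  by (simp_all add: mpoly_const_def)

lemma mpoly_const_add: "mpoly_const (a + b) = mpoly_const a + mpoly_const b"
  by (simp add: mpoly_const_def single_add)

lemma mpoly_const_diff: "mpoly_const (a - b) = mpoly_const a - mpoly_const b"
  by (simp add: mpoly_const_def single_diff)

lemma mpoly_const_mult: "mpoly_const (a * b) = mpoly_const a * mpoly_const b"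
  by (simp add: mpoly_const_def mult_single)

lemma mpoly_const_power: "mpoly_const (a ^ n) = mpoly_const a ^ n"
  by (induction n) (simp_all add: mpoly_const_mult)

lemma mpoly_const_sum: "mpoly_const (\<Sum>i\<in>A. f i) = (\<Sum>i\<in>A. mpoly_const (f i))"
  by (induction A rule: infinite_finite_induct) (simp_all add: mpoly_const_add)

lemma mpoly_const_prod: "mpoly_const (\<Prod>i\<in>A. f i) = (\<Prod>i\<in>A. mpoly_const (f i))"
  by (induction A rule: infinite_finite_induct) (simp_all add: mpoly_const_mult)

lemma mpoly_const_inject: "mpoly_const a = mpoly_const b \<longleftrightarrow> a = b"
  unfolding mpoly_const_def by (metis lookup_single_eq)

lemma lookup_mpoly_const_mult:
  "Poly_Mapping.lookup (mpoly_const a * f) t = a * Poly_Mapping.lookup f t"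
proof -
  have "mpoly_const a * f = mpoly_const a *
      (\<Sum>t\<in>Poly_Mapping.keys f. Poly_Mapping.single t (Poly_Mapping.lookup f t))"
    by (rule arg_cong[OF mpoly_sum_singles]) auto
  also have "\<dots> = (\<Sum>t\<in>Poly_Mapping.keys f. Poly_Mapping.single t (a * Poly_Mapping.lookup f t))"
    by (simp add: mpoly_const_def sum_distrib_left mult_single)
  finally show ?thesis
    by (simp add: lookup_sum lookup_single when_def in_keys_iff)
qed

lemma mp_subspace_mult: "mp.subspace V \<Longrightarrow> f \<in> V \<Longrightarrow> mpoly_const a * f \<in> V"
  using mp.subspace_scale[of V f a] by (simp add: mpoly_scale_def)

lemma mpoly_scale_mult_left: "mpoly_scale a f * g = mpoly_scale a (f * g)"
  and mpoly_scale_mult_right: "f * mpoly_scale a g = mpoly_scale a (f * g)"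
  by (simp_all add: mpoly_scale_def algebra_simps)

lemma mp_subspace_mult_vimage:
  assumes "mp.subspace V"
  shows "mp.subspace {g. f * g \<in> V}" and "mp.subspace {g. g * f \<in> V}"
  by (rule mp.subspaceI;
      simp add: distrib_left distrib_right mpoly_scale_mult_left mpoly_scale_mult_right
        mp.subspace_0[OF assms] mp.subspace_add[OF assms] mp.subspace_scale[OF assms])+

lemma mp_span_mult_mem:
  assumes "mp.subspace V" "\<And>x y. x \<in> A \<Longrightarrow> y \<in> B \<Longrightarrow> x * y \<in> V" "f \<in> mp.span A" "g \<in> mp.span B"
  shows "f * g \<in> V"
proof -
  have "x * g \<in> V" if "x \<in> A" for x
    using assms(2,4) that mp.span_minimal[OF _ mp_subspace_mult_vimage(1)[OF assms(1)], of B x] by blast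
  then show ?thesis
    using assms(3) mp.span_minimal[OF _ mp_subspace_mult_vimage(2)[OF assms(1)], of A g] by blast
qed

lemma prod_lessThan_add:
  fixes f :: "nat \<Rightarrow> 'b::comm_monoid_mult"
  shows "(\<Prod>i<m + n. f i) = (\<Prod>i<m. f i) * (\<Prod>i<n. f (m + i))"
  by (induction n) (simp_all add: mult.assoc)

section \<open>Powers of an ideal given by generators\<close>

definition ideal_power :: "'a::comm_ring_1 set \<Rightarrow> nat \<Rightarrow> 'a set" where
  "ideal_power A j = rg.span {prod_list w | w. set w \<subseteq> A \<and> length w = j}"

lemma subspace_ideal_power [simp]: "rg.subspace (ideal_power A j)"
  by (simp add: ideal_power_def)

lemma prod_list_ideal_power: "set w \<subseteq> A \<Longrightarrow> prod_list w \<in> ideal_power A (length w)"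
  unfolding ideal_power_def by (intro rg.span_base) auto

lemma rg_subspace_mult_vimage:
  assumes "rg.subspace V"
  shows "rg.subspace {b. a * b \<in> V}" and "rg.subspace {b. b * a \<in> V}"
  by (rule rg.subspaceI;
      simp add: distrib_left distrib_right mult.assoc mult.left_commute[of a]
        rg.subspace_0[OF assms] rg.subspace_add[OF assms] rg.subspace_scale[OF assms])+

lemma rg_span_mult_mem:
  assumes "rg.subspace V" "\<And>x y. x \<in> A \<Longrightarrow> y \<in> B \<Longrightarrow> x * y \<in> V" "a \<in> rg.span A" "b \<in> rg.span B"
  shows "a * b \<in> V"
proof -
  have "x * b \<in> V" if "x \<in> A" for x
    using assms(2,4) that rg.span_minimal[OF _ rg_subspace_mult_vimage(1)[OF assms(1)], of B x] by blast
  then show ?thesis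
    using assms(3) rg.span_minimal[OF _ rg_subspace_mult_vimage(2)[OF assms(1)], of A b] by blast
qed

lemma ideal_power_mult:
  assumes "a \<in> ideal_power A i" "b \<in> ideal_power A j"
  shows "a * b \<in> ideal_power A (i + j)"
  using assms unfolding ideal_power_def[of A i] ideal_power_def[of A j]
proof (rule rg_span_mult_mem[OF subspace_ideal_power, rotated])
  fix x y assume "x \<in> {prod_list w |w. set w \<subseteq> A \<and> length w = i}"
    "y \<in> {prod_list w |w. set w \<subseteq> A \<and> length w = j}"
  then obtain v w where "x = prod_list v" "y = prod_list w" "set v \<subseteq> A" "set w \<subseteq> A"
    "length v = i" "length w = j" by auto
  then show "x * y \<in> ideal_power A (i + j)" using prod_list_ideal_power[of "v @ w" A] by simp
qed

text \<open>Elimination rule for a power of exponent \<open>i + j\<close>: words of this length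
  split into a prefix and a suffix, so products of elements of the two smaller powers are all that
  has to be checked.\<close>

lemma ideal_power_add_mem:
  assumes "s \<in> ideal_power A (i + j)" "rg.subspace V"
    and "\<And>a b. a \<in> ideal_power A i \<Longrightarrow> b \<in> ideal_power A j \<Longrightarrow> a * b \<in> V"
  shows "s \<in> V"
proof -
  have "{prod_list w | w. set w \<subseteq> A \<and> length w = i + j} \<subseteq> V"
  proof clarify
    fix w assume w: "set w \<subseteq> A" "length w = i + j"
    have "prod_list (take i w) \<in> ideal_power A i" "prod_list (drop i w) \<in> ideal_power A j"
      using prod_list_ideal_power[of "take i w" A] prod_list_ideal_power[of "drop i w" A] w
        set_take_subset[of i w] set_drop_subset[of i w] by auto
    from assms(3)[OF this] show "prod_list w \<in> V"
      by (metis append_take_drop_id prod_list.append)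
  qed
  then show ?thesis using assms(1,2) rg.span_minimal unfolding ideal_power_def by blast
qed

lemma ideal_power_0 [simp]: "ideal_power A 0 = UNIV"
  using prod_list_ideal_power[of "[]" A] subspace_eq_UNIV_iff[OF subspace_ideal_power] by auto

lemma ideal_power_antimono:
  assumes "i \<le> j"
  shows "ideal_power A j \<subseteq> ideal_power A i"
proof
  fix s assume "s \<in> ideal_power A j"
  then have "s \<in> ideal_power A (i + (j - i))" using assms by simp
  then show "s \<in> ideal_power A i"
    by (rule ideal_power_add_mem)
      (simp, metis mult.commute rg.subspace_scale subspace_ideal_power)
qed

lemma ideal_power_1: "ideal_power A 1 = rg.span A"
proof -
  have "{prod_list w | w. set w \<subseteq> A \<and> length w = 1} = A"
    by (auto simp: length_Suc_conv) (metis empty_set length_Cons list.simps(15) list.size(3)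
        mult.right_neutral prod_list.Cons prod_list.Nil singletonD insert_subset empty_subsetI One_nat_def)
  then show ?thesis by (simp add: ideal_power_def)
qed

text \<open>
  \<open>E i\<close> and \<open>g i a\<close> are \<open>M\<^sub>i\<close> and its generators, embedded into \<open>S(F)\<close>; \<open>p 0, \<dots>, p (d - 1)\<close> is
  a system of parameters and \<open>Z\<close> generates \<open>\<mm>\<close>.
\<close>

locale finite_colength_forms =
  fixes \<mm> Z :: "'a::comm_ring_1 set" and p :: "nat \<Rightarrow> 'a" and c d q :: nat and r m :: "nat \<Rightarrow> nat"
    and E :: "nat \<Rightarrow> (nat \<times> nat, 'a) mpoly set" and g :: "nat \<Rightarrow> nat \<Rightarrow> (nat \<times> nat, 'a) mpoly"
  assumes unit: "\<And>x. x \<notin> \<mm> \<Longrightarrow> \<exists>y. x * y = 1"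
    and subm: "rg.subspace \<mm>" and one_notin: "1 \<notin> \<mm>"
    and Z: "finite Z" "rg.span Z = \<mm>"
    and p_in: "\<And>i. i < d \<Longrightarrow> p i \<in> \<mm>"
    and c_pos: "c > 0"
    and pow_c: "\<And>w. set w \<subseteq> \<mm> \<Longrightarrow> length w = c \<Longrightarrow> prod_list w \<in> rg.span (p ` {..<d})"
    and not_nil: "\<And>n. \<exists>w. set w \<subseteq> \<mm> \<and> length w = n \<and> prod_list w \<noteq> 0"
    and d_pos: "d > 0" and d_le: "d \<le> q" and r_pos: "\<And>i. i < q \<Longrightarrow> r i \<ge> 1"
    and E_span: "\<And>i. i < q \<Longrightarrow> E i = mp.span (g i ` {..<m i})"
    and E_lin: "\<And>i. i < q \<Longrightarrow> E i \<subseteq> mp.span ((\<lambda>a. mpoly_var (i, a)) ` {..<r i})"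
    and E_absorbs: "\<And>i a w. i < q \<Longrightarrow> a < r i \<Longrightarrow> set w \<subseteq> \<mm> \<Longrightarrow> length w = c \<Longrightarrow>
      mpoly_const (prod_list w) * mpoly_var (i, a) \<in> E i"
begin

definition \<delta> :: "nat \<Rightarrow> nat \<Rightarrow> nat" where "\<delta> i j = (if j = i then 1 else 0)"

definition pure_prods :: "(nat \<Rightarrow> nat) \<Rightarrow> (nat \<times> nat, 'a) mpoly set" where
  "pure_prods D = {\<Prod>j<q. \<Prod>t<D j. h j t | h. \<forall>j<q. \<forall>t<D j. h j t \<in> E j}"

text \<open>The component \<open>S\<^bsub>D 0\<^esub>(M\<^sub>0) \<cdots> S\<^bsub>D (q - 1)\<^esub>(M\<^sub>q\<^sub>-\<^sub>1)\<close> of the Rees algebra.\<close>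

definition Rees :: "(nat \<Rightarrow> nat) \<Rightarrow> (nat \<times> nat, 'a) mpoly set" where
  "Rees D = mp.span (pure_prods D)"

lemma subspace_Rees [simp]: "mp.subspace (Rees D)"
  by (simp add: Rees_def)

lemma Rees_cong: "(\<And>j. j < q \<Longrightarrow> D j = D' j) \<Longrightarrow> Rees D = Rees D'"
  by (auto simp: Rees_def pure_prods_def intro!: arg_cong[where f = mp.span])

lemma pure_prods_mult:
  assumes "x \<in> pure_prods D" "y \<in> pure_prods D'"
  shows "x * y \<in> pure_prods (\<lambda>j. D j + D' j)"
proof -
  obtain h h' where h: "x = (\<Prod>j<q. \<Prod>t<D j. h j t)" "\<forall>j<q. \<forall>t<D j. h j t \<in> E j"
    and h': "y = (\<Prod>j<q. \<Prod>t<D' j. h' j t)" "\<forall>j<q. \<forall>t<D' j. h' j t \<in> E j"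
    using assms by (auto simp: pure_prods_def)
  let ?h = "\<lambda>j t. if t < D j then h j t else h' j (t - D j)"
  have "x * y = (\<Prod>j<q. \<Prod>t<D j + D' j. ?h j t)"
    by (simp add: h(1) h'(1) prod_lessThan_add prod.distrib)
  moreover have "\<forall>j<q. \<forall>t<D j + D' j. ?h j t \<in> E j" using h(2) h'(2) by auto
  ultimately show ?thesis unfolding pure_prods_def by (intro CollectI exI[of _ ?h] conjI)
qed

lemma Rees_mult: "x \<in> Rees D \<Longrightarrow> y \<in> Rees D' \<Longrightarrow> x * y \<in> Rees (\<lambda>j. D j + D' j)"
  unfolding Rees_def[of D] Rees_def[of D']
  by (rule mp_span_mult_mem) (auto simp: Rees_def intro: mp.span_base pure_prods_mult)

lemma Rees_one: "1 \<in> Rees (\<lambda>_. 0)"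
  unfolding Rees_def by (intro mp.span_base) (simp add: pure_prods_def)

lemma E_Rees:
  assumes "i < q" "x \<in> E i"
  shows "x \<in> Rees (\<delta> i)"
proof -
  have "x = (\<Prod>j<q. \<Prod>t<\<delta> i j. x)"
  proof -
    have "(\<Prod>j<q. \<Prod>t<\<delta> i j. x) = (\<Prod>j<q. if j = i then x else 1)"
      by (intro prod.cong) (auto simp: \<delta>_def)
    then show ?thesis using assms(1) by simp
  qed
  then have "x \<in> pure_prods (\<delta> i)"
    unfolding pure_prods_def using assms(2) by (intro CollectI exI[of _ "\<lambda>_ _. x"]) (auto simp: \<delta>_def)
  then show ?thesis unfolding Rees_def by (rule mp.span_base)
qed

text \<open>Compares the Rees algebra with another graded family by looking at the
  \<open>E i\<close> alone. Products produce degree functions that agree with \<open>D\<close> only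
  below \<open>q\<close>, which is what \<open>cong\<close> is for.\<close>

lemma Rees_induct:
  assumes "x \<in> Rees D"
    and cong: "\<And>D D'. (\<And>j. j < q \<Longrightarrow> D j = D' j) \<Longrightarrow> \<Phi> D = \<Phi> D'"
    and sub: "\<And>D. mp.subspace (\<Phi> D)"
    and one: "1 \<in> \<Phi> (\<lambda>_. 0)"
    and mult: "\<And>D D' x y. x \<in> \<Phi> D \<Longrightarrow> y \<in> \<Phi> D' \<Longrightarrow> x * y \<in> \<Phi> (\<lambda>j. D j + D' j)"
    and E: "\<And>i x. i < q \<Longrightarrow> x \<in> E i \<Longrightarrow> x \<in> \<Phi> (\<delta> i)"
  shows "x \<in> \<Phi> D"
proof -
  have "pure_prods D \<subseteq> \<Phi> D"
  proof
    fix y assume "y \<in> pure_prods D"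
    then obtain h where h: "y = (\<Prod>j<q. \<Prod>t<D j. h j t)" "\<forall>j<q. \<forall>t<D j. h j t \<in> E j"
      by (auto simp: pure_prods_def)
    have 1: "(\<Prod>t<k. h j t) \<in> \<Phi> (\<lambda>j'. k * \<delta> j j')" if "j < q" "k \<le> D j" for j k
      using that(2)
    proof (induction k)
      case (Suc k)
      then show ?case using mult[of "\<Prod>t<k. h j t" "\<lambda>j'. k * \<delta> j j'" "h j k" "\<delta> j"] E[OF that(1)] h(2) that(1)
        by (auto simp: algebra_simps)
    qed (simp add: one)
    have "(\<Prod>j<k. \<Prod>t<D j. h j t) \<in> \<Phi> (\<lambda>j. if j < k then D j else 0)" if "k \<le> q" for k
      using that
    proof (induction k)
      case (Suc k)
      have "\<Phi> (\<lambda>j. (if j < k then D j else 0) + D k * \<delta> k j) = \<Phi> (\<lambda>j. if j < Suc k then D j else 0)"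
        by (rule cong) (auto simp: \<delta>_def less_Suc_eq)
      then show ?case
        using mult[OF Suc.IH 1[of k "D k"]] Suc.prems by simp
    qed (simp add: one)
    from this[of q] show "y \<in> \<Phi> D" using cong[of "\<lambda>j. if j < q then D j else 0" D] h(1) by simp
  qed
  then show ?thesis using assms(1) sub unfolding Rees_def by (meson mp.span_minimal subsetD)
qed

definition T :: "nat \<Rightarrow> (nat \<times> nat, 'a) mpoly set" where
  "T n = Rees (\<lambda>_. n)"

lemma subspace_T [simp]: "mp.subspace (T n)"
  by (simp add: T_def)

lemma T_mult: "x \<in> T k \<Longrightarrow> y \<in> T n \<Longrightarrow> x * y \<in> T (k + n)"
  unfolding T_def using Rees_mult by fastforce

lemma T_one: "1 \<in> T 0"
  unfolding T_def by (rule Rees_one)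

lemma T_power: "x \<in> T k \<Longrightarrow> x ^ n \<in> T (k * n)"
proof (induction n)
  case (Suc n)
  then show ?case using T_mult[of x k "x ^ n" "k * n"] by simp
qed (simp add: T_one)

lemma T_prod: "(\<And>i. i \<in> A \<Longrightarrow> x i \<in> T (k i)) \<Longrightarrow> (\<Prod>i\<in>A. x i) \<in> T (\<Sum>i\<in>A. k i)"
  by (induction A rule: infinite_finite_induct) (auto simp: T_one T_mult)

definition ideal_Rees :: "'a set \<Rightarrow> (nat \<Rightarrow> nat) \<Rightarrow> (nat \<times> nat, 'a) mpoly set" where
  "ideal_Rees J D = mp.span {mpoly_const s * x | s x. s \<in> J \<and> x \<in> Rees D}"

lemma subspace_ideal_Rees [simp]: "mp.subspace (ideal_Rees J D)"
  by (simp add: ideal_Rees_def)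

lemma ideal_Rees_base: "s \<in> J \<Longrightarrow> x \<in> Rees D \<Longrightarrow> mpoly_const s * x \<in> ideal_Rees J D"
  unfolding ideal_Rees_def by (intro mp.span_base) auto

lemma ideal_Rees_mem:
  assumes "x \<in> ideal_Rees J D" "mp.subspace V" "\<And>s y. s \<in> J \<Longrightarrow> y \<in> Rees D \<Longrightarrow> mpoly_const s * y \<in> V"
  shows "x \<in> V"
  using mp.span_minimal[of "{mpoly_const s * x | s x. s \<in> J \<and> x \<in> Rees D}" V] assms
  unfolding ideal_Rees_def by blast

lemma ideal_Rees_mono: "J \<subseteq> J' \<Longrightarrow> ideal_Rees J D \<subseteq> ideal_Rees J' D"
  unfolding ideal_Rees_def by (rule mp.span_mono) auto

lemma ideal_Rees_subset_Rees: "ideal_Rees J D \<subseteq> Rees D"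
proof
  fix x assume "x \<in> ideal_Rees J D"
  then show "x \<in> Rees D" by (rule ideal_Rees_mem) (simp_all add: mp_subspace_mult)
qed

lemma ideal_Rees_mult:
  assumes "x \<in> ideal_Rees J D" "y \<in> Rees D'"
  shows "x * y \<in> ideal_Rees J (\<lambda>j. D j + D' j)"
proof -
  have "mp.subspace {x. x * y \<in> ideal_Rees J (\<lambda>j. D j + D' j)}"
    by (rule mp_subspace_mult_vimage) simp
  from ideal_Rees_mem[OF assms(1) this] show ?thesis
    using ideal_Rees_base Rees_mult assms(2) by (auto simp: mult.assoc)
qed

abbreviation param_Rees :: "nat \<Rightarrow> (nat \<Rightarrow> nat) \<Rightarrow> (nat \<times> nat, 'a) mpoly set" where
  "param_Rees j D \<equiv> ideal_Rees (ideal_power (p ` {..<d}) j) D"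

lemma param_Rees_0: "param_Rees 0 D = Rees D"
  using ideal_Rees_subset_Rees[of "UNIV"] ideal_Rees_base[of 1 UNIV _ D] by auto

lemma param_Rees_antimono: "i \<le> j \<Longrightarrow> param_Rees j D \<subseteq> param_Rees i D"
  by (intro ideal_Rees_mono ideal_power_antimono)

lemma param_Rees_const_mult:
  assumes "s \<in> ideal_power (p ` {..<d}) i" "x \<in> param_Rees j D"
  shows "mpoly_const s * x \<in> param_Rees (i + j) D"
proof -
  have "mp.subspace {x. mpoly_const s * x \<in> param_Rees (i + j) D}"
    by (rule mp_subspace_mult_vimage) simp
  from ideal_Rees_mem[OF assms(2) this] show ?thesis
    using ideal_Rees_base[OF ideal_power_mult[OF assms(1)]]
    by (auto simp: mpoly_const_mult mult.assoc)
qed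

end

lemma rg_subspace_const_vimage:
  assumes "mp.subspace V"
  shows "rg.subspace {s. mpoly_const s * f \<in> V}"
  by (rule rg.subspaceI)
    (simp_all add: mpoly_const_add mpoly_const_mult distrib_right mult.assoc
      mp.subspace_0[OF assms] mp.subspace_add[OF assms] mp_subspace_mult[OF assms])

text \<open>Functions with values in a polynomial ring and pointwise operations. A linear relation
  between functions of the matrix tuple has coefficients that do not depend on the tuple.\<close>

interpretation fm: Modules.module
  "\<lambda>c (\<phi> :: 'x \<Rightarrow> ('v, 'a::comm_ring_1) mpoly) x. mpoly_scale c (\<phi> x)"
  by unfold_locales
    (auto simp: fun_eq_iff plus_fun_def mp.scale_right_distrib mp.scale_left_distrib mp.scale_scale)

declare fm.scale_scale [simp del]

lemma fm_span_mult_mem: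
  assumes V: "fm.subspace V" and "\<And>x y. x \<in> A \<Longrightarrow> y \<in> B \<Longrightarrow> (\<lambda>z. x z * y z) \<in> V"
    and "f \<in> fm.span A" "g \<in> fm.span B"
  shows "(\<lambda>z. f z * g z) \<in> V"
proof -
  have 1: "fm.subspace {g. (\<lambda>z. x z * g z) \<in> V}" "fm.subspace {g. (\<lambda>z. g z * x z) \<in> V}" for x
    using fm.subspace_0[OF V] fm.subspace_add[OF V] fm.subspace_scale[OF V]
    by (auto intro!: fm.subspaceI simp: distrib_left distrib_right mpoly_scale_mult_left
        mpoly_scale_mult_right zero_fun_def plus_fun_def)
  have "(\<lambda>z. x z * g z) \<in> V" if "x \<in> A" for x
    using assms(2,4) that fm.span_minimal[OF _ 1(1), of B x] by blast
  then show ?thesis using assms(3) fm.span_minimal[OF _ 1(2), of A g] by blast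
qed

context finite_colength_forms
begin

section \<open>Absorption of S(F) into the Rees algebra by powers of the parameter ideal\<close>

lemma E_subspace: "i < q \<Longrightarrow> mp.subspace (E i)"
  by (simp add: E_span)

lemma params_subset: "p ` {..<d} \<subseteq> \<mm>"
  using p_in by auto

text \<open>With Q the parameter ideal: Q^(j + k) x lies in Q^j times the Rees algebra. Demanding
  this for all \<open>j\<close> gives a uniform loss \<open>k\<close>, which is additive under
  products.\<close>

definition absorb :: "nat \<Rightarrow> (nat \<Rightarrow> nat) \<Rightarrow> (nat \<times> nat, 'a) mpoly \<Rightarrow> bool" where
  "absorb k D x \<longleftrightarrow> (\<forall>j. \<forall>s\<in>ideal_power (p ` {..<d}) (j + k). mpoly_const s * x \<in> param_Rees j D)"

text \<open>Of the available parameters, \<open>j + k\<close> are spent on \<open>x\<close> and the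
  remaining \<open>k'\<close> on \<open>y\<close>; for \<open>y\<close> the case of exponent 0
  suffices.\<close>

lemma absorb_mult:
  assumes "absorb k D x" "absorb k' D' y"
  shows "absorb (k + k') (\<lambda>i. D i + D' i) (x * y)"
  unfolding absorb_def
proof (intro allI ballI)
  fix j s assume "s \<in> ideal_power (p ` {..<d}) (j + (k + k'))"
  then have "s \<in> ideal_power (p ` {..<d}) ((j + k) + k')" by (simp add: add.assoc)
  then have "s \<in> {s. mpoly_const s * (x * y) \<in> param_Rees j (\<lambda>i. D i + D' i)}"
  proof (rule ideal_power_add_mem)
    show "rg.subspace {s. mpoly_const s * (x * y) \<in> param_Rees j (\<lambda>i. D i + D' i)}"
      by (rule rg_subspace_const_vimage) simp
    fix a b assume "a \<in> ideal_power (p ` {..<d}) (j + k)" "b \<in> ideal_power (p ` {..<d}) k'"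
    then have "mpoly_const a * x \<in> param_Rees j D" "mpoly_const b * y \<in> Rees D'"
      using assms unfolding absorb_def by (blast, metis add_0 param_Rees_0)
    from ideal_Rees_mult[OF this] show "a * b \<in> {s. mpoly_const s * (x * y) \<in> param_Rees j (\<lambda>i. D i + D' i)}"
      by (simp add: mpoly_const_mult mult_ac)
  qed
  then show "mpoly_const s * (x * y) \<in> param_Rees j (\<lambda>i. D i + D' i)" by simp
qed

lemma absorb_one: "absorb 0 (\<lambda>_. 0) 1"
  unfolding absorb_def using ideal_Rees_base[OF _ Rees_one] by auto

lemma absorb_var:
  assumes "i < q" "a < r i"
  shows "absorb c (\<delta> i) (mpoly_var (i, a))"
  unfolding absorb_def
proof (intro allI ballI)
  fix j s assume "s \<in> ideal_power (p ` {..<d}) (j + c)"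
  then have "s \<in> {s. mpoly_const s * mpoly_var (i, a) \<in> param_Rees j (\<delta> i)}"
  proof (rule ideal_power_add_mem)
    show "rg.subspace {s. mpoly_const s * mpoly_var (i, a) \<in> param_Rees j (\<delta> i)}"
      by (rule rg_subspace_const_vimage) simp
    fix x y assume xy: "x \<in> ideal_power (p ` {..<d}) j" "y \<in> ideal_power (p ` {..<d}) c"
    have "ideal_power (p ` {..<d}) c \<subseteq> {y. mpoly_const y * mpoly_var (i, a) \<in> E i}"
      unfolding ideal_power_def
      using E_absorbs[OF assms] params_subset
      by (intro rg.span_minimal rg_subspace_const_vimage E_subspace assms) blast
    then have "mpoly_const y * mpoly_var (i, a) \<in> Rees (\<delta> i)" using xy E_Rees assms by blast
    from ideal_Rees_base[OF xy(1) this]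
    show "x * y \<in> {s. mpoly_const s * mpoly_var (i, a) \<in> param_Rees j (\<delta> i)}"
      by (simp add: mpoly_const_mult mult.assoc)
  qed
  then show "mpoly_const s * mpoly_var (i, a) \<in> param_Rees j (\<delta> i)" by simp
qed

lemma absorb_power: "absorb k D x \<Longrightarrow> absorb (n * k) (\<lambda>i. n * D i) (x ^ n)"
proof (induction n)
  case (Suc n)
  then show ?case using absorb_mult[of k D x "n * k" "\<lambda>i. n * D i" "x ^ n"] by simp
qed (simp add: absorb_one)

lemma absorb_prod:
  assumes "\<And>v. v \<in> S \<Longrightarrow> absorb (k v) (D v) (x v)" "finite S"
  shows "absorb (\<Sum>v\<in>S. k v) (\<lambda>i. \<Sum>v\<in>S. D v i) (\<Prod>v\<in>S. x v)"
  using assms(2,1)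
proof (induction S rule: finite_induct)
  case (insert v S)
  then show ?case
    using absorb_mult[of "k v" "D v" "x v" "\<Sum>v\<in>S. k v" "\<lambda>i. \<Sum>v\<in>S. D v i" "\<Prod>v\<in>S. x v"] by simp
qed (simp add: absorb_one)

section \<open>Monomials of S(F) and polynomial functions of the matrix entries\<close>

definition vars :: "(nat \<times> nat) set" where
  "vars = (SIGMA i:{..<q}. {..<r i})"

lemma finite_vars [simp]: "finite vars"
  by (simp add: vars_def)

definition xmon :: "(nat \<times> nat \<Rightarrow> nat) \<Rightarrow> (nat \<times> nat, 'a) mpoly" where
  "xmon \<kappa> = (\<Prod>v\<in>vars. mpoly_var v ^ \<kappa> v)"

definition xdeg :: "(nat \<times> nat \<Rightarrow> nat) \<Rightarrow> nat \<Rightarrow> nat" where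
  "xdeg \<kappa> i = (\<Sum>v\<in>vars. \<kappa> v * \<delta> (fst v) i)"

lemma xmon_add: "xmon (\<lambda>v. \<kappa> v + \<kappa>' v) = xmon \<kappa> * xmon \<kappa>'"
  by (simp add: xmon_def power_add prod.distrib)

lemma xdeg_add: "xdeg (\<lambda>v. \<kappa> v + \<kappa>' v) i = xdeg \<kappa> i + xdeg \<kappa>' i"
  by (simp add: xdeg_def distrib_right sum.distrib)

lemma sum_xdeg: "(\<Sum>i<q. xdeg \<kappa> i) = (\<Sum>v\<in>vars. \<kappa> v)"
proof -
  have "(\<Sum>i<q. xdeg \<kappa> i) = (\<Sum>v\<in>vars. \<kappa> v * (\<Sum>i<q. \<delta> (fst v) i))"
    unfolding xdeg_def by (subst sum.swap) (simp add: sum_distrib_left)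
  also have "\<dots> = (\<Sum>v\<in>vars. \<kappa> v)"
    by (intro sum.cong) (auto simp: \<delta>_def vars_def)
  finally show ?thesis .
qed

text \<open>Each variable costs \<open>c\<close> parameters by finite colength, so the loss is
  linear in the degree. This linearity keeps the later count at the right order of growth.\<close>

lemma absorb_xmon: "absorb (c * (\<Sum>v\<in>vars. \<kappa> v)) (xdeg \<kappa>) (xmon \<kappa>)"
proof -
  have "absorb (\<kappa> v * c) (\<lambda>i. \<kappa> v * \<delta> (fst v) i) (mpoly_var v ^ \<kappa> v)" if "v \<in> vars" for v
    using that by (intro absorb_power) (auto simp: vars_def absorb_var)
  from absorb_prod[OF this finite_vars] show ?thesis
    unfolding xmon_def xdeg_def[abs_def]
    by (simp add: sum_distrib_left mult.commute)
qed

text \<open>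
  Polynomials in the matrix entries are represented by functions of \<open>A\<close>, so that specialising
  the entries is application.
\<close>

definition poly_fun :: "(nat \<times> nat \<times> nat) set \<Rightarrow> (nat \<Rightarrow> nat) \<Rightarrow> nat \<Rightarrow>
    ((nat \<times> nat \<times> nat \<Rightarrow> 'a) \<Rightarrow> (nat \<times> nat, 'a) mpoly) set" where
  "poly_fun S D e = fm.span {\<lambda>A. mpoly_const (\<Prod>v\<in>S. A v ^ \<rho> v) * xmon \<kappa> | \<rho> \<kappa>.
     (\<forall>i<q. xdeg \<kappa> i = D i) \<and> (\<forall>v. \<rho> v \<le> e)}"

lemma poly_fun_base:
  assumes "\<And>i. i < q \<Longrightarrow> xdeg \<kappa> i = D i" "\<And>v. \<rho> v \<le> e"
  shows "(\<lambda>A. mpoly_const (\<Prod>v\<in>S. A v ^ \<rho> v) * xmon \<kappa>) \<in> poly_fun S D e"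
  unfolding poly_fun_def using assms by (intro fm.span_base CollectI exI[of _ \<rho>] exI[of _ \<kappa>]) auto

lemma subspace_poly_fun [simp]: "fm.subspace (poly_fun S D e)"
  by (simp add: poly_fun_def)

lemma poly_fun_mono: "e \<le> e' \<Longrightarrow> poly_fun S D e \<subseteq> poly_fun S D e'"
  unfolding poly_fun_def using order.trans by (intro fm.span_mono) blast

lemma poly_fun_cong: "(\<And>i. i < q \<Longrightarrow> D i = D' i) \<Longrightarrow> poly_fun S D e = poly_fun S D' e"
  unfolding poly_fun_def by (intro arg_cong[where f = fm.span]) auto

lemma poly_fun_mult:
  assumes "\<phi> \<in> poly_fun S D e" "\<psi> \<in> poly_fun S D' e'"
  shows "(\<lambda>A. \<phi> A * \<psi> A) \<in> poly_fun S (\<lambda>i. D i + D' i) (e + e')"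
  using assms unfolding poly_fun_def[of S D] poly_fun_def[of S D']
proof (rule fm_span_mult_mem[rotated 2])
  fix x y
  assume "x \<in> {\<lambda>A. mpoly_const (\<Prod>v\<in>S. A v ^ \<rho> v) * xmon \<kappa> |\<rho> \<kappa>. (\<forall>i<q. xdeg \<kappa> i = D i) \<and> (\<forall>v. \<rho> v \<le> e)}"
    and "y \<in> {\<lambda>A. mpoly_const (\<Prod>v\<in>S. A v ^ \<rho> v) * xmon \<kappa> |\<rho> \<kappa>. (\<forall>i<q. xdeg \<kappa> i = D' i) \<and> (\<forall>v. \<rho> v \<le> e')}"
  then obtain \<rho> \<kappa> \<rho>' \<kappa>' where
    x: "x = (\<lambda>A. mpoly_const (\<Prod>v\<in>S. A v ^ \<rho> v) * xmon \<kappa>)" "\<forall>i<q. xdeg \<kappa> i = D i" "\<forall>v. \<rho> v \<le> e" and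
    y: "y = (\<lambda>A. mpoly_const (\<Prod>v\<in>S. A v ^ \<rho>' v) * xmon \<kappa>')" "\<forall>i<q. xdeg \<kappa>' i = D' i" "\<forall>v. \<rho>' v \<le> e'"
    by blast
  have "(\<lambda>A. x A * y A) = (\<lambda>A. mpoly_const (\<Prod>v\<in>S. A v ^ (\<rho> v + \<rho>' v)) * xmon (\<lambda>v. \<kappa> v + \<kappa>' v))"
    by (simp add: x(1) y(1) xmon_add power_add prod.distrib mpoly_const_mult mult_ac)
  also have "\<dots> \<in> poly_fun S (\<lambda>i. D i + D' i) (e + e')"
  proof (rule poly_fun_base)
    show "\<rho> v + \<rho>' v \<le> e + e'" for v using x(3) y(3) add_mono by blast
  qed (use x(2) y(2) in \<open>simp add: xdeg_add\<close>)
  finally show "(\<lambda>A. x A * y A) \<in> poly_fun S (\<lambda>i. D i + D' i) (e + e')" .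
qed simp

lemma poly_fun_one: "(\<lambda>_. 1) \<in> poly_fun S (\<lambda>_. 0) 0"
  using poly_fun_base[of "\<lambda>_. 0" "\<lambda>_. 0" "\<lambda>_. 0" 0 S] by (simp add: xdeg_def xmon_def)

lemma poly_fun_power: "\<phi> \<in> poly_fun S D e \<Longrightarrow> (\<lambda>A. \<phi> A ^ n) \<in> poly_fun S (\<lambda>i. n * D i) (n * e)"
proof (induction n)
  case (Suc n)
  then show ?case using poly_fun_mult[of \<phi> S D e "\<lambda>A. \<phi> A ^ n" "\<lambda>i. n * D i" "n * e"] by simp
qed (simp add: poly_fun_one)

lemma poly_fun_prod:
  assumes "finite J" "\<And>j. j \<in> J \<Longrightarrow> \<phi> j \<in> poly_fun S (D j) (e j)"
  shows "(\<lambda>A. \<Prod>j\<in>J. \<phi> j A) \<in> poly_fun S (\<lambda>i. \<Sum>j\<in>J. D j i) (\<Sum>j\<in>J. e j)"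
  using assms
proof (induction J rule: finite_induct)
  case (insert j J)
  then show ?case
    using poly_fun_mult[of "\<phi> j" S "D j" "e j" "\<lambda>A. \<Prod>j\<in>J. \<phi> j A" "\<lambda>i. \<Sum>j\<in>J. D j i" "\<Sum>j\<in>J. e j"] by simp
qed (simp add: poly_fun_one)

lemma poly_fun_coord:
  assumes "finite S" "v \<in> S"
  shows "(\<lambda>A. mpoly_const (A v)) \<in> poly_fun S (\<lambda>_. 0) 1"
proof -
  have "(\<Prod>w\<in>S. A w ^ (if w = v then 1 else 0)) = A v" for A :: "nat \<times> nat \<times> nat \<Rightarrow> 'a"
    using assms by (subst prod.remove[of S v]) auto
  then show ?thesis
    using poly_fun_base[of "\<lambda>_. 0" "\<lambda>_. 0" "\<lambda>w. if w = v then 1 else 0" 1 S] by (simp add: xdeg_def xmon_def)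
qed

text \<open>By \<open>E_lin\<close> the elements of \<open>E i\<close> are combinations of the
  variables of F_i, so elements of the Rees algebra are combinations of monomials
  \<open>xmon\<close> of the same multidegree, without any matrix entry.\<close>

lemma poly_fun_const:
  assumes "x \<in> Rees D"
  shows "(\<lambda>_. x) \<in> poly_fun S D 0"
proof -
  have vimage: "mp.subspace {x. (\<lambda>_. x) \<in> poly_fun S D 0}" for D
    using fm.subspace_0[OF subspace_poly_fun] fm.subspace_add[OF subspace_poly_fun] fm.subspace_scale[OF subspace_poly_fun]
    by (auto intro!: mp.subspaceI simp: zero_fun_def plus_fun_def)
  have "x \<in> {x. (\<lambda>_. x) \<in> poly_fun S D 0}"
    using assms
  proof (rule Rees_induct)
    fix i x assume i: "i < q" and x: "x \<in> E i"
    have "(\<lambda>_. mpoly_var (i, a)) \<in> poly_fun S (\<delta> i) 0" if "a < r i" for a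
    proof -
      let ?\<kappa> = "\<lambda>v. if v = (i, a) then 1 else 0 :: nat"
      have v: "(i, a) \<in> vars" using i that by (simp add: vars_def)
      then have "xmon ?\<kappa> = mpoly_var (i, a)"
        unfolding xmon_def by (subst prod.remove[of vars "(i, a)"]) auto
      moreover have "xdeg ?\<kappa> j = \<delta> i j" for j
        unfolding xdeg_def using v by (subst sum.remove[of vars "(i, a)"]) auto
      ultimately show ?thesis
        using poly_fun_base[of ?\<kappa> "\<delta> i" "\<lambda>_. 0" 0 S] by simp
    qed
    then show "x \<in> {x. (\<lambda>_. x) \<in> poly_fun S (\<delta> i) 0}"
      using x E_lin[OF i] mp.span_minimal[OF _ vimage, of "(\<lambda>a. mpoly_var (i, a)) ` {..<r i}" "\<delta> i"] by blast
  next
    fix D D' x y assume "x \<in> {x. (\<lambda>_. x) \<in> poly_fun S D 0}" "y \<in> {x. (\<lambda>_. x) \<in> poly_fun S D' 0}"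
    then show "x * y \<in> {x. (\<lambda>_. x) \<in> poly_fun S (\<lambda>j. D j + D' j) 0}"
      using poly_fun_mult[of "\<lambda>_. x" S D 0 "\<lambda>_. y" D' 0] by simp
  next
    fix D D' :: "nat \<Rightarrow> nat" assume "\<And>j. j < q \<Longrightarrow> D j = D' j"
    then have "poly_fun S D 0 = poly_fun S D' 0" by (rule poly_fun_cong)
    then show "{x. (\<lambda>_. x) \<in> poly_fun S D 0} = {x. (\<lambda>_. x) \<in> poly_fun S D' 0}" by simp
  next
    show "1 \<in> {x. (\<lambda>_. x) \<in> poly_fun S (\<lambda>_. 0) 0}" using poly_fun_one by simp
  qed (rule vimage)
  then show ?thesis by simp
qed

end

section \<open>Points annihilated by the matrices\<close>

lemma prod_fun_upd_Suc:
  fixes x :: "'i \<Rightarrow> 'b::comm_monoid_mult"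
  assumes "finite S" "i \<in> S"
  shows "(\<Prod>j\<in>S. x j ^ (\<mu>(i := Suc (\<mu> i))) j) = x i * (\<Prod>j\<in>S. x j ^ \<mu> j)"
proof -
  have "(\<Prod>j\<in>S - {i}. x j ^ (\<mu>(i := Suc (\<mu> i))) j) = (\<Prod>j\<in>S - {i}. x j ^ \<mu> j)"
    by (intro prod.cong) auto
  then show ?thesis using assms by (simp add: prod.remove mult.assoc)
qed

lemma sum_fun_upd_Suc:
  assumes "finite S" "i \<in> S"
  shows "(\<Sum>j\<in>S. (\<mu>(i := Suc (\<mu> i))) j) = Suc (\<Sum>j\<in>S. \<mu> j)"
proof -
  have "(\<Sum>j\<in>S - {i}. (\<mu>(i := Suc (\<mu> i))) j) = (\<Sum>j\<in>S - {i}. \<mu> j)"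
    by (intro sum.cong) auto
  then show ?thesis using assms by (simp add: sum.remove)
qed

lemma sum_fun_apply: "(\<Sum>i\<in>I. f i) x = (\<Sum>i\<in>I. f i x)"
  by (induction I rule: infinite_finite_induct) auto

lemma rg_subspace_fm_scale_vimage:
  assumes "fm.subspace V"
  shows "rg.subspace {s. (\<lambda>A. mpoly_scale s (\<phi> A)) \<in> V}"
  using fm.subspace_0[OF assms] fm.subspace_add[OF assms] fm.subspace_scale[OF assms]
  by (auto intro!: rg.subspaceI simp: mp.scale_left_distrib zero_fun_def plus_fun_def
      mp.scale_scale[symmetric])

context finite_colength_forms
begin

lemma g_in_E: "i < q \<Longrightarrow> a < m i \<Longrightarrow> g i a \<in> E i"
  by (simp add: E_span mp.span_base)

lemma Rees_prod:
  assumes "finite J" "\<And>j. j \<in> J \<Longrightarrow> x j \<in> Rees (D j)"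
  shows "(\<Prod>j\<in>J. x j) \<in> Rees (\<lambda>i. \<Sum>j\<in>J. D j i)"
  using assms
proof (induction J rule: finite_induct)
  case (insert j J)
  then show ?case using Rees_mult[of "x j" "D j" "\<Prod>j\<in>J. x j" "\<lambda>i. \<Sum>j\<in>J. D j i"] by simp
qed (simp add: Rees_one)

section \<open>Selections of one generator from each module and the generic zero of the
  columns\<close>

definition choices :: "(nat \<Rightarrow> nat) set" where
  "choices = (\<Pi>\<^sub>E i\<in>{..<q}. {..<m i})"

lemma choices_less: "\<sigma> \<in> choices \<Longrightarrow> i < q \<Longrightarrow> \<sigma> i < m i"
  by (auto simp: choices_def)

definition entries :: "(nat \<times> nat \<times> nat) set" where
  "entries = (SIGMA i:{..<q}. {..<m i} \<times> {..<r i})"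

lemma finite_entries [simp]: "finite entries"
  by (simp add: entries_def)

definition free_entries :: "(nat \<Rightarrow> nat) \<Rightarrow> (nat \<times> nat \<times> nat) set" where
  "free_entries \<sigma> = {(i, a, b) \<in> entries. a \<noteq> \<sigma> i}"

lemma finite_free_entries [simp]: "finite (free_entries \<sigma>)"
  by (rule finite_subset[of _ entries]) (auto simp: free_entries_def)

definition sel_prod :: "(nat \<Rightarrow> nat) \<Rightarrow> (nat \<times> nat, 'a) mpoly" where
  "sel_prod \<sigma> = (\<Prod>j<q. g j (\<sigma> j))"

definition sel_coprod :: "(nat \<Rightarrow> nat) \<Rightarrow> nat \<Rightarrow> (nat \<times> nat, 'a) mpoly" where
  "sel_coprod \<sigma> i = (\<Prod>j\<in>{..<q} - {i}. g j (\<sigma> j))"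

definition codeg :: "nat \<Rightarrow> nat \<Rightarrow> nat" where
  "codeg i i' = (\<Sum>j\<in>{..<q} - {i}. \<delta> j i')"

lemma codeg_add: "i < q \<Longrightarrow> i' < q \<Longrightarrow> codeg i i' + \<delta> i i' = 1"
  unfolding codeg_def by (subst add.commute, subst sum.remove[symmetric]) (auto simp: \<delta>_def)

lemma sel_coprod_Rees: "\<sigma> \<in> choices \<Longrightarrow> sel_coprod \<sigma> i \<in> Rees (codeg i)"
  unfolding sel_coprod_def codeg_def[abs_def] by (rule Rees_prod) (auto intro: E_Rees g_in_E choices_less)

lemma sel_prod_eq: "i < q \<Longrightarrow> sel_prod \<sigma> = sel_coprod \<sigma> i * g i (\<sigma> i)"
  unfolding sel_prod_def sel_coprod_def by (subst prod.remove[of _ i]) (auto simp: mult.commute)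

lemma sel_coprod_mult_T:
  assumes "\<sigma> \<in> choices" "i < q" "x \<in> E i"
  shows "sel_coprod \<sigma> i * x \<in> T 1"
proof -
  have "Rees (\<lambda>j. codeg i j + \<delta> i j) = T 1"
    unfolding T_def by (rule Rees_cong) (rule codeg_add[OF assms(2)])
  then show ?thesis using Rees_mult[OF sel_coprod_Rees[OF assms(1), of i] E_Rees[OF assms(2,3)]] by simp
qed

lemma q_pos: "q > 0"
  using d_pos d_le by simp

lemma sel_prod_T: "\<sigma> \<in> choices \<Longrightarrow> sel_prod \<sigma> \<in> T 1"
  using sel_prod_eq[OF q_pos] sel_coprod_mult_T[OF _ q_pos] g_in_E[OF q_pos] choices_less[OF _ q_pos] by simp

text \<open>
  The point of the space of matrix tuples at which, after division by \<open>sel_prod \<sigma>\<close>, all the forms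
  \<open>\<Sum>a<m i. A (i, a, b) * g i a\<close> vanish; its coordinates outside \<open>free_entries \<sigma>\<close> are solved for.
\<close>

definition zeropt :: "(nat \<Rightarrow> nat) \<Rightarrow> (nat \<times> nat \<times> nat \<Rightarrow> 'a) \<Rightarrow> nat \<times> nat \<times> nat \<Rightarrow> (nat \<times> nat, 'a) mpoly" where
  "zeropt \<sigma> A = (\<lambda>(i, a, b). if a \<noteq> \<sigma> i then sel_prod \<sigma> * mpoly_const (A (i, a, b))
     else - (\<Sum>a'\<in>{..<m i} - {\<sigma> i}. sel_coprod \<sigma> i * g i a' * mpoly_const (A (i, a', b))))"

lemma zeropt_T:
  assumes "\<sigma> \<in> choices" "v \<in> entries"
  shows "zeropt \<sigma> A v \<in> T 1"
proof -
  obtain i a b where v: "v = (i, a, b)" "i < q" "a < m i" "b < r i" using assms(2) by (auto simp: entries_def)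
  have "sel_coprod \<sigma> i * g i a' * mpoly_const (A (i, a', b)) \<in> T 1" if "a' < m i" for a'
    using mp_subspace_mult[OF subspace_T sel_coprod_mult_T[OF assms(1) v(2) g_in_E[OF v(2) that]]]
    by (simp add: mult.commute)
  moreover have "sel_prod \<sigma> * mpoly_const (A (i, a, b)) \<in> T 1"
    using mp_subspace_mult[OF subspace_T sel_prod_T[OF assms(1)]] by (simp add: mult.commute[of "sel_prod \<sigma>"])
  ultimately show ?thesis
    by (auto simp: zeropt_def v(1) intro!: mp.subspace_neg mp.subspace_sum)
qed

lemma zeropt_poly_fun:
  assumes "\<sigma> \<in> choices" "v \<in> entries"
  shows "(\<lambda>A. zeropt \<sigma> A v) \<in> poly_fun (free_entries \<sigma>) (\<lambda>_. 1) 1"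
proof -
  obtain i a b where v: "v = (i, a, b)" "i < q" "a < m i" "b < r i" using assms(2) by (auto simp: entries_def)
  have *: "(\<lambda>A. x * mpoly_const (A w)) \<in> poly_fun (free_entries \<sigma>) (\<lambda>_. 1) 1" if "x \<in> T 1" "w \<in> free_entries \<sigma>" for x w
    using poly_fun_mult[OF poly_fun_const[OF that(1)[unfolded T_def]] poly_fun_coord[OF finite_free_entries that(2)]] by simp
  show ?thesis
  proof (cases "a = \<sigma> i")
    case True
    have "(\<Sum>a'\<in>{..<m i} - {\<sigma> i}. (\<lambda>A. sel_coprod \<sigma> i * g i a' * mpoly_const (A (i, a', b)))) \<in> poly_fun (free_entries \<sigma>) (\<lambda>_. 1) 1"
      using v by (intro fm.subspace_sum[OF subspace_poly_fun] * sel_coprod_mult_T assms(1) g_in_E) (auto simp: free_entries_def entries_def)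
    from fm.subspace_neg[OF subspace_poly_fun this] show ?thesis
      using True by (simp add: zeropt_def v(1) fun_Compl_def sum_fun_apply)
  next
    case False
    then show ?thesis
      using *[OF sel_prod_T[OF assms(1)], of "(i, a, b)"] v by (simp add: zeropt_def free_entries_def entries_def)
  qed
qed

text \<open>Bounding each exponent separately, instead of the total degree, makes the number of
  monomials a pure power of \<open>n\<close>.\<close>

definition box :: "nat \<Rightarrow> (nat \<times> nat \<times> nat \<Rightarrow> nat) set" where
  "box n = (\<Pi>\<^sub>E v\<in>entries. {..<n})"

lemma finite_box [simp]: "finite (box n)"
  by (simp add: box_def finite_PiE)

lemma box_sum_le: "\<tau> \<in> box n \<Longrightarrow> (\<Sum>v\<in>entries. \<tau> v) \<le> card entries * n"
  using sum_bounded_above[of entries \<tau> n] by (force simp: box_def PiE_iff)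

text \<open>The power of \<open>sel_prod \<sigma>\<close> homogenises the monomial: all these
  products get the diagonal degree \<open>card entries * n\<close>, which bounds the sum of the
  exponents, and can be compared in one graded piece.\<close>

definition box_form :: "(nat \<Rightarrow> nat) \<Rightarrow> nat \<Rightarrow> (nat \<times> nat \<times> nat \<Rightarrow> nat) \<Rightarrow>
    (nat \<times> nat \<times> nat \<Rightarrow> 'a) \<Rightarrow> (nat \<times> nat, 'a) mpoly" where
  "box_form \<sigma> n \<tau> A = (\<Prod>v\<in>entries. zeropt \<sigma> A v ^ \<tau> v) * sel_prod \<sigma> ^ (card entries * n - (\<Sum>v\<in>entries. \<tau> v))"

lemma box_form_T:
  assumes "\<sigma> \<in> choices" "\<tau> \<in> box n"
  shows "box_form \<sigma> n \<tau> A \<in> T (card entries * n)"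
proof -
  have "(\<Prod>v\<in>entries. zeropt \<sigma> A v ^ \<tau> v) \<in> T (\<Sum>v\<in>entries. \<tau> v)"
    by (rule T_prod) (use T_power[OF zeropt_T[OF assms(1)]] in simp)
  from T_mult[OF this T_power[OF sel_prod_T[OF assms(1)], of "card entries * n - (\<Sum>v\<in>entries. \<tau> v)"]] show ?thesis
    using box_sum_le[OF assms(2)] by (simp add: box_form_def)
qed

lemma box_form_poly_fun:
  assumes "\<sigma> \<in> choices" "\<tau> \<in> box n"
  shows "box_form \<sigma> n \<tau> \<in> poly_fun (free_entries \<sigma>) (\<lambda>_. card entries * n) (card entries * n)"
proof -
  let ?s = "\<Sum>v\<in>entries. \<tau> v"
  have "(\<lambda>A. \<Prod>v\<in>entries. zeropt \<sigma> A v ^ \<tau> v) \<in> poly_fun (free_entries \<sigma>) (\<lambda>_. \<Sum>v\<in>entries. \<tau> v * 1) (\<Sum>v\<in>entries. \<tau> v * 1)"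
    by (rule poly_fun_prod[OF finite_entries poly_fun_power[OF zeropt_poly_fun[OF assms(1)]]])
  from poly_fun_mult[OF this poly_fun_const[OF T_power[OF sel_prod_T[OF assms(1)], unfolded T_def], of "card entries * n - ?s"]]
  have "box_form \<sigma> n \<tau> \<in> poly_fun (free_entries \<sigma>) (\<lambda>_. card entries * n) ?s"
    using box_sum_le[OF assms(2)] by (simp add: box_form_def[abs_def])
  then show ?thesis using poly_fun_mono[OF box_sum_le[OF assms(2)]] by blast
qed

section \<open>Generators of a filtration with factors killed by the maximal ideal\<close>

definition xexps :: "nat \<Rightarrow> (nat \<times> nat \<Rightarrow> nat) set" where
  "xexps N = {\<kappa> \<in> \<Pi>\<^sub>E v\<in>vars. {..N}. \<forall>i<q. xdeg \<kappa> i = N}"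

definition pexps :: "nat \<Rightarrow> (nat \<Rightarrow> nat) set" where
  "pexps L = {\<mu> \<in> \<Pi>\<^sub>E i\<in>{..<d}. {..<L}. (\<Sum>i<d. \<mu> i) < L}"

definition zwords :: "'a list set" where
  "zwords = {\<nu>. set \<nu> \<subseteq> Z \<and> length \<nu> < c}"

definition filt_index :: "(nat \<Rightarrow> nat) \<Rightarrow> nat \<Rightarrow> nat \<Rightarrow> ((nat \<times> nat \<Rightarrow> nat) \<times> (nat \<times> nat \<times> nat \<Rightarrow> nat) \<times> (nat \<Rightarrow> nat) \<times> 'a list) set" where
  "filt_index \<sigma> N L = xexps N \<times> (\<Pi>\<^sub>E v\<in>free_entries \<sigma>. {..N}) \<times> pexps L \<times> zwords"

definition filt_gen :: "(nat \<Rightarrow> nat) \<Rightarrow> (nat \<times> nat \<Rightarrow> nat) \<times> (nat \<times> nat \<times> nat \<Rightarrow> nat) \<times> (nat \<Rightarrow> nat) \<times> 'a list \<Rightarrow>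
    (nat \<times> nat \<times> nat \<Rightarrow> 'a) \<Rightarrow> (nat \<times> nat, 'a) mpoly" where
  "filt_gen \<sigma> = (\<lambda>(\<kappa>, \<rho>, \<mu>, \<nu>) A.
     mpoly_const ((\<Prod>v\<in>free_entries \<sigma>. A v ^ \<rho> v) * ((\<Prod>i<d. p i ^ \<mu> i) * prod_list \<nu>)) * xmon \<kappa>)"

text \<open>A parameter weighs \<open>c\<close>, a letter from \<open>Z\<close> weighs 1. Replacing
  a word of fewer than \<open>c\<close> letters by a single further parameter therefore increases
  the weight, just as appending a letter does.\<close>

definition weight :: "(nat \<times> nat \<Rightarrow> nat) \<times> (nat \<times> nat \<times> nat \<Rightarrow> nat) \<times> (nat \<Rightarrow> nat) \<times> 'a list \<Rightarrow> nat" where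
  "weight = (\<lambda>(\<kappa>, \<rho>, \<mu>, \<nu>). c * (\<Sum>i<d. \<mu> i) + length \<nu>)"

text \<open>The part that is not counted: it already lies in a high power of the parameter ideal
  times the Rees algebra, for every \<open>A\<close>.\<close>

definition deep :: "nat \<Rightarrow> nat \<Rightarrow> ((nat \<times> nat \<times> nat \<Rightarrow> 'a) \<Rightarrow> (nat \<times> nat, 'a) mpoly) set" where
  "deep n N = {\<phi>. \<forall>A. \<phi> A \<in> param_Rees n (\<lambda>_. N)}"

lemma subspace_deep [simp]: "fm.subspace (deep n N)"
  using mp.subspace_0[OF subspace_ideal_Rees] mp.subspace_add[OF subspace_ideal_Rees] mp.subspace_scale[OF subspace_ideal_Rees]
  by (intro fm.subspaceI) (simp_all add: deep_def)

lemma poly_fun_subset_span_filt_gen: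
  assumes "L > 0"
  shows "poly_fun (free_entries \<sigma>) (\<lambda>_. N) N \<subseteq> fm.span (filt_gen \<sigma> ` filt_index \<sigma> N L)"
  unfolding poly_fun_def
proof (rule fm.span_mono, safe)
  fix \<rho> :: "nat \<times> nat \<times> nat \<Rightarrow> nat" and \<kappa> :: "nat \<times> nat \<Rightarrow> nat"
  assume \<kappa>: "\<forall>i<q. xdeg \<kappa> i = N" and \<rho>: "\<forall>v. \<rho> v \<le> N"
  let ?\<kappa> = "restrict \<kappa> vars" and ?\<rho> = "restrict \<rho> (free_entries \<sigma>)" and ?\<mu> = "\<lambda>i\<in>{..<d}. 0"
  have x: "xmon ?\<kappa> = xmon \<kappa>" by (simp add: xmon_def)
  have "\<kappa> v \<le> N" if "v \<in> vars" for v
  proof -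
    have "\<kappa> v * \<delta> (fst v) (fst v) \<le> xdeg \<kappa> (fst v)"
      unfolding xdeg_def using that by (intro member_le_sum) auto
    then show ?thesis using \<kappa> that by (auto simp: vars_def \<delta>_def)
  qed
  then have "?\<kappa> \<in> xexps N" using \<kappa> by (auto simp: xexps_def xdeg_def)
  moreover have "?\<mu> \<in> pexps L" using assms by (auto simp: pexps_def)
  moreover have "[] \<in> zwords" using c_pos by (simp add: zwords_def)
  ultimately have mem: "(?\<kappa>, ?\<rho>, ?\<mu>, []) \<in> filt_index \<sigma> N L" using \<rho> by (auto simp: filt_index_def)
  have filt_gen: "filt_gen \<sigma> (?\<kappa>, ?\<rho>, ?\<mu>, []) = (\<lambda>A. mpoly_const (\<Prod>v\<in>free_entries \<sigma>. A v ^ \<rho> v) * xmon \<kappa>)"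
    by (simp add: filt_gen_def x)
  show "(\<lambda>A. mpoly_const (\<Prod>v\<in>free_entries \<sigma>. A v ^ \<rho> v) * xmon \<kappa>) \<in> filt_gen \<sigma> ` filt_index \<sigma> N L"
    unfolding filt_gen[symmetric] by (rule imageI[OF mem])
qed

lemma prod_p_power: "finite S \<Longrightarrow> S \<subseteq> {..<d} \<Longrightarrow> (\<Prod>i\<in>S. p i ^ \<mu> i) \<in> ideal_power (p ` {..<d}) (\<Sum>i\<in>S. \<mu> i)"
proof (induction S rule: finite_induct)
  case (insert i S)
  have "set (replicate (\<mu> i) (p i)) \<subseteq> p ` {..<d}" using insert.prems by auto
  from prod_list_ideal_power[OF this] have "p i ^ \<mu> i \<in> ideal_power (p ` {..<d}) (\<mu> i)"
    by (simp add: prod_list_replicate)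
  then show ?case using ideal_power_mult[of "p i ^ \<mu> i"] insert by simp
qed simp

text \<open>A factor from \<open>Z\<close> lengthens the word; a word that reaches \<open>c\<close>
  letters lies in the parameter ideal and is traded for parameters. Once
  \<open>n + c * (q * N)\<close> parameters have accumulated, \<open>c * (q * N)\<close> of them
  move the monomial of total degree \<open>q * N\<close> into the Rees algebra, and the other
  \<open>n\<close> show that the element is deep.\<close>

lemma filt_gen_step:
  assumes ix: "ix \<in> filt_index \<sigma> N (n + c * (q * N))" and x: "x \<in> \<mm>"
  shows "(\<lambda>A. mpoly_scale x (filt_gen \<sigma> ix A)) \<in>
    fm.span (filt_gen \<sigma> ` {i' \<in> filt_index \<sigma> N (n + c * (q * N)). weight ix < weight i'} \<union> deep n N)"
proof -
  define L where "L = n + c * (q * N)"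
  obtain \<kappa> \<rho> \<mu> \<nu> where ix_eq: "ix = (\<kappa>, \<rho>, \<mu>, \<nu>)" by (metis prod_cases4)
  have in_sets: "\<kappa> \<in> xexps N" "\<rho> \<in> (\<Pi>\<^sub>E v\<in>free_entries \<sigma>. {..N})" "\<mu> \<in> pexps L" "\<nu> \<in> zwords"
    using ix by (auto simp: ix_eq filt_index_def L_def)
  define V where "V = fm.span (filt_gen \<sigma> ` {i' \<in> filt_index \<sigma> N L. weight ix < weight i'} \<union> deep n N)"
  have subV: "fm.subspace V" by (simp add: V_def)
  let ?Am = "\<lambda>A. \<Prod>v\<in>free_entries \<sigma>. A v ^ \<rho> v" and ?P = "\<lambda>\<mu>. \<Prod>i<d. p i ^ \<mu> i"
  have p_step: "(\<lambda>A. mpoly_scale (p i) (filt_gen \<sigma> (\<kappa>, \<rho>, \<mu>, []) A)) \<in> V" if i: "i < d" for i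
  proof -
    define \<mu>' where "\<mu>' = \<mu>(i := Suc (\<mu> i))"
    have P: "?P \<mu>' = p i * ?P \<mu>" unfolding \<mu>'_def by (rule prod_fun_upd_Suc) (use i in auto)
    have S: "(\<Sum>i<d. \<mu>' i) = Suc (\<Sum>i<d. \<mu> i)" unfolding \<mu>'_def by (rule sum_fun_upd_Suc) (use i in auto)
    have eq: "(\<lambda>A. mpoly_scale (p i) (filt_gen \<sigma> (\<kappa>, \<rho>, \<mu>, []) A)) = filt_gen \<sigma> (\<kappa>, \<rho>, \<mu>', [])"
      unfolding filt_gen_def by (simp add: P mpoly_scale_def mpoly_const_mult mult_ac)
    show ?thesis
    proof (cases "(\<Sum>i<d. \<mu>' i) < L")
      case True
      have "\<mu>' j < L" if "j < d" for j
        using member_le_sum[of j "{..<d}" \<mu>'] True that by simp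
      then have "\<mu>' \<in> pexps L"
        using True in_sets(3) i by (auto simp: pexps_def PiE_iff extensional_def \<mu>'_def)
      then have "(\<kappa>, \<rho>, \<mu>', []) \<in> filt_index \<sigma> N L" using in_sets c_pos by (simp add: filt_index_def zwords_def)
      moreover have "weight ix < weight (\<kappa>, \<rho>, \<mu>', [])"
        using in_sets(4) unfolding weight_def ix_eq prod.case S by (simp add: zwords_def)
      ultimately show ?thesis unfolding eq V_def by (intro fm.span_base) auto
    next
      case False
      then have "(\<Sum>i<d. \<mu>' i) = L" using S in_sets(3) by (simp add: pexps_def)
      then have PL: "?P \<mu>' \<in> ideal_power (p ` {..<d}) (n + c * (q * N))"
        using prod_p_power[of "{..<d}" \<mu>'] by (simp add: L_def)
      have k: "\<forall>i<q. xdeg \<kappa> i = N" using in_sets(1) by (simp add: xexps_def)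
      then have "(\<Sum>v\<in>vars. \<kappa> v) = q * N" unfolding sum_xdeg[symmetric] by simp
      then have ab: "absorb (c * (q * N)) (xdeg \<kappa>) (xmon \<kappa>)" using absorb_xmon[of \<kappa>] by simp
      have R: "Rees (xdeg \<kappa>) = Rees (\<lambda>_. N)" by (rule Rees_cong) (use k in simp)
      have "filt_gen \<sigma> (\<kappa>, \<rho>, \<mu>', []) A \<in> param_Rees n (\<lambda>_. N)" for A
      proof -
        have "?Am A * (?P \<mu>' * prod_list []) \<in> ideal_power (p ` {..<d}) (n + c * (q * N))"
          using rg.subspace_scale[OF subspace_ideal_power PL] by simp
        then have "filt_gen \<sigma> (\<kappa>, \<rho>, \<mu>', []) A \<in> param_Rees n (xdeg \<kappa>)"
          using ab unfolding absorb_def filt_gen_def prod.case by blast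
        then show ?thesis by (simp add: ideal_Rees_def R)
      qed
      then have "filt_gen \<sigma> (\<kappa>, \<rho>, \<mu>', []) \<in> deep n N" by (simp add: deep_def)
      then show ?thesis unfolding eq V_def by (intro fm.span_base) simp
    qed
  qed
  have z_step: "z \<in> {x. (\<lambda>A. mpoly_scale x (filt_gen \<sigma> ix A)) \<in> V}" if z: "z \<in> Z" for z
  proof (cases "Suc (length \<nu>) < c")
    case True
    have "(\<lambda>A. mpoly_scale z (filt_gen \<sigma> ix A)) = filt_gen \<sigma> (\<kappa>, \<rho>, \<mu>, z # \<nu>)"
      unfolding filt_gen_def ix_eq by (simp add: mpoly_scale_def mpoly_const_mult mult_ac)
    moreover have "(\<kappa>, \<rho>, \<mu>, z # \<nu>) \<in> filt_index \<sigma> N L" using in_sets True z by (simp add: filt_index_def zwords_def)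
    moreover have "weight ix < weight (\<kappa>, \<rho>, \<mu>, z # \<nu>)" by (simp add: weight_def ix_eq)
    ultimately show ?thesis unfolding V_def by (auto intro!: fm.span_base)
  next
    case False
    have "set (z # \<nu>) \<subseteq> \<mm>" "length (z # \<nu>) = c"
      using False in_sets(4) z Z(2) rg.span_superset[of Z] by (auto simp: zwords_def)
    then have "prod_list (z # \<nu>) \<in> rg.span (p ` {..<d})" by (rule pow_c)
    moreover have "rg.span (p ` {..<d}) \<subseteq> {s. (\<lambda>A. mpoly_scale s (filt_gen \<sigma> (\<kappa>, \<rho>, \<mu>, []) A)) \<in> V}"
      using p_step by (intro rg.span_minimal rg_subspace_fm_scale_vimage[OF subV]) auto
    moreover have "(\<lambda>A. mpoly_scale z (filt_gen \<sigma> ix A)) =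
        (\<lambda>A. mpoly_scale (prod_list (z # \<nu>)) (filt_gen \<sigma> (\<kappa>, \<rho>, \<mu>, []) A))"
      unfolding filt_gen_def ix_eq by (simp add: mpoly_scale_def mpoly_const_mult mult_ac)
    ultimately show ?thesis by auto
  qed
  have "rg.span Z \<subseteq> {x. (\<lambda>A. mpoly_scale x (filt_gen \<sigma> ix A)) \<in> V}"
    using z_step by (intro rg.span_minimal rg_subspace_fm_scale_vimage[OF subV]) auto
  then show ?thesis using x Z(2) unfolding V_def L_def by blast
qed

end

section \<open>Counting\<close>

context finite_colength_forms
begin

lemma card_vars: "card vars = (\<Sum>i<q. r i)"
  by (simp add: vars_def)

lemma q_le_card_vars: "q \<le> card vars"
  using sum_mono[of "{..<q}" "\<lambda>_. 1" r] r_pos by (simp add: card_vars)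

text \<open>For each pair \<open>(i, b)\<close> exactly the entry \<open>(i, \<sigma> i, b)\<close>
  is solved for.\<close>

lemma card_free_entries:
  assumes "\<sigma> \<in> choices"
  shows "card (free_entries \<sigma>) + card vars = card entries"
proof -
  have un: "entries = free_entries \<sigma> \<union> (\<lambda>(i, b). (i, \<sigma> i, b)) ` vars"
    using choices_less[OF assms] by (auto simp: entries_def free_entries_def vars_def)
  moreover have "free_entries \<sigma> \<inter> (\<lambda>(i, b). (i, \<sigma> i, b)) ` vars = {}" by (auto simp: free_entries_def)
  moreover have "card ((\<lambda>(i, b). (i, \<sigma> i, b)) ` vars) = card vars"
    by (intro card_image) (auto simp: inj_on_def)
  ultimately show ?thesis
    unfolding un by (subst card_Un_disjoint) (auto simp del: image_iff)
qed

text \<open>In each of the \<open>q\<close> blocks of variables the prescribed degree determines the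
  exponent of \<open>(i, 0)\<close> from the others. This is the saving of \<open>q\<close> that
  compensates for the \<open>d\<close> parameters.\<close>

lemma card_xexps: "finite (xexps N) \<and> card (xexps N) \<le> (N + 1) ^ (card vars - q)"
proof -
  define vars1 where "vars1 = {v \<in> vars. snd v \<noteq> 0}"
  have fin1: "finite vars1" by (simp add: vars1_def)
  have un: "vars = vars1 \<union> (\<lambda>i. (i, 0)) ` {..<q}"
    using r_pos by (fastforce simp: vars1_def vars_def)
  have "vars1 \<inter> (\<lambda>i. (i, 0)) ` {..<q} = {}" by (auto simp: vars1_def)
  moreover have "card ((\<lambda>i. (i, 0 :: nat)) ` {..<q}) = q"
    by (subst card_image) (auto simp: inj_on_def)
  ultimately have "card vars = card vars1 + q"
    using fin1 by (subst un, subst card_Un_disjoint) auto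
  then have c1: "card vars1 = card vars - q" by simp
  have fin: "finite (xexps N)"
    by (rule finite_subset[of _ "\<Pi>\<^sub>E v\<in>vars. {..N}"]) (auto simp: xexps_def intro: finite_PiE)
  have "inj_on (\<lambda>\<kappa>. restrict \<kappa> vars1) (xexps N)"
  proof (rule inj_onI)
    fix \<kappa> \<kappa>' assume k: "\<kappa> \<in> xexps N" "\<kappa>' \<in> xexps N" "restrict \<kappa> vars1 = restrict \<kappa>' vars1"
    have eq1: "\<kappa> v = \<kappa>' v" if "v \<in> vars1" for v using k(3) that by (metis restrict_apply')
    have "\<kappa> v = \<kappa>' v" if v: "v \<in> vars" for v
    proof (cases "v \<in> vars1")
      case False
      define i where "i = fst v"
      have iq: "i < q" and v0: "v = (i, 0)" using v False by (auto simp: vars_def vars1_def i_def)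
      have split: "xdeg \<kappa>'' i = \<kappa>'' v + (\<Sum>w\<in>vars - {v}. \<kappa>'' w * \<delta> (fst w) i)" for \<kappa>''
        unfolding xdeg_def using v by (subst sum.remove[of vars v]) (auto simp: i_def \<delta>_def)
      have "\<kappa> w * \<delta> (fst w) i = \<kappa>' w * \<delta> (fst w) i" if w: "w \<in> vars - {v}" for w
      proof (cases "fst w = i")
        case True
        then have "w \<in> vars1" using w v0 by (cases w) (auto simp: vars1_def)
        then show ?thesis using eq1 by simp
      qed (simp add: \<delta>_def)
      then have "(\<Sum>w\<in>vars - {v}. \<kappa> w * \<delta> (fst w) i) = (\<Sum>w\<in>vars - {v}. \<kappa>' w * \<delta> (fst w) i)"
        by (intro sum.cong) auto
      moreover have "xdeg \<kappa> i = xdeg \<kappa>' i" using k iq by (simp add: xexps_def)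
      ultimately show ?thesis using split[of \<kappa>] split[of \<kappa>'] by simp
    qed (rule eq1)
    then show "\<kappa> = \<kappa>'"
      using k by (intro PiE_ext[of \<kappa> vars "\<lambda>_. {..N}" \<kappa>']) (auto simp: xexps_def)
  qed
  moreover have "(\<lambda>\<kappa>. restrict \<kappa> vars1) ` xexps N \<subseteq> (\<Pi>\<^sub>E v\<in>vars1. {..N})"
  proof (rule image_subsetI)
    fix \<kappa> assume "\<kappa> \<in> xexps N"
    then have "\<kappa> v \<le> N" if "v \<in> vars1" for v using that by (auto simp: xexps_def vars1_def)
    then show "restrict \<kappa> vars1 \<in> (\<Pi>\<^sub>E v\<in>vars1. {..N})" by simp
  qed
  ultimately have "card (xexps N) \<le> card (\<Pi>\<^sub>E v\<in>vars1. {..N})"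
    using fin1 by (intro card_inj_on_le) (auto intro: finite_PiE)
  then show ?thesis using fin fin1 c1 by (simp add: card_PiE)
qed

lemma finite_zwords: "finite zwords"
  using finite_lists_length_le[OF Z(1), of c]
  by (rule finite_subset[rotated]) (auto simp: zwords_def)

lemma card_pexps: "finite (pexps L) \<and> card (pexps L) \<le> L ^ d"
proof -
  have "pexps L \<subseteq> (\<Pi>\<^sub>E i\<in>{..<d}. {..<L})" by (auto simp: pexps_def)
  moreover have "finite (\<Pi>\<^sub>E i\<in>{..<d}. {..<L})" by (intro finite_PiE) auto
  ultimately show ?thesis using card_mono[of "\<Pi>\<^sub>E i\<in>{..<d}. {..<L}" "pexps L"] finite_subset
    by (auto simp: card_PiE)
qed

lemma card_box: "card (box n) = n ^ card entries"
  by (simp add: box_def card_PiE)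

text \<open>
  Large enough for the \<open>bound ^ (card entries + 1)\<close> products of a power of a parameter with a
  \<open>box_form\<close> to outnumber the index set of the filtration, which has at most
  \<open>card zwords * (C * bound) ^ card entries\<close> elements because \<open>d \<le> q\<close>.
\<close>

definition bound :: nat where
  "bound = (let C = card entries + 2 + c * q * card entries in card zwords * C ^ card entries + 1)"

lemma bound_pos: "bound > 0"
  by (simp add: bound_def Let_def)

lemma card_filt_index:
  assumes \<sigma>: "\<sigma> \<in> choices"
  defines "N \<equiv> card entries * bound"
  shows "finite (filt_index \<sigma> N (bound + c * (q * N)))"
    and "card (filt_index \<sigma> N (bound + c * (q * N))) < bound * card (box bound)"
proof -
  \<comment> \<open>Chosen so that \<open>C * bound\<close> dominates both \<open>N + 1\<close> and
    \<open>L\<close>, which are linear in \<open>bound\<close>.\<close>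
  define C where "C = card entries + 2 + c * q * card entries"
  define L where "L = bound + c * (q * N)"
  define B where "B = C * bound"
  have bound: "bound = card zwords * C ^ card entries + 1" by (simp add: bound_def C_def Let_def)
  have NB: "N + 1 \<le> B" using bound_pos by (simp add: N_def B_def C_def algebra_simps)
  have "B = (card entries + 2 + c * q * card entries) * bound" by (simp add: B_def C_def)
  also have "\<dots> = L + (card entries + 1) * bound" by (simp add: L_def N_def algebra_simps)
  finally have LB: "L \<le> B" by simp
  have B1: "B \<ge> 1" using NB by simp
  show fin: "finite (filt_index \<sigma> N (bound + c * (q * N)))"
    using card_xexps card_pexps finite_zwords by (auto simp: filt_index_def intro!: finite_cartesian_product finite_PiE)
  have "card (filt_index \<sigma> N L) = card (xexps N) * ((N + 1) ^ card (free_entries \<sigma>) * (card (pexps L) * card zwords))"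
    by (simp add: filt_index_def card_cartesian_product card_PiE)
  also have "\<dots> \<le> B ^ (card vars - q) * (B ^ card (free_entries \<sigma>) * (B ^ d * card zwords))"
  proof (intro mult_le_mono)
    show "card (xexps N) \<le> B ^ (card vars - q)"
      using card_xexps[of N] power_mono[OF NB, of "card vars - q"] by simp
    show "(N + 1) ^ card (free_entries \<sigma>) \<le> B ^ card (free_entries \<sigma>)" using NB by (intro power_mono) auto
    show "card (pexps L) \<le> B ^ d" using card_pexps[of L] power_mono[OF LB, of d] by simp
  qed simp
  also have "\<dots> = B ^ (card vars - q + card (free_entries \<sigma>) + d) * card zwords"
    by (simp add: power_add mult_ac)
  \<comment> \<open>The exponent is at most \<open>card entries\<close> because the free entries and
    the variables together are as many as the entries, and \<open>d \<le> q\<close>.\<close>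
  also have "\<dots> \<le> B ^ card entries * card zwords"
    using card_free_entries[OF \<sigma>] d_le q_le_card_vars B1 by (intro mult_le_mono power_increasing) auto
  also have "\<dots> = (card zwords * C ^ card entries) * bound ^ card entries"
    by (simp add: B_def power_mult_distrib)
  also have "\<dots> < bound * bound ^ card entries"
    using bound bound_pos by (intro mult_strict_right_mono) auto
  finally show "card (filt_index \<sigma> N (bound + c * (q * N))) < bound * card (box bound)"
    by (simp add: card_box L_def)
qed

text \<open>The products of powers of the parameter with box forms are ordered by the power first.
  By \<open>exists_mem_span_later\<close> one of them is a combination of later ones modulo deep
  elements: later ones either have the same power and another \<open>\<tau>\<close>, or contain a
  further factor of the parameter. Bringing the former to one side leaves coefficient 1 at the
  distinguished \<open>\<tau>\<close>.\<close>

lemma forms_relation: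
  assumes \<sigma>: "\<sigma> \<in> choices" and i0: "i0 < d"
  defines "N \<equiv> card entries * bound"
  shows "\<exists>a F. (\<exists>\<tau>\<in>box bound. F \<tau> = 1) \<and>
    (\<forall>A. mpoly_const (p i0 ^ a) * (\<Sum>\<tau>\<in>box bound. mpoly_const (F \<tau>) * box_form \<sigma> bound \<tau> A) \<in> param_Rees (Suc a) (\<lambda>_. N))"
proof -
  define L where "L = bound + c * (q * N)"
  let ?T = "card (box bound)"
  have Tpos: "?T > 0" using bound_pos by (simp add: card_box)
  obtain en where en: "bij_betw en {..<?T} (box bound)"
    using ex_bij_betw_nat_finite[OF finite_box] by (auto simp: atLeast0LessThan)
  then have en_in: "en t \<in> box bound" if "t < ?T" for t using that bij_betwE by blast
  \<comment> \<open>Lexicographic numbering: the quotient by \<open>?T\<close> is the power of the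
    parameter, the remainder selects the box form.\<close>
  define v where "v j = (\<lambda>A. mpoly_scale (p i0 ^ (j div ?T)) (box_form \<sigma> bound (en (j mod ?T)) A))" for j
  have modT: "j mod ?T < ?T" for j using Tpos by simp
  have WT: "box_form \<sigma> bound (en (j mod ?T)) A \<in> Rees (\<lambda>_. N)" for j A
    using box_form_T[OF \<sigma> en_in[OF modT]] by (simp add: T_def N_def)
  have pp: "p i0 ^ k \<in> ideal_power (p ` {..<d}) k" for k
    using prod_p_power[of "{i0}" "\<lambda>_. k"] i0 by simp
  have "\<exists>j\<in>{..<bound * ?T}. v j \<in> fm.span (v ` {j' \<in> {..<bound * ?T}. j < j'} \<union> deep bound N)"
  proof (rule fm.exists_mem_span_later[of \<mm> "filt_index \<sigma> N L" _ _ "filt_gen \<sigma>" weight])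
    show "finite (filt_index \<sigma> N L)" "card (filt_index \<sigma> N L) < card {..<bound * ?T}"
      using card_filt_index[OF \<sigma>] by (simp_all add: L_def N_def)
    show "(\<lambda>A. mpoly_scale x (filt_gen \<sigma> i A)) \<in> fm.span (filt_gen \<sigma> ` {i' \<in> filt_index \<sigma> N L. weight i < weight i'} \<union> deep bound N)"
      if "i \<in> filt_index \<sigma> N L" "x \<in> \<mm>" for i x
      using filt_gen_step[of i \<sigma> N bound x] that by (simp add: L_def)
    fix j assume "j \<in> {..<bound * ?T}"
    have "L > 0" using bound_pos by (simp add: L_def)
    then have "box_form \<sigma> bound (en (j mod ?T)) \<in> fm.span (filt_gen \<sigma> ` filt_index \<sigma> N L)"
      using box_form_poly_fun[OF \<sigma> en_in[OF modT]] poly_fun_subset_span_filt_gen unfolding N_def by blast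
    then have "v j \<in> fm.span (filt_gen \<sigma> ` filt_index \<sigma> N L)" unfolding v_def by (rule fm.span_scale)
    then show "v j \<in> fm.span (filt_gen \<sigma> ` filt_index \<sigma> N L \<union> deep bound N)"
      using fm.span_mono[of "filt_gen \<sigma> ` filt_index \<sigma> N L" "filt_gen \<sigma> ` filt_index \<sigma> N L \<union> deep bound N"] by blast
  qed (use unit in auto)
  then obtain j where j: "j < bound * ?T"
    "v j \<in> fm.span (v ` {j' \<in> {..<bound * ?T}. j < j'} \<union> deep bound N)" by auto
  define a where "a = j div ?T"
  define \<tau>0 where "\<tau>0 = en (j mod ?T)"
  have a: "a < bound" using j(1) Tpos by (simp add: a_def less_mult_imp_div_less)
  define form_comb where "form_comb F A = (\<Sum>\<tau>\<in>box bound. mpoly_const (F \<tau>) * box_form \<sigma> bound \<tau> A)" for F A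
  have form_comb_delta: "form_comb (\<lambda>\<tau>. if \<tau> = \<tau>1 then 1 else 0) A = box_form \<sigma> bound \<tau>1 A" if "\<tau>1 \<in> box bound" for \<tau>1 A
  proof -
    have "form_comb (\<lambda>\<tau>. if \<tau> = \<tau>1 then 1 else 0) A = (\<Sum>\<tau>\<in>box bound. if \<tau> = \<tau>1 then box_form \<sigma> bound \<tau> A else 0)"
      unfolding form_comb_def by (intro sum.cong) auto
    then show ?thesis using that by simp
  qed
  have form_comb_add: "form_comb (\<lambda>\<tau>. F \<tau> + F' \<tau>) A = form_comb F A + form_comb F' A" for F F' A
    by (simp add: form_comb_def mpoly_const_add distrib_right sum.distrib)
  have form_comb_diff: "form_comb (\<lambda>\<tau>. F \<tau> - F' \<tau>) A = form_comb F A - form_comb F' A" for F F' A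
    by (simp add: form_comb_def mpoly_const_diff left_diff_distrib sum_subtractf)
  have form_comb_scale: "form_comb (\<lambda>\<tau>. b * F \<tau>) A = mpoly_const b * form_comb F A" for F A b
    by (simp add: form_comb_def mpoly_const_mult sum_distrib_left mult.assoc)
  have form_comb_zero: "form_comb (\<lambda>_. 0) A = 0" for A by (simp add: form_comb_def)
  \<comment> \<open>Everything that may occur on the other side of the relation: combinations of box
    forms with the same power of the parameter, avoiding \<open>\<tau>0\<close>, up to elements with
    one parameter more. Deep elements qualify since \<open>a < bound\<close>.\<close>
  define V where "V = {\<phi>. \<exists>F. F \<tau>0 = 0 \<and> (\<forall>A. \<phi> A - mpoly_const (p i0 ^ a) * form_comb F A \<in> param_Rees (Suc a) (\<lambda>_. N))}"
  let ?R = "param_Rees (Suc a) (\<lambda>_. N)"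
  have "fm.subspace V"
  proof (rule fm.subspaceI)
    show "0 \<in> V" unfolding V_def
      by (intro CollectI exI[of _ "\<lambda>_. 0"]) (simp add: form_comb_zero mp.subspace_0)
    fix x y assume "x \<in> V" "y \<in> V"
    then obtain F F' where F: "F \<tau>0 = 0" "\<And>A. x A - mpoly_const (p i0 ^ a) * form_comb F A \<in> ?R"
      and F': "F' \<tau>0 = 0" "\<And>A. y A - mpoly_const (p i0 ^ a) * form_comb F' A \<in> ?R" by (auto simp: V_def)
    have "(x + y) A - mpoly_const (p i0 ^ a) * form_comb (\<lambda>\<tau>. F \<tau> + F' \<tau>) A \<in> ?R" for A
      using mp.subspace_add[OF subspace_ideal_Rees F(2)[of A] F'(2)[of A]]
      by (simp add: form_comb_add algebra_simps)
    then show "x + y \<in> V" using F(1) F'(1) unfolding V_def by (intro CollectI exI[of _ "\<lambda>\<tau>. F \<tau> + F' \<tau>"]) simp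
  next
    fix b x assume "x \<in> V"
    then obtain F where F: "F \<tau>0 = 0" "\<And>A. x A - mpoly_const (p i0 ^ a) * form_comb F A \<in> ?R" by (auto simp: V_def)
    have "mpoly_scale b (x A) - mpoly_const (p i0 ^ a) * form_comb (\<lambda>\<tau>. b * F \<tau>) A \<in> ?R" for A
      using mp_subspace_mult[OF subspace_ideal_Rees F(2)[of A], of b]
      by (simp add: form_comb_scale mpoly_scale_def algebra_simps)
    then show "(\<lambda>A. mpoly_scale b (x A)) \<in> V"
      using F(1) unfolding V_def by (intro CollectI exI[of _ "\<lambda>\<tau>. b * F \<tau>"]) simp
  qed
  moreover have "v j' \<in> V" if "j < j'" for j'
  proof (cases "j' div ?T = a")
    case True
    define \<tau>1 where "\<tau>1 = en (j' mod ?T)"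
    have "j' mod ?T \<noteq> j mod ?T" using True that by (metis a_def div_mult_mod_eq less_irrefl)
    then have "\<tau>1 \<noteq> \<tau>0" using en modT unfolding \<tau>1_def \<tau>0_def bij_betw_def inj_on_def by blast
    moreover have "\<tau>1 \<in> box bound" unfolding \<tau>1_def by (rule en_in[OF modT])
    ultimately show ?thesis
      unfolding V_def using True
      by (intro CollectI exI[of _ "\<lambda>\<tau>. if \<tau> = \<tau>1 then 1 else 0"])
        (simp add: form_comb_delta v_def mpoly_scale_def \<tau>1_def mp.subspace_0)
  next
    case False
    have "a \<le> j' div ?T" unfolding a_def using that by (intro div_le_mono) simp
    then have "Suc a \<le> j' div ?T" using False by simp
    then have "v j' A \<in> ?R" for A
      using ideal_Rees_base[OF pp WT] param_Rees_antimono by (fastforce simp: v_def mpoly_scale_def)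
    then show ?thesis unfolding V_def by (intro CollectI exI[of _ "\<lambda>_. 0"]) (simp add: form_comb_zero)
  qed
  moreover have "deep bound N \<subseteq> V"
  proof
    fix \<phi> assume "\<phi> \<in> deep bound N"
    then have "\<phi> A \<in> ?R" for A using param_Rees_antimono[of "Suc a" bound] a by (auto simp: deep_def)
    then show "\<phi> \<in> V" unfolding V_def by (intro CollectI exI[of _ "\<lambda>_. 0"]) (simp add: form_comb_zero)
  qed
  ultimately have "fm.span (v ` {j' \<in> {..<bound * ?T}. j < j'} \<union> deep bound N) \<subseteq> V"
    by (intro fm.span_minimal) auto
  then have "v j \<in> V" using j(2) by blast
  then obtain F where F: "F \<tau>0 = 0" "\<And>A. v j A - mpoly_const (p i0 ^ a) * form_comb F A \<in> ?R"
    by (auto simp: V_def)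
  let ?F = "\<lambda>\<tau>. (if \<tau> = \<tau>0 then 1 else 0) - F \<tau>"
  have \<tau>0: "\<tau>0 \<in> box bound" unfolding \<tau>0_def by (rule en_in[OF modT])
  have "v j A = mpoly_const (p i0 ^ a) * box_form \<sigma> bound \<tau>0 A" for A
    by (simp add: v_def mpoly_scale_def a_def \<tau>0_def)
  then have "mpoly_const (p i0 ^ a) * form_comb ?F A \<in> ?R" for A
    using F(2)[of A] unfolding form_comb_diff form_comb_delta[OF \<tau>0] by (simp add: right_diff_distrib)
  then show ?thesis
    using F(1) \<tau>0 unfolding form_comb_def by (intro exI[of _ a] exI[of _ ?F]) auto
qed

end

section \<open>Integrality over the maximal ideal\<close>

lemma lookup_mult_mem:
  assumes "rg.subspace V" "\<And>s t. Poly_Mapping.lookup f s * Poly_Mapping.lookup g t \<in> V"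
  shows "Poly_Mapping.lookup (f * g) u \<in> V"
proof -
  let ?f = "\<lambda>s. Poly_Mapping.lookup f s" and ?g = "\<lambda>t. Poly_Mapping.lookup g t"
  have "f * g = (\<Sum>s\<in>Poly_Mapping.keys f. Poly_Mapping.single s (?f s)) *
      (\<Sum>t\<in>Poly_Mapping.keys g. Poly_Mapping.single t (?g t))"
    by (intro arg_cong2[where f = "(*)"] mpoly_sum_singles) auto
  then have "Poly_Mapping.lookup (f * g) u = (\<Sum>s\<in>Poly_Mapping.keys f. \<Sum>t\<in>Poly_Mapping.keys g.
      (if s + t = u then ?f s * ?g t else 0))"
    by (simp only: sum_product mult_single lookup_sum lookup_single when_def)
  also have "\<dots> \<in> V"
    using assms(2) rg.subspace_0[OF assms(1)] by (intro rg.subspace_sum[OF assms(1)]) auto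
  finally show ?thesis .
qed

lemma list_of_image:
  assumes "set u \<subseteq> f ` A"
  obtains w where "u = map f w" "set w \<subseteq> A"
proof -
  have "u \<in> map f ` lists A" using assms unfolding lists_image[symmetric] by (simp add: lists_eq_set)
  then show ?thesis using that by (auto simp: lists_eq_set)
qed

lemma remove_letters:
  fixes p :: "'i \<Rightarrow> 'b::comm_monoid_mult"
  assumes "a \<le> count_list w i"
  shows "\<exists>w'. set w' \<subseteq> set w \<and> length w' + a = length w \<and>
    prod_list (map p w) = p i ^ a * prod_list (map p w')"
  using assms
proof (induction w arbitrary: a)
  case (Cons x w)
  show ?case
  proof (cases "x = i \<and> a > 0")
    case True
    then obtain a' where a': "a = Suc a'" using gr0_conv_Suc by blast
    with Cons.prems True have "a' \<le> count_list w i" by simp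
    from Cons.IH[OF this] obtain w' where "set w' \<subseteq> set w" "length w' + a' = length w"
      "prod_list (map p w) = p i ^ a' * prod_list (map p w')" by blast
    then show ?thesis using True a' by (intro exI[of _ w']) (auto simp: mult.assoc)
  next
    case False
    then have "a \<le> count_list w i" using Cons.prems by (auto split: if_splits)
    from Cons.IH[OF this] obtain w' where "set w' \<subseteq> set w" "length w' + a = length w"
      "prod_list (map p w) = p i ^ a * prod_list (map p w')" by blast
    then show ?thesis by (intro exI[of _ "x # w'"]) (auto simp: mult.left_commute)
  qed
qed simp

context finite_colength_forms
begin

section \<open>Homogeneous ideals of the diagonal subalgebra and congruences modulo them\<close>

definition gideal :: "(nat \<Rightarrow> (nat \<times> nat, 'a) mpoly set) \<Rightarrow> bool" where
  "gideal J \<longleftrightarrow> (\<forall>n. mp.subspace (J n) \<and> J n \<subseteq> T n) \<and>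
     (\<forall>k n x y. x \<in> J k \<longrightarrow> y \<in> T n \<longrightarrow> x * y \<in> J (k + n))"

lemma gideal_subspace: "gideal J \<Longrightarrow> mp.subspace (J n)"
  and gideal_subset: "gideal J \<Longrightarrow> J n \<subseteq> T n"
  and gideal_mult: "gideal J \<Longrightarrow> x \<in> J k \<Longrightarrow> y \<in> T n \<Longrightarrow> x * y \<in> J (k + n)"
  unfolding gideal_def by blast+

lemma gideal_mult_left: "gideal J \<Longrightarrow> y \<in> T k \<Longrightarrow> x \<in> J n \<Longrightarrow> y * x \<in> J (k + n)"
  using gideal_mult[of J x n y k] by (simp add: mult.commute add.commute)

lemma gideal_cong_mult:
  assumes "gideal J" "x \<in> T k" "y' \<in> T n" "x - x' \<in> J k" "y - y' \<in> J n"
  shows "x * y - x' * y' \<in> J (k + n)"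
proof -
  have "x * y - x' * y' = x * (y - y') + (x - x') * y'" by (simp add: algebra_simps)
  then show ?thesis
    using gideal_mult_left[OF assms(1,2,5)] gideal_mult[OF assms(1,4,3)]
    by (simp add: mp.subspace_add[OF gideal_subspace[OF assms(1)]])
qed

lemma gideal_cong_power:
  assumes "gideal J" "x \<in> T k" "x' \<in> T k" "x - x' \<in> J k"
  shows "x ^ n - x' ^ n \<in> J (k * n)"
proof (induction n)
  case 0
  then show ?case using mp.subspace_0[OF gideal_subspace[OF assms(1)]] by simp
next
  case (Suc n)
  then show ?case
    using gideal_cong_mult[OF assms(1,2) T_power[OF assms(3)] assms(4) Suc] by simp
qed

lemma gideal_cong_prod:
  assumes "gideal J" "finite A"
    and "\<And>i. i \<in> A \<Longrightarrow> x i \<in> T (k i)" "\<And>i. i \<in> A \<Longrightarrow> x' i \<in> T (k i)" "\<And>i. i \<in> A \<Longrightarrow> x i - x' i \<in> J (k i)"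
  shows "(\<Prod>i\<in>A. x i) - (\<Prod>i\<in>A. x' i) \<in> J (\<Sum>i\<in>A. k i)"
  using assms(2-5)
proof (induction A rule: finite_induct)
  case empty
  then show ?case using mp.subspace_0[OF gideal_subspace[OF assms(1)]] by simp
next
  case (insert i A)
  have "x i * (\<Prod>i\<in>A. x i) - x' i * (\<Prod>i\<in>A. x' i) \<in> J (k i + (\<Sum>i\<in>A. k i))"
    by (rule gideal_cong_mult[OF assms(1)]) (use insert in \<open>auto intro!: T_prod\<close>)
  then show ?case using insert.hyps by simp
qed

definition max_ideal_part :: "nat \<Rightarrow> (nat \<times> nat, 'a) mpoly set" where
  "max_ideal_part n = ideal_Rees \<mm> (\<lambda>_. n)"

lemma gideal_max_ideal_part: "gideal max_ideal_part"
  unfolding gideal_def max_ideal_part_def T_def using ideal_Rees_mult ideal_Rees_subset_Rees by fastforce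

lemma mm_power_subset: "ideal_power \<mm> (c * n) \<subseteq> ideal_power (p ` {..<d}) n"
proof (induction n)
  case (Suc n)
  have "ideal_power \<mm> c \<subseteq> ideal_power (p ` {..<d}) 1"
    unfolding ideal_power_1 unfolding ideal_power_def using pow_c by (intro rg.span_minimal) auto
  show ?case
  proof
    fix s assume "s \<in> ideal_power \<mm> (c * Suc n)"
    then have "s \<in> ideal_power \<mm> (c + c * n)" by simp
    then show "s \<in> ideal_power (p ` {..<d}) (Suc n)"
    proof (rule ideal_power_add_mem)
      fix a b assume "a \<in> ideal_power \<mm> c" "b \<in> ideal_power \<mm> (c * n)"
      then have "a \<in> ideal_power (p ` {..<d}) 1" "b \<in> ideal_power (p ` {..<d}) n"
        using \<open>ideal_power \<mm> c \<subseteq> _\<close> Suc by auto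
      from ideal_power_mult[OF this] show "a * b \<in> ideal_power (p ` {..<d}) (Suc n)" by simp
    qed simp
  qed
qed simp

text \<open>Let h be the product of the f_i, N the sum of the a_i and Q the parameter ideal. Then h
  Q^N lies in Q^(N+1) times the Rees algebra, so multiplication by h on the words of length N has
  coefficients in the maximal ideal. Elimination gives an element congruent to a power of h that
  annihilates Q^N, and such an element is nilpotent.\<close>

lemma forms_power_mem_max_ideal_part:
  assumes f: "\<And>i. i < d \<Longrightarrow> f i \<in> T k"
    and pf: "\<And>i. i < d \<Longrightarrow> mpoly_const (p i ^ a i) * f i \<in> param_Rees (Suc (a i)) (\<lambda>_. k)"
  shows "\<exists>n. (\<Prod>i<d. f i) ^ n \<in> max_ideal_part (d * k * n)"
proof -
  define h where "h = (\<Prod>i<d. f i)"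
  define N where "N = (\<Sum>i<d. a i)"
  define W where "W = {w. set w \<subseteq> {..<d} \<and> length w = N}"
  have finW: "finite W" unfolding W_def by (rule finite_lists_length_eq) simp
  define P where "P w = (mpoly_const (prod_list (map p w)) :: (nat \<times> nat, 'a) mpoly)" for w
  have hT: "h \<in> T (d * k)" using T_prod[of "{..<d}" f "\<lambda>_. k"] f by (simp add: h_def)
  have pl: "prod_list (map p w) \<in> ideal_power (p ` {..<d}) (length w)" if "set w \<subseteq> {..<d}" for w
    using prod_list_ideal_power[of "map p w" "p ` {..<d}"] that by auto
  have hP: "h * P w \<in> param_Rees (Suc N) (\<lambda>_. d * k)" if w: "w \<in> W" for w
  proof -
    \<comment> \<open>Pigeonhole on the letters of a word of length \<open>N\<close>; the strict
      inequality between the sums uses \<open>d > 0\<close>.\<close>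
    have "\<exists>i<d. a i \<le> count_list w i"
    proof (rule ccontr)
      assume "\<not> ?thesis"
      then have "(\<Sum>i<d. count_list w i) < N"
        unfolding N_def using d_pos by (intro sum_strict_mono) auto
      moreover have "(\<Sum>i<d. count_list w i) = length w"
        using w by (intro sum_count_set) (auto simp: W_def)
      ultimately show False using w by (simp add: W_def)
    qed
    then obtain i where i: "i < d" "a i \<le> count_list w i" by blast
    obtain w' where w': "set w' \<subseteq> set w" "length w' + a i = length w"
      "prod_list (map p w) = p i ^ a i * prod_list (map p w')"
      using remove_letters[OF i(2), of p] by blast
    have "prod_list (map p w') \<in> ideal_power (p ` {..<d}) (length w')"
      using w w'(1) by (intro pl) (auto simp: W_def)
    from param_Rees_const_mult[OF this pf[OF i(1)]]
    have 1: "mpoly_const (prod_list (map p w')) * (mpoly_const (p i ^ a i) * f i) \<in> param_Rees (Suc N) (\<lambda>_. k)"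
      using w' w by (simp add: W_def)
    have "(\<Prod>j\<in>{..<d} - {i}. f j) \<in> T ((d - 1) * k)"
      using T_prod[of "{..<d} - {i}" f "\<lambda>_. k"] f i(1) by simp
    from ideal_Rees_mult[OF 1 this[unfolded T_def]]
    have "mpoly_const (prod_list (map p w')) * (mpoly_const (p i ^ a i) * f i) * (\<Prod>j\<in>{..<d} - {i}. f j)
        \<in> param_Rees (Suc N) (\<lambda>_. k + (d - 1) * k)" .
    moreover have "k + (d - 1) * k = d * k" using d_pos by (cases d) auto
    moreover have "h = f i * (\<Prod>j\<in>{..<d} - {i}. f j)"
      unfolding h_def using i(1) by (intro prod.remove) auto
    then have "h * P w = mpoly_const (prod_list (map p w')) * (mpoly_const (p i ^ a i) * f i) *
        (\<Prod>j\<in>{..<d} - {i}. f j)"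
      by (simp add: P_def w'(3) mpoly_const_mult mult_ac)
    ultimately show ?thesis by simp
  qed
  \<comment> \<open>From a word of length \<open>N + 1\<close> one letter is split off as a
    coefficient in \<open>\<mm>\<close>; what remains is a word in \<open>W\<close>.\<close>
  have decomp: "\<exists>b. (\<forall>w\<in>W. b w \<in> max_ideal_part n) \<and> x = (\<Sum>w\<in>W. b w * P w)" if x: "x \<in> param_Rees (Suc N) (\<lambda>_. n)" for x n
  proof -
    define V where "V = {x. \<exists>b. (\<forall>w\<in>W. b w \<in> max_ideal_part n) \<and> x = (\<Sum>w\<in>W. b w * P w)}"
    note sub = gideal_subspace[OF gideal_max_ideal_part, of n]
    have V: "mp.subspace V"
    proof (rule mp.subspaceI)
      show "0 \<in> V" unfolding V_def by (intro CollectI exI[of _ "\<lambda>_. 0"]) (simp add: mp.subspace_0[OF sub])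
      fix x y assume "x \<in> V" "y \<in> V"
      then obtain b b' where "\<forall>w\<in>W. b w \<in> max_ideal_part n" "x = (\<Sum>w\<in>W. b w * P w)"
        "\<forall>w\<in>W. b' w \<in> max_ideal_part n" "y = (\<Sum>w\<in>W. b' w * P w)" by (auto simp: V_def)
      then show "x + y \<in> V" unfolding V_def
        by (intro CollectI exI[of _ "\<lambda>w. b w + b' w"])
          (simp add: mp.subspace_add[OF sub] distrib_right sum.distrib)
    next
      fix s x assume "x \<in> V"
      then obtain b where "\<forall>w\<in>W. b w \<in> max_ideal_part n" "x = (\<Sum>w\<in>W. b w * P w)" by (auto simp: V_def)
      then show "mpoly_scale s x \<in> V" unfolding V_def
        by (intro CollectI exI[of _ "\<lambda>w. mpoly_scale s (b w)"])
          (simp add: mp.subspace_scale[OF sub] mp.scale_sum_right mpoly_scale_mult_left)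
    qed
    have "mpoly_const s * y \<in> V" if s: "s \<in> ideal_power (p ` {..<d}) (Suc N)" and y: "y \<in> Rees (\<lambda>_. n)" for s y
    proof -
      have "ideal_power (p ` {..<d}) (Suc N) \<subseteq> {s. mpoly_const s * y \<in> V}"
        unfolding ideal_power_def
      proof (intro rg.span_minimal rg_subspace_const_vimage V subsetI)
        fix s assume "s \<in> {prod_list w |w. set w \<subseteq> p ` {..<d} \<and> length w = Suc N}"
        then obtain u where u: "s = prod_list u" "set u \<subseteq> p ` {..<d}" "length u = Suc N" by blast
        from u(2) obtain w0 where "u = map p w0" "set w0 \<subseteq> {..<d}" by (rule list_of_image)
        with u(3) obtain i w where w: "u = p i # map p w" "i < d" "set w \<subseteq> {..<d}" "length w = N"
          by (cases w0) auto
        have wW: "w \<in> W" using w by (simp add: W_def)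
        have "mpoly_const s * y = (mpoly_const (p i) * y) * P w"
          using u(1) w(1) by (simp add: P_def mpoly_const_mult mult_ac)
        also have "\<dots> = (\<Sum>w'\<in>W. (if w' = w then mpoly_const (p i) * y else 0) * P w')"
          using wW finW by (simp add: if_distrib[of "\<lambda>x. x * _"] cong: if_cong)
        finally have "mpoly_const s * y = (\<Sum>w'\<in>W. (if w' = w then mpoly_const (p i) * y else 0) * P w')" .
        moreover have "mpoly_const (p i) * y \<in> max_ideal_part n"
          unfolding max_ideal_part_def using p_in[OF w(2)] y by (rule ideal_Rees_base)
        ultimately have "mpoly_const s * y \<in> V" unfolding V_def
          by (intro CollectI exI[of _ "\<lambda>w'. if w' = w then mpoly_const (p i) * y else 0"])
            (simp add: mp.subspace_0[OF sub])
        then show "s \<in> {s. mpoly_const s * y \<in> V}" by simp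
      qed
      then show ?thesis using s by blast
    qed
    from ideal_Rees_mem[OF x V this] show ?thesis by (simp add: V_def)
  qed
  have "\<exists>E gg. gg \<in> T (d * k * E) \<and> gg - h ^ E \<in> max_ideal_part (d * k * E) \<and> (\<forall>w\<in>W. gg * P w \<in> {0})"
  proof (rule graded_elimination[of T max_ideal_part])
    fix w assume "w \<in> W"
    from decomp[OF hP[OF this]]
    show "\<exists>b. (\<forall>w'\<in>W. b w' \<in> max_ideal_part (d * k)) \<and> h * P w - (\<Sum>w'\<in>W. b w' * P w') \<in> {0}" by auto
  qed (use T_one T_mult mp.subspace_diff[OF subspace_T] gideal_subset[OF gideal_max_ideal_part]
      mp.subspace_0[OF gideal_subspace[OF gideal_max_ideal_part]] mp.subspace_diff[OF gideal_subspace[OF gideal_max_ideal_part]]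
      gideal_mult[OF gideal_max_ideal_part] finW hT in simp_all)
  then obtain E gg where gg: "gg \<in> T (d * k * E)" "gg - h ^ E \<in> max_ideal_part (d * k * E)" "\<forall>w\<in>W. gg * P w = 0" by auto
  \<comment> \<open>By \<open>mm_power_subset\<close>, the M-th power of \<open>\<mm>\<close> lies
    in the ideal generated by the words in \<open>W\<close>, so every coefficient of
    \<open>gg\<close> annihilates it.\<close>
  define M where "M = c * N"
  have kill: "Poly_Mapping.lookup gg t * s = 0" if s: "s \<in> ideal_power \<mm> M" for t s
  proof -
    have "Poly_Mapping.lookup gg t * prod_list (map p w) = 0" if "w \<in> W" for w
      using gg(3) that lookup_mpoly_const_mult[of "prod_list (map p w)" gg t]
      by (simp add: P_def mult.commute)
    moreover have "u \<in> (\<lambda>w. prod_list (map p w)) ` W" if u: "u \<in> {prod_list w |w. set w \<subseteq> p ` {..<d} \<and> length w = N}" for u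
    proof -
      obtain v where v: "u = prod_list v" "set v \<subseteq> p ` {..<d}" "length v = N" using u by blast
      from v(2) obtain w0 where "v = map p w0" "set w0 \<subseteq> {..<d}" by (rule list_of_image)
      then show ?thesis using v by (auto simp: W_def)
    qed
    ultimately have "{prod_list w |w. set w \<subseteq> p ` {..<d} \<and> length w = N} \<subseteq> {s. Poly_Mapping.lookup gg t * s \<in> {0}}"
      by fastforce
    then have "ideal_power (p ` {..<d}) N \<subseteq> {s. Poly_Mapping.lookup gg t * s \<in> {0}}"
      unfolding ideal_power_def by (intro rg.span_minimal rg_subspace_mult_vimage) simp_all
    then show ?thesis using s mm_power_subset[of N] by (auto simp: M_def)
  qed
  \<comment> \<open>A unit coefficient would annihilate a nonzero product of \<open>M\<close>
    elements of \<open>\<mm>\<close>.\<close>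
  have coeff_mm: "Poly_Mapping.lookup gg t \<in> \<mm>" for t
  proof (rule ccontr)
    assume "Poly_Mapping.lookup gg t \<notin> \<mm>"
    then obtain y where y: "Poly_Mapping.lookup gg t * y = 1" using unit by blast
    obtain w where w: "set w \<subseteq> \<mm>" "length w = M" "prod_list w \<noteq> 0" using not_nil by blast
    have "prod_list w = y * (Poly_Mapping.lookup gg t * prod_list w)"
      by (simp add: mult.assoc[symmetric] mult.commute[of y] y)
    also have "\<dots> = 0" using kill[of "prod_list w" t] prod_list_ideal_power[OF w(1)] w(2) by simp
    finally show False using w(3) by simp
  qed
  \<comment> \<open>For \<open>j = M\<close> the coefficients of the power are among the elements
    that the coefficients of \<open>gg\<close> annihilate; hence the next power of \<open>gg\<close>
    is 0.\<close>
  have "Poly_Mapping.lookup (gg ^ j) t \<in> ideal_power \<mm> j" for j t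
  proof (induction j arbitrary: t)
    case (Suc j)
    show ?case unfolding power_Suc
    proof (rule lookup_mult_mem[OF subspace_ideal_power])
      fix s t
      have "Poly_Mapping.lookup gg s \<in> ideal_power \<mm> 1"
        using coeff_mm rg.span_superset[of \<mm>] unfolding ideal_power_1 by blast
      from ideal_power_mult[OF this Suc]
      show "Poly_Mapping.lookup gg s * Poly_Mapping.lookup (gg ^ j) t \<in> ideal_power \<mm> (Suc j)" by simp
    qed
  qed simp
  then have "Poly_Mapping.lookup (gg * gg ^ M) t \<in> {0}" for t
    by (intro lookup_mult_mem) (use kill in auto)
  then have zero: "gg ^ Suc M = 0" by (intro poly_mapping_eqI) simp
  have "(h ^ E) ^ Suc M - gg ^ Suc M \<in> max_ideal_part (d * k * E * Suc M)"
  proof (rule gideal_cong_power[OF gideal_max_ideal_part T_power[OF hT] gg(1)])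
    show "h ^ E - gg \<in> max_ideal_part (d * k * E)"
      using mp.subspace_neg[OF gideal_subspace[OF gideal_max_ideal_part] gg(2)] by simp
  qed
  then have "h ^ (E * Suc M) \<in> max_ideal_part (d * k * (E * Suc M))"
    unfolding zero by (simp only: diff_zero power_mult mult.assoc)
  then show ?thesis unfolding h_def by blast
qed

end

section \<open>Generic reductions\<close>

context finite_colength_forms
begin

text \<open>
  The degree \<open>(n, \<dots>, n)\<close> part of the ideal generated by the \<open>B i\<close> in the Rees algebra.
\<close>

definition col_ideal :: "(nat \<Rightarrow> (nat \<times> nat, 'a) mpoly set) \<Rightarrow> nat \<Rightarrow> (nat \<times> nat, 'a) mpoly set" where
  "col_ideal B n = mp.span {b * w | i b D w. i < q \<and> b \<in> B i \<and> w \<in> Rees D \<and> (\<forall>j<q. D j + \<delta> i j = n)}"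

lemma col_ideal_base:
  "i < q \<Longrightarrow> b \<in> B i \<Longrightarrow> w \<in> Rees D \<Longrightarrow> (\<And>j. j < q \<Longrightarrow> D j + \<delta> i j = n) \<Longrightarrow> b * w \<in> col_ideal B n"
  unfolding col_ideal_def by (intro mp.span_base) blast

lemma gideal_col_ideal:
  assumes B: "\<And>i. i < q \<Longrightarrow> B i \<subseteq> E i"
  shows "gideal (col_ideal B)"
  unfolding gideal_def
proof (intro conjI allI impI)
  show "mp.subspace (col_ideal B n)" for n by (simp add: col_ideal_def)
  show "col_ideal B n \<subseteq> T n" for n
    unfolding col_ideal_def
  proof (intro mp.span_minimal subspace_T subsetI)
    fix x assume "x \<in> {b * w | i b D w. i < q \<and> b \<in> B i \<and> w \<in> Rees D \<and> (\<forall>j<q. D j + \<delta> i j = n)}"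
    then obtain i b D w where x: "x = b * w" "i < q" "b \<in> B i" "w \<in> Rees D" "\<forall>j<q. D j + \<delta> i j = n" by blast
    have "w * b \<in> Rees (\<lambda>j. D j + \<delta> i j)" using x B by (intro Rees_mult E_Rees) auto
    also have "\<dots> = T n" unfolding T_def by (rule Rees_cong) (use x in simp)
    finally show "x \<in> T n" by (simp add: x(1) mult.commute)
  qed
  fix k n x y assume x: "x \<in> col_ideal B k" and y: "y \<in> T n"
  have V: "mp.subspace {x. x * y \<in> col_ideal B (k + n)}"
    by (rule mp_subspace_mult_vimage) (simp add: col_ideal_def)
  have S: "{b * w | i b D w. i < q \<and> b \<in> B i \<and> w \<in> Rees D \<and> (\<forall>j<q. D j + \<delta> i j = k)} \<subseteq>
      {x. x * y \<in> col_ideal B (k + n)}"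
  proof clarify
    fix i b D w assume a: "i < q" "b \<in> B i" "w \<in> Rees D" "\<forall>j<q. D j + \<delta> i j = k"
    have "b * (w * y) \<in> col_ideal B (k + n)"
      using a Rees_mult[OF a(3) y[unfolded T_def]]
      by (intro col_ideal_base[of i b B "w * y" "\<lambda>j. D j + n"]) force+
    then show "b * w * y \<in> col_ideal B (k + n)" by (simp add: mult.assoc)
  qed
  have "x \<in> {x. x * y \<in> col_ideal B (k + n)}"
    using mp.span_minimal[OF S V] x unfolding col_ideal_def[of B k] by (rule subsetD)
  then show "x * y \<in> col_ideal B (k + n)" by simp
qed

definition col_form :: "(nat \<times> nat \<times> nat \<Rightarrow> 'a) \<Rightarrow> nat \<Rightarrow> nat \<Rightarrow> (nat \<times> nat, 'a) mpoly" where
  "col_form A i b = (\<Sum>a<m i. mpoly_const (A (i, a, b)) * g i a)"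

definition col_forms :: "(nat \<times> nat \<times> nat \<Rightarrow> 'a) \<Rightarrow> nat \<Rightarrow> (nat \<times> nat, 'a) mpoly set" where
  "col_forms A i = col_form A i ` {..<r i}"

lemma col_forms_subset: "i < q \<Longrightarrow> col_forms A i \<subseteq> E i"
  unfolding col_forms_def col_form_def
  by (auto intro!: mp.subspace_sum[OF E_subspace] mp_subspace_mult[OF E_subspace] g_in_E)

lemma gideal_col_ideal_col_forms: "gideal (col_ideal (col_forms A))"
  by (rule gideal_col_ideal) (rule col_forms_subset)

text \<open>Modulo the columns, the generic zero is \<open>sel_prod \<sigma>\<close> times the given
  tuple. At a solved entry the two differ by minus the column form times
  \<open>sel_coprod \<sigma> i\<close>, since \<open>sel_prod \<sigma>\<close> is that coproduct
  times the selected generator.\<close>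

lemma zeropt_cong:
  assumes \<sigma>: "\<sigma> \<in> choices" and v: "v \<in> entries"
  shows "zeropt \<sigma> A v - sel_prod \<sigma> * mpoly_const (A v) \<in> col_ideal (col_forms A) 1"
proof -
  obtain i a b where ve: "v = (i, a, b)" "i < q" "a < m i" "b < r i" using v by (auto simp: entries_def)
  show ?thesis
  proof (cases "a = \<sigma> i")
    case True
    let ?s = "\<Sum>a'\<in>{..<m i} - {a}. mpoly_const (A (i, a', b)) * g i a'"
    have "col_form A i b = mpoly_const (A (i, a, b)) * g i a + ?s"
      unfolding col_form_def using ve by (subst sum.remove[of _ a]) auto
    moreover have "zeropt \<sigma> A v = - (sel_coprod \<sigma> i * ?s)"
      using True by (simp add: zeropt_def ve(1) sum_distrib_left mult_ac)
    moreover have "sel_prod \<sigma> = sel_coprod \<sigma> i * g i a" using sel_prod_eq[OF ve(2)] True by simp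
    ultimately have "zeropt \<sigma> A v - sel_prod \<sigma> * mpoly_const (A v) = - (col_form A i b * sel_coprod \<sigma> i)"
      by (simp add: ve(1) algebra_simps)
    moreover have "col_form A i b * sel_coprod \<sigma> i \<in> col_ideal (col_forms A) 1"
      using ve sel_coprod_Rees[OF \<sigma>] codeg_add[OF ve(2)]
      by (intro col_ideal_base[of i "col_form A i b" "col_forms A" "sel_coprod \<sigma> i" "codeg i"]) (auto simp: col_forms_def)
    ultimately show ?thesis
      using mp.subspace_neg[OF gideal_subspace[OF gideal_col_ideal_col_forms]] by simp
  next
    case False
    then show ?thesis
      using mp.subspace_0[OF gideal_subspace[OF gideal_col_ideal_col_forms]] by (simp add: zeropt_def ve(1))
  qed
qed

text \<open>The dehomogenised form: coordinates are replaced by the entries of \<open>A\<close>, and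
  \<open>sel_prod\<close> by 1.\<close>

definition coeff_fun :: "((nat \<times> nat \<times> nat \<Rightarrow> nat) \<Rightarrow> 'a) \<Rightarrow> (nat \<times> nat \<times> nat \<Rightarrow> 'a) \<Rightarrow> 'a" where
  "coeff_fun F A = (\<Sum>\<tau>\<in>box bound. F \<tau> * (\<Prod>v\<in>entries. A v ^ \<tau> v))"

definition form_comb :: "(nat \<Rightarrow> nat) \<Rightarrow> ((nat \<times> nat \<times> nat \<Rightarrow> nat) \<Rightarrow> 'a) \<Rightarrow> (nat \<times> nat \<times> nat \<Rightarrow> 'a) \<Rightarrow>
    (nat \<times> nat, 'a) mpoly" where
  "form_comb \<sigma> F A = (\<Sum>\<tau>\<in>box bound. mpoly_const (F \<tau>) * box_form \<sigma> bound \<tau> A)"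

lemma form_comb_T: "\<sigma> \<in> choices \<Longrightarrow> form_comb \<sigma> F A \<in> T (card entries * bound)"
  unfolding form_comb_def by (intro mp.subspace_sum[OF subspace_T] mp_subspace_mult[OF subspace_T] box_form_T)

lemma const_T: "mpoly_const a \<in> T 0"
  using mp_subspace_mult[OF subspace_T T_one, of a] by simp

lemma form_comb_cong:
  assumes \<sigma>: "\<sigma> \<in> choices"
  shows "form_comb \<sigma> F A - sel_prod \<sigma> ^ (card entries * bound) * mpoly_const (coeff_fun F A) \<in> col_ideal (col_forms A) (card entries * bound)"
proof -
  let ?N = "card entries * bound"
  note gi = gideal_col_ideal_col_forms[of A]
  have yc: "sel_prod \<sigma> * mpoly_const (A v) \<in> T 1" for v
    using T_mult[OF sel_prod_T[OF \<sigma>] const_T] by simp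
  have "box_form \<sigma> bound \<tau> A - sel_prod \<sigma> ^ ?N * mpoly_const (\<Prod>v\<in>entries. A v ^ \<tau> v) \<in> col_ideal (col_forms A) ?N" if \<tau>: "\<tau> \<in> box bound" for \<tau>
  proof -
    let ?s = "\<Sum>v\<in>entries. \<tau> v"
    have "(\<Prod>v\<in>entries. zeropt \<sigma> A v ^ \<tau> v) - (\<Prod>v\<in>entries. (sel_prod \<sigma> * mpoly_const (A v)) ^ \<tau> v) \<in> col_ideal (col_forms A) (\<Sum>v\<in>entries. 1 * \<tau> v)"
      by (rule gideal_cong_prod[OF gi finite_entries]; (rule T_power gideal_cong_power[OF gi])?)
        (use zeropt_T[OF \<sigma>] yc zeropt_cong[OF \<sigma>] in auto)
    from gideal_mult[OF gi this T_power[OF sel_prod_T[OF \<sigma>], of "?N - ?s"]]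
    have "((\<Prod>v\<in>entries. zeropt \<sigma> A v ^ \<tau> v) - (\<Prod>v\<in>entries. (sel_prod \<sigma> * mpoly_const (A v)) ^ \<tau> v)) * sel_prod \<sigma> ^ (?N - ?s) \<in> col_ideal (col_forms A) ?N"
      using box_sum_le[OF \<tau>] by simp
    moreover have "(\<Prod>v\<in>entries. (sel_prod \<sigma> * mpoly_const (A v)) ^ \<tau> v) * sel_prod \<sigma> ^ (?N - ?s) =
        sel_prod \<sigma> ^ ?N * mpoly_const (\<Prod>v\<in>entries. A v ^ \<tau> v)"
    proof -
      have "(\<Prod>v\<in>entries. (sel_prod \<sigma> * mpoly_const (A v)) ^ \<tau> v) = sel_prod \<sigma> ^ ?s * mpoly_const (\<Prod>v\<in>entries. A v ^ \<tau> v)"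
        by (simp add: power_mult_distrib prod.distrib mpoly_const_prod mpoly_const_power power_sum)
      moreover have "sel_prod \<sigma> ^ ?N = sel_prod \<sigma> ^ ?s * sel_prod \<sigma> ^ (?N - ?s)"
        using box_sum_le[OF \<tau>] by (simp flip: power_add)
      ultimately show ?thesis by (simp add: mult_ac)
    qed
    ultimately show ?thesis by (simp add: box_form_def left_diff_distrib)
  qed
  then have "(\<Sum>\<tau>\<in>box bound. mpoly_const (F \<tau>) *
      (box_form \<sigma> bound \<tau> A - sel_prod \<sigma> ^ ?N * mpoly_const (\<Prod>v\<in>entries. A v ^ \<tau> v))) \<in> col_ideal (col_forms A) ?N"
    by (intro mp.subspace_sum[OF gideal_subspace[OF gi]] mp_subspace_mult[OF gideal_subspace[OF gi]])
  then show ?thesis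
    by (simp add: form_comb_def coeff_fun_def mpoly_const_sum mpoly_const_mult right_diff_distrib sum_subtractf
        sum_distrib_left mult.left_commute)
qed

text \<open>The columns plus the maximal ideal. Once this fills a diagonal degree, Nakayama's lemma
  removes the second summand.\<close>

definition reduction_ideal :: "(nat \<times> nat \<times> nat \<Rightarrow> 'a) \<Rightarrow> nat \<Rightarrow> (nat \<times> nat, 'a) mpoly set" where
  "reduction_ideal A n = {x + y | x y. x \<in> col_ideal (col_forms A) n \<and> y \<in> max_ideal_part n}"

lemma gideal_reduction_ideal: "gideal (reduction_ideal A)"
proof -
  note 1 = gideal_subspace[OF gideal_col_ideal_col_forms[of A]] and 2 = gideal_subspace[OF gideal_max_ideal_part]
  have "mp.subspace (reduction_ideal A n)" for n
    unfolding reduction_ideal_def using mp.span_Un[of "col_ideal (col_forms A) n" "max_ideal_part n"] mp.subspace_span[of "col_ideal (col_forms A) n \<union> max_ideal_part n"]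
    by (simp add: 1 2 mp.span_eq_iff[THEN iffD2])
  moreover have "reduction_ideal A n \<subseteq> T n" for n
    using gideal_subset[OF gideal_col_ideal_col_forms[of A]] gideal_subset[OF gideal_max_ideal_part]
    by (auto simp: reduction_ideal_def intro!: mp.subspace_add[OF subspace_T])
  moreover have "z * t \<in> reduction_ideal A (k + n)" if z: "z \<in> reduction_ideal A k" and t: "t \<in> T n" for k n z t
  proof -
    obtain x y where "z = x + y" "x \<in> col_ideal (col_forms A) k" "y \<in> max_ideal_part k" using z unfolding reduction_ideal_def by blast
    with gideal_mult[OF gideal_col_ideal_col_forms _ t, of x A k] gideal_mult[OF gideal_max_ideal_part _ t, of y k]
    show ?thesis
      unfolding reduction_ideal_def by (intro CollectI exI[of _ "x * t"] exI[of _ "y * t"]) (simp add: distrib_right)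
  qed
  ultimately show ?thesis by (simp add: gideal_def)
qed

text \<open>A power of the product of the forms lies in the maximal ideal part. Modulo the columns
  the same power is a power of \<open>sel_prod \<sigma>\<close> times a power of the product of the
  values \<open>coeff_fun\<close>, which is a unit that can be divided out.\<close>

lemma sel_prod_power_reduction_ideal:
  assumes \<sigma>: "\<sigma> \<in> choices"
    and F: "\<And>i. i < d \<Longrightarrow> \<exists>a. \<forall>A. mpoly_const (p i ^ a) * form_comb \<sigma> (F i) A \<in> param_Rees (Suc a) (\<lambda>_. card entries * bound)"
    and h: "\<And>i. i < d \<Longrightarrow> coeff_fun (F i) A \<notin> \<mm>"
  shows "\<exists>n. sel_prod \<sigma> ^ n \<in> reduction_ideal A n"
proof -
  let ?N = "card entries * bound"
  obtain a where a: "\<And>i. i < d \<Longrightarrow> mpoly_const (p i ^ a i) * form_comb \<sigma> (F i) A \<in> param_Rees (Suc (a i)) (\<lambda>_. ?N)"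
    using F by metis
  define f where "f = (\<Prod>i<d. form_comb \<sigma> (F i) A)"
  obtain e where e: "f ^ e \<in> max_ideal_part (d * ?N * e)"
    using forms_power_mem_max_ideal_part[of "\<lambda>i. form_comb \<sigma> (F i) A" ?N a] form_comb_T[OF \<sigma>] a unfolding f_def by blast
  have yT: "sel_prod \<sigma> ^ ?N * mpoly_const s \<in> T ?N" for s
    using T_mult[OF T_power[OF sel_prod_T[OF \<sigma>], of ?N] const_T] by simp
  have "f - (\<Prod>i<d. sel_prod \<sigma> ^ ?N * mpoly_const (coeff_fun (F i) A)) \<in> col_ideal (col_forms A) (\<Sum>i<d. ?N)"
    unfolding f_def by (rule gideal_cong_prod[OF gideal_col_ideal_col_forms]) (use form_comb_T[OF \<sigma>] form_comb_cong[OF \<sigma>] yT in auto)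
  moreover have "f \<in> T (\<Sum>i<d. ?N)" unfolding f_def by (rule T_prod) (rule form_comb_T[OF \<sigma>])
  moreover have "(\<Prod>i<d. sel_prod \<sigma> ^ ?N * mpoly_const (coeff_fun (F i) A)) \<in> T (\<Sum>i<d. ?N)" by (rule T_prod) (rule yT)
  ultimately have c: "f ^ e - (\<Prod>i<d. sel_prod \<sigma> ^ ?N * mpoly_const (coeff_fun (F i) A)) ^ e \<in> col_ideal (col_forms A) (d * ?N * e)"
    using gideal_cong_power[OF gideal_col_ideal_col_forms, of f "\<Sum>i<d. ?N" "\<Prod>i<d. sel_prod \<sigma> ^ ?N * mpoly_const (coeff_fun (F i) A)"] by simp
  define u where "u = (\<Prod>i<d. coeff_fun (F i) A) ^ e"
  have eq: "(\<Prod>i<d. sel_prod \<sigma> ^ ?N * mpoly_const (coeff_fun (F i) A)) ^ e = sel_prod \<sigma> ^ (d * ?N * e) * mpoly_const u"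
  proof -
    have "(\<Prod>i<d. sel_prod \<sigma> ^ ?N * mpoly_const (coeff_fun (F i) A)) = (sel_prod \<sigma> ^ ?N) ^ d * mpoly_const (\<Prod>i<d. coeff_fun (F i) A)"
      by (simp add: prod.distrib mpoly_const_prod)
    moreover have "((sel_prod \<sigma> ^ ?N) ^ d) ^ e = sel_prod \<sigma> ^ (d * ?N * e)"
      unfolding power_mult[symmetric] by (simp only: mult_ac)
    ultimately show ?thesis by (simp only: power_mult_distrib u_def mpoly_const_power)
  qed
  have "\<forall>i. \<exists>w. i < d \<longrightarrow> coeff_fun (F i) A * w = 1" using h unit by blast
  then obtain w where w: "\<And>i. i < d \<Longrightarrow> coeff_fun (F i) A * w i = 1" by metis
  have "(\<Prod>i<d. coeff_fun (F i) A) * (\<Prod>i<d. w i) = 1" unfolding prod.distrib[symmetric] using w by simp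
  then have uw: "u * (\<Prod>i<d. w i) ^ e = 1" unfolding u_def power_mult_distrib[symmetric] by simp
  have "sel_prod \<sigma> ^ (d * ?N * e) * mpoly_const u = - (f ^ e - sel_prod \<sigma> ^ (d * ?N * e) * mpoly_const u) + f ^ e" by simp
  moreover have "- (f ^ e - sel_prod \<sigma> ^ (d * ?N * e) * mpoly_const u) \<in> col_ideal (col_forms A) (d * ?N * e)"
    using mp.subspace_neg[OF gideal_subspace[OF gideal_col_ideal_col_forms] c] unfolding eq .
  ultimately have "sel_prod \<sigma> ^ (d * ?N * e) * mpoly_const u \<in> reduction_ideal A (d * ?N * e)"
    unfolding reduction_ideal_def using e by blast
  from mp_subspace_mult[OF gideal_subspace[OF gideal_reduction_ideal] this, of "(\<Prod>i<d. w i) ^ e"]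
  have "mpoly_const (u * (\<Prod>i<d. w i) ^ e) * sel_prod \<sigma> ^ (d * ?N * e) \<in> reduction_ideal A (d * ?N * e)"
    unfolding mpoly_const_mult by (simp only: mult_ac)
  then show ?thesis unfolding uw by auto
qed

section \<open>From powers of the selected products to a whole diagonal degree, and Nakayama's
  lemma\<close>

definition gen_monomials :: "nat \<Rightarrow> (nat \<times> nat, 'a) mpoly set" where
  "gen_monomials n = (\<lambda>s. \<Prod>t<n. sel_prod (s t)) ` (\<Pi>\<^sub>E t\<in>{..<n}. choices)"

lemma finite_choices: "finite choices"
  by (simp add: choices_def finite_PiE)

lemma finite_gen_monomials: "finite (gen_monomials n)"
  by (simp add: gen_monomials_def finite_PiE finite_choices)

text \<open>A product of \<open>n\<close> generators from each of the \<open>q\<close> modules can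
  be regrouped into \<open>n\<close> products with one generator from each. This regrouping is what
  makes the diagonal degrees sufficient.\<close>

lemma T_span_gen_monomials: "T n = mp.span (gen_monomials n)"
proof
  show "mp.span (gen_monomials n) \<subseteq> T n"
  proof (rule mp.span_minimal)
    show "gen_monomials n \<subseteq> T n"
    proof
      fix x assume "x \<in> gen_monomials n"
      then obtain s where s: "x = (\<Prod>t<n. sel_prod (s t))" "\<And>t. t < n \<Longrightarrow> s t \<in> choices" by (auto simp: gen_monomials_def)
      then show "x \<in> T n" using T_prod[of "{..<n}" "\<lambda>t. sel_prod (s t)" "\<lambda>_. 1"] sel_prod_T by simp
    qed
  qed simp
  define GD where "GD D = {\<Prod>j<q. \<Prod>t<D j. g j (a j t) | a. \<forall>j<q. \<forall>t<D j. a j t < m j}" for D :: "nat \<Rightarrow> nat"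
  have "T n \<subseteq> mp.span (GD (\<lambda>_. n))"
  proof
    fix x assume "x \<in> T n"
    then show "x \<in> mp.span (GD (\<lambda>_. n))"
      unfolding T_def
    proof (rule Rees_induct)
      show "mp.span (GD D) = mp.span (GD D')" if "\<And>j. j < q \<Longrightarrow> D j = D' j" for D D'
        using that by (auto simp: GD_def intro!: arg_cong[where f = mp.span])
      show "1 \<in> mp.span (GD (\<lambda>_. 0))" by (intro mp.span_base) (simp add: GD_def)
      show "x * y \<in> mp.span (GD (\<lambda>j. D j + D' j))" if "x \<in> mp.span (GD D)" "y \<in> mp.span (GD D')" for x y D D'
      proof (rule mp_span_mult_mem[OF mp.subspace_span _ that])
        fix x y assume "x \<in> GD D" "y \<in> GD D'"
        then obtain a a' where a: "x = (\<Prod>j<q. \<Prod>t<D j. g j (a j t))" "\<forall>j<q. \<forall>t<D j. a j t < m j"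
          and a': "y = (\<Prod>j<q. \<Prod>t<D' j. g j (a' j t))" "\<forall>j<q. \<forall>t<D' j. a' j t < m j"
          by (auto simp: GD_def)
        let ?a = "\<lambda>j t. if t < D j then a j t else a' j (t - D j)"
        have "x * y = (\<Prod>j<q. \<Prod>t<D j + D' j. g j (?a j t))"
          by (simp add: a(1) a'(1) prod_lessThan_add prod.distrib)
        moreover have "\<forall>j<q. \<forall>t<D j + D' j. ?a j t < m j" using a(2) a'(2) by auto
        ultimately show "x * y \<in> mp.span (GD (\<lambda>j. D j + D' j))"
          unfolding GD_def by (intro mp.span_base CollectI exI[of _ ?a] conjI)
      qed
      fix i x assume i: "i < q" and x: "x \<in> E i"
      have "g i b \<in> mp.span (GD (\<delta> i))" if "b < m i" for b
      proof -
        have "(\<Prod>j<q. \<Prod>t<\<delta> i j. g j b) = (\<Prod>j<q. if j = i then g j b else 1)"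
          by (intro prod.cong) (auto simp: \<delta>_def)
        then have "g i b = (\<Prod>j<q. \<Prod>t<\<delta> i j. g j b)" using i by simp
        then show ?thesis
          unfolding GD_def using that
          by (intro mp.span_base CollectI exI[of _ "\<lambda>_ _. b"]) (auto simp: \<delta>_def)
      qed
      then show "x \<in> mp.span (GD (\<delta> i))"
        using x mp.span_minimal[OF _ mp.subspace_span, of "g i ` {..<m i}" "GD (\<delta> i)"]
        unfolding E_span[OF i] by auto
    qed simp
  qed
  moreover have "GD (\<lambda>_. n) \<subseteq> gen_monomials n"
  proof
    fix x assume "x \<in> GD (\<lambda>_. n)"
    then obtain a where a: "x = (\<Prod>j<q. \<Prod>t<n. g j (a j t))" "\<And>j t. j < q \<Longrightarrow> t < n \<Longrightarrow> a j t < m j"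
      by (auto simp: GD_def)
    let ?s = "\<lambda>t\<in>{..<n}. \<lambda>j\<in>{..<q}. a j t"
    have "x = (\<Prod>t<n. sel_prod (?s t))"
      unfolding a(1) sel_prod_def by (subst prod.swap) (intro prod.cong, auto)
    moreover have "?s \<in> (\<Pi>\<^sub>E t\<in>{..<n}. choices)" using a(2) by (auto simp: choices_def PiE_iff)
    ultimately show "x \<in> gen_monomials n" unfolding gen_monomials_def
      by (intro image_eqI[where f = "\<lambda>s. \<Prod>t<n. sel_prod (s t)" and x = ?s])
  qed
  ultimately show "T n \<subseteq> mp.span (gen_monomials n)" using mp.span_mono by blast
qed

text \<open>Among more than the sum of all \<open>k \<sigma>\<close> selected factors, some
  \<open>\<sigma>\<close> occurs at least \<open>k \<sigma>\<close> times, and its power carries the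
  whole product into the ideal.\<close>

lemma gen_monomials_pigeonhole:
  assumes K: "\<And>\<sigma>. \<sigma> \<in> choices \<Longrightarrow> sel_prod \<sigma> ^ k \<sigma> \<in> reduction_ideal A (k \<sigma>)"
  shows "\<exists>n>0. gen_monomials n \<subseteq> reduction_ideal A n"
proof (intro exI conjI)
  define M where "M = (\<Sum>\<sigma>\<in>choices. k \<sigma>)"
  let ?n = "card choices * M + 1"
  show "?n > 0" by simp
  show "gen_monomials ?n \<subseteq> reduction_ideal A ?n"
  proof
    fix x assume "x \<in> gen_monomials ?n"
    then obtain s where s: "x = (\<Prod>t<?n. sel_prod (s t))" "\<And>t. t < ?n \<Longrightarrow> s t \<in> choices" by (auto simp: gen_monomials_def)
    define ct where "ct \<sigma> = card {t \<in> {..<?n}. s t = \<sigma>}" for \<sigma>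
    have x: "x = (\<Prod>\<sigma>\<in>choices. sel_prod \<sigma> ^ ct \<sigma>)"
      unfolding s(1) ct_def
      by (subst prod.group[symmetric, of "{..<?n}" choices s]) (use s(2) finite_choices in auto)
    have "(\<Sum>\<sigma>\<in>choices. ct \<sigma>) = ?n"
      using sum.group[of "{..<?n}" choices s "\<lambda>_. 1 :: nat"] s(2) finite_choices by (auto simp: ct_def)
    have "\<exists>\<sigma>\<in>choices. k \<sigma> \<le> ct \<sigma>"
    proof (rule ccontr)
      assume "\<not> ?thesis"
      then have "(\<Sum>\<sigma>\<in>choices. ct \<sigma>) \<le> M" unfolding M_def by (intro sum_mono) auto
      moreover have "choices \<noteq> {}" using \<open>(\<Sum>\<sigma>\<in>choices. ct \<sigma>) = ?n\<close> by auto
      then have "card choices > 0" using finite_choices by (simp add: card_gt_0_iff)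
      then have "M \<le> card choices * M" by simp
      ultimately show False using \<open>(\<Sum>\<sigma>\<in>choices. ct \<sigma>) = ?n\<close> by linarith
    qed
    then obtain \<sigma> where \<sigma>: "\<sigma> \<in> choices" "k \<sigma> \<le> ct \<sigma>" by blast
    let ?y = "sel_prod \<sigma> ^ (ct \<sigma> - k \<sigma>) * (\<Prod>\<sigma>'\<in>choices - {\<sigma>}. sel_prod \<sigma>' ^ ct \<sigma>')"
    have "sel_prod \<sigma> ^ ct \<sigma> = sel_prod \<sigma> ^ k \<sigma> * sel_prod \<sigma> ^ (ct \<sigma> - k \<sigma>)" using \<sigma>(2) by (simp flip: power_add)
    then have xe: "x = sel_prod \<sigma> ^ k \<sigma> * ?y"
      unfolding x using \<sigma>(1) finite_choices by (simp add: prod.remove mult.assoc)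
    have yT: "?y \<in> T (1 * (ct \<sigma> - k \<sigma>) + (\<Sum>\<sigma>'\<in>choices - {\<sigma>}. 1 * ct \<sigma>'))"
      using \<sigma>(1) by (intro T_mult T_power T_prod sel_prod_T) auto
    have deg: "k \<sigma> + (1 * (ct \<sigma> - k \<sigma>) + (\<Sum>\<sigma>'\<in>choices - {\<sigma>}. 1 * ct \<sigma>')) = ?n"
      using \<open>(\<Sum>\<sigma>\<in>choices. ct \<sigma>) = ?n\<close> \<sigma> finite_choices by (simp add: sum.remove)
    show "x \<in> reduction_ideal A ?n"
      using gideal_mult[OF gideal_reduction_ideal K[OF \<sigma>(1)] yT] unfolding deg xe .
  qed
qed

text \<open>\<open>graded_elimination\<close> with \<open>f = 1\<close> and all degrees constant:
  the ring is the image of R, the ideal that of \<open>\<mm>\<close>, and the submodule is the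
  column part. The resulting multiplier differs from 1 by an element of \<open>\<mm>\<close>, so it
  is a unit.\<close>

lemma nakayama_T:
  assumes "gen_monomials n \<subseteq> reduction_ideal A n"
  shows "T n \<subseteq> col_ideal (col_forms A) n"
proof -
  note sub = gideal_subspace[OF gideal_col_ideal_col_forms[of A]]
  have decomp: "\<exists>b. (\<forall>w'\<in>gen_monomials n. b w' \<in> mpoly_const ` \<mm>) \<and> x = (\<Sum>w'\<in>gen_monomials n. b w' * w')" if x: "x \<in> max_ideal_part n" for x
  proof -
    define V where "V = {x. \<exists>b. (\<forall>w'\<in>gen_monomials n. b w' \<in> \<mm>) \<and> x = (\<Sum>w'\<in>gen_monomials n. mpoly_const (b w') * w')}"
    have V: "mp.subspace V"
    proof (rule mp.subspaceI)
      show "0 \<in> V" unfolding V_def by (intro CollectI exI[of _ "\<lambda>_. 0"]) (simp add: rg.subspace_0[OF subm])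
      fix x y assume "x \<in> V" "y \<in> V"
      then obtain b b' where "\<forall>w\<in>gen_monomials n. b w \<in> \<mm>" "x = (\<Sum>w\<in>gen_monomials n. mpoly_const (b w) * w)"
        "\<forall>w\<in>gen_monomials n. b' w \<in> \<mm>" "y = (\<Sum>w\<in>gen_monomials n. mpoly_const (b' w) * w)" by (auto simp: V_def)
      then show "x + y \<in> V" unfolding V_def
        by (intro CollectI exI[of _ "\<lambda>w. b w + b' w"])
          (simp add: rg.subspace_add[OF subm] mpoly_const_add distrib_right sum.distrib)
    next
      fix s x assume "x \<in> V"
      then obtain b where "\<forall>w\<in>gen_monomials n. b w \<in> \<mm>" "x = (\<Sum>w\<in>gen_monomials n. mpoly_const (b w) * w)" by (auto simp: V_def)
      then show "mpoly_scale s x \<in> V" unfolding V_def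
        by (intro CollectI exI[of _ "\<lambda>w. s * b w"])
          (simp add: rg.subspace_scale[OF subm] mpoly_scale_def mpoly_const_mult sum_distrib_left mult.assoc)
    qed
    have "mpoly_const s * y \<in> V" if s: "s \<in> \<mm>" and y: "y \<in> Rees (\<lambda>_. n)" for s y
    proof -
      have "gen_monomials n \<subseteq> {y. mpoly_const s * y \<in> V}"
      proof
        fix w assume w: "w \<in> gen_monomials n"
        have "(\<Sum>w'\<in>gen_monomials n. mpoly_const (if w' = w then s else 0) * w') = (\<Sum>w'\<in>gen_monomials n. if w' = w then mpoly_const s * w' else 0)"
          by (intro sum.cong) auto
        then have "mpoly_const s * w = (\<Sum>w'\<in>gen_monomials n. mpoly_const (if w' = w then s else 0) * w')"
          using w finite_gen_monomials by simp
        then have "mpoly_const s * w \<in> V" unfolding V_def using s rg.subspace_0[OF subm]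
          by (intro CollectI exI[of _ "\<lambda>w'. if w' = w then s else 0"]) auto
        then show "w \<in> {y. mpoly_const s * y \<in> V}" by simp
      qed
      then have "T n \<subseteq> {y. mpoly_const s * y \<in> V}"
        unfolding T_span_gen_monomials by (intro mp.span_minimal mp_subspace_mult_vimage V)
      then show ?thesis using y by (auto simp: T_def)
    qed
    from ideal_Rees_mem[OF x[unfolded max_ideal_part_def] V this] obtain b where
      "\<forall>w'\<in>gen_monomials n. b w' \<in> \<mm>" "x = (\<Sum>w'\<in>gen_monomials n. mpoly_const (b w') * w')" by (auto simp: V_def)
    then show ?thesis by (intro exI[of _ "\<lambda>w'. mpoly_const (b w')"]) auto
  qed
  have "\<exists>e gg. gg \<in> range mpoly_const \<and> gg - 1 ^ e \<in> mpoly_const ` \<mm> \<and> (\<forall>w\<in>gen_monomials n. gg * w \<in> col_ideal (col_forms A) n)"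
  proof (rule graded_elimination[of "\<lambda>_. range mpoly_const" "\<lambda>_. mpoly_const ` \<mm>" _ "gen_monomials n" 1 0 "\<lambda>w. w"])
    show "1 \<in> range mpoly_const" by (metis mpoly_const_simps(2) rangeI)
    then show "1 \<in> range mpoly_const" .
    show "x * y \<in> range mpoly_const" if "x \<in> range mpoly_const" "y \<in> range mpoly_const" for x y :: "(nat \<times> nat, 'a) mpoly"
      using that by (auto simp flip: mpoly_const_mult)
    show "x - y \<in> range mpoly_const" if "x \<in> range mpoly_const" "y \<in> range mpoly_const" for x y :: "(nat \<times> nat, 'a) mpoly"
      using that by (auto simp flip: mpoly_const_diff)
    show "0 \<in> mpoly_const ` \<mm>" using rg.subspace_0[OF subm] by (metis image_eqI mpoly_const_simps(1))
    show "x - y \<in> mpoly_const ` \<mm>" if "x \<in> mpoly_const ` \<mm>" "y \<in> mpoly_const ` \<mm>" for x y :: "(nat \<times> nat, 'a) mpoly"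
      using that rg.subspace_diff[OF subm] by (auto simp flip: mpoly_const_diff)
    show "x * y \<in> mpoly_const ` \<mm>" if "x \<in> mpoly_const ` \<mm>" "y \<in> range mpoly_const" for x y :: "(nat \<times> nat, 'a) mpoly"
      using that rg.subspace_scale[OF subm] by (auto simp: mult.commute simp flip: mpoly_const_mult)
    show "x * y \<in> col_ideal (col_forms A) n" if "x \<in> range mpoly_const" "y \<in> col_ideal (col_forms A) n" for x y
      using that mp_subspace_mult[OF sub] by auto
    fix w assume "w \<in> gen_monomials n"
    then obtain x y where xy: "w = x + y" "x \<in> col_ideal (col_forms A) n" "y \<in> max_ideal_part n" using assms by (auto simp: reduction_ideal_def)
    obtain b where "\<forall>w'\<in>gen_monomials n. b w' \<in> mpoly_const ` \<mm>" "y = (\<Sum>w'\<in>gen_monomials n. b w' * w')"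
      using decomp[OF xy(3)] by blast
    then show "\<exists>b. (\<forall>w'\<in>gen_monomials n. b w' \<in> mpoly_const ` \<mm>) \<and> 1 * w - (\<Sum>w'\<in>gen_monomials n. b w' * w') \<in> col_ideal (col_forms A) n"
      using xy(1,2) by (intro exI[of _ b]) simp
  qed (use mp.subspace_0[OF sub] mp.subspace_add[OF sub] finite_gen_monomials in auto)
  then obtain e gg where gg: "gg \<in> range mpoly_const" "gg - 1 ^ e \<in> mpoly_const ` \<mm>"
    "\<forall>w\<in>gen_monomials n. gg * w \<in> col_ideal (col_forms A) n" by blast
  obtain s where s: "gg = mpoly_const s" using gg(1) by blast
  obtain t where t: "gg - 1 ^ e = mpoly_const t" "t \<in> \<mm>" using gg(2) by blast
  have st: "mpoly_const s - 1 = (mpoly_const t :: (nat \<times> nat, 'a) mpoly)" "t \<in> \<mm>" "\<forall>w\<in>gen_monomials n. mpoly_const s * w \<in> col_ideal (col_forms A) n"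
    using gg(3) t by (simp_all add: s)
  have "mpoly_const (s - 1) = (mpoly_const t :: (nat \<times> nat, 'a) mpoly)" using st(1) by (simp add: mpoly_const_diff)
  then have "s - 1 = t" by (simp only: mpoly_const_inject)
  then have "s \<notin> \<mm>" using st(2) rg.subspace_diff[OF subm, of s "s - 1"] one_notin by auto
  then obtain u where u: "s * u = 1" using unit by blast
  have "w \<in> col_ideal (col_forms A) n" if "w \<in> gen_monomials n" for w
  proof -
    have "mpoly_const u * (mpoly_const s * w) = mpoly_const (s * u) * w" by (simp add: mpoly_const_mult mult_ac)
    then show ?thesis using mp_subspace_mult[OF sub, of "mpoly_const s * w" n u] st(3) that u by auto
  qed
  then show ?thesis unfolding T_span_gen_monomials by (intro mp.span_minimal sub) auto
qed

text \<open>\<open>F\<close> is chosen before \<open>A\<close>, so the conditions are fixed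
  polynomial conditions on the entries. The coefficient 1 is recorded because it makes each
  polynomial nonzero in the residue field.\<close>

lemma generic_joint_reduction:
  "\<exists>F. (\<forall>\<sigma>\<in>choices. \<forall>i<d. \<exists>\<tau>\<in>box bound. F \<sigma> i \<tau> = 1) \<and>
     (\<forall>A. (\<forall>\<sigma>\<in>choices. \<forall>i<d. coeff_fun (F \<sigma> i) A \<notin> \<mm>) \<longrightarrow> (\<exists>n. T (Suc n) \<subseteq> col_ideal (col_forms A) (Suc n)))"
proof -
  have "\<forall>\<sigma> i. \<exists>F. \<sigma> \<in> choices \<longrightarrow> i < d \<longrightarrow> (\<exists>\<tau>\<in>box bound. F \<tau> = 1) \<and>
      (\<exists>a. \<forall>A. mpoly_const (p i ^ a) * form_comb \<sigma> F A \<in> param_Rees (Suc a) (\<lambda>_. card entries * bound))"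
    using forms_relation unfolding form_comb_def by blast
  then obtain F where F: "\<And>\<sigma> i. \<sigma> \<in> choices \<Longrightarrow> i < d \<Longrightarrow> (\<exists>\<tau>\<in>box bound. F \<sigma> i \<tau> = 1) \<and>
      (\<exists>a. \<forall>A. mpoly_const (p i ^ a) * form_comb \<sigma> (F \<sigma> i) A \<in> param_Rees (Suc a) (\<lambda>_. card entries * bound))"
    by metis
  have "\<exists>n. T (Suc n) \<subseteq> col_ideal (col_forms A) (Suc n)" if h: "\<forall>\<sigma>\<in>choices. \<forall>i<d. coeff_fun (F \<sigma> i) A \<notin> \<mm>" for A
  proof -
    have "\<exists>n. sel_prod \<sigma> ^ n \<in> reduction_ideal A n" if "\<sigma> \<in> choices" for \<sigma>
      by (rule sel_prod_power_reduction_ideal[OF that]) (use F h that in blast)+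
    then obtain k where "\<And>\<sigma>. \<sigma> \<in> choices \<Longrightarrow> sel_prod \<sigma> ^ k \<sigma> \<in> reduction_ideal A (k \<sigma>)" by metis
    from gen_monomials_pigeonhole[of k, OF this] obtain n where "n > 0" "gen_monomials n \<subseteq> reduction_ideal A n" by blast
    then show ?thesis using nakayama_T by (metis gr0_conv_Suc)
  qed
  then show ?thesis using F by blast
qed

end

section \<open>The embedding of the free modules into S(F)\<close>

context Modules.module
begin

lemma free_module_basisD:
  assumes "free_module_basis scale F n e"
  shows "inj_on e {..<n}" "independent (e ` {..<n})" "span (e ` {..<n}) = F"
  using assms by (simp_all add: free_module_basis_def)

lemma free_module_basis_expand:
  assumes "free_module_basis scale F n e" "v \<in> F"
  shows "(\<Sum>a<n. representation (e ` {..<n}) v (e a) *s e a) = v"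
proof -
  note b = free_module_basisD[OF assms(1)]
  have "(\<Sum>a<n. representation (e ` {..<n}) v (e a) *s e a) =
      (\<Sum>x\<in>e ` {..<n}. representation (e ` {..<n}) v x *s x)"
    using b(1) by (simp add: sum.reindex)
  also have "\<dots> = v" using b assms(2) by (intro sum_representation_eq) auto
  finally show ?thesis .
qed

context
  fixes F :: "'b set" and r :: "nat \<Rightarrow> nat" and e :: "nat \<Rightarrow> nat \<Rightarrow> 'b" and i :: nat
  assumes basis: "free_module_basis scale F (r i) (e i)"
begin

lemma sym_embed_add:
  assumes "u \<in> F" "v \<in> F"
  shows "sym_embed scale r e i (u + v) = sym_embed scale r e i u + sym_embed scale r e i v"
  using free_module_basisD[OF basis] assms
  by (simp add: sym_embed_def representation_add mp.scale_left_distrib sum.distrib)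

lemma sym_embed_scale:
  assumes "v \<in> F"
  shows "sym_embed scale r e i (x *s v) = mpoly_scale x (sym_embed scale r e i v)"
  using free_module_basisD[OF basis] assms
  by (simp add: sym_embed_def representation_scale mp.scale_sum_right mp.scale_scale)

lemma sym_embed_zero:
  shows "sym_embed scale r e i 0 = 0"
  by (simp add: sym_embed_def representation_zero)

lemma sym_embed_sum:
  assumes "\<And>j. j \<in> J \<Longrightarrow> v j \<in> F"
  shows "sym_embed scale r e i (\<Sum>j\<in>J. v j) = (\<Sum>j\<in>J. sym_embed scale r e i (v j))"
proof -
  have F: "subspace F" using free_module_basisD(3)[OF basis] subspace_span by metis
  show ?thesis
    using assms
  proof (induction J rule: infinite_finite_induct)
    case (insert j J)
    then show ?case
      using sym_embed_add[of "v j" "\<Sum>j\<in>J. v j"] subspace_sum[OF F, of J v] by simp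
  qed (simp_all add: sym_embed_zero)
qed

lemma sym_embed_basis:
  assumes "a < r i"
  shows "sym_embed scale r e i (e i a) = mpoly_var (i, a)"
proof -
  note b = free_module_basisD[OF basis]
  have "sym_embed scale r e i (e i a) = (\<Sum>a'<r i. if a' = a then mpoly_var (i, a) else 0)"
    unfolding sym_embed_def
  proof (intro sum.cong refl)
    fix a' assume "a' \<in> {..<r i}"
    then have "e i a = e i a' \<longleftrightarrow> a' = a" using b(1) assms by (auto simp: inj_on_def)
    then show "mpoly_scale (representation (e i ` {..<r i}) (e i a) (e i a')) (mpoly_var (i, a')) =
        (if a' = a then mpoly_var (i, a) else 0)"
      using representation_basis[OF b(2), of "e i a"] assms by auto
  qed
  then show ?thesis using assms by simp
qed

lemma sym_embed_span:
  assumes "A \<subseteq> F"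
  shows "sym_embed scale r e i ` span A = mp.span (sym_embed scale r e i ` A)"
proof
  let ?f = "sym_embed scale r e i"
  have F: "subspace F" using free_module_basisD(3)[OF basis] subspace_span by metis
  have AF: "span A \<subseteq> F" by (rule span_minimal[OF assms F])
  have "mp.subspace (?f ` span A)"
  proof (rule mp.subspaceI)
    show "0 \<in> ?f ` span A" using sym_embed_zero span_zero by (metis image_eqI)
    fix x y assume "x \<in> ?f ` span A" "y \<in> ?f ` span A"
    then obtain u v where uv: "u \<in> span A" "v \<in> span A" "x = ?f u" "y = ?f v" by blast
    then have "x + y = ?f (u + v)" using sym_embed_add[of u v] subsetD[OF AF] by simp
    then show "x + y \<in> ?f ` span A" using span_add[OF uv(1,2)] by simp
  next
    fix c x assume "x \<in> ?f ` span A"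
    then obtain u where u: "u \<in> span A" "x = ?f u" by blast
    then have "mpoly_scale c x = ?f (c *s u)" using sym_embed_scale[of u c] subsetD[OF AF] by simp
    then show "mpoly_scale c x \<in> ?f ` span A" using span_scale[OF u(1)] by simp
  qed
  then show "mp.span (?f ` A) \<subseteq> ?f ` span A"
    using span_superset[of A] by (intro mp.span_minimal) auto
  \<comment> \<open>The embedding is known to be linear on \<open>F\<close> only, hence the
    restriction to \<open>F\<close>.\<close>
  have "subspace {v \<in> F. ?f v \<in> mp.span (?f ` A)}"
    using subspace_0[OF F] subspace_add[OF F] subspace_scale[OF F]
    by (auto intro!: subspaceI mp.span_add mp.span_scale mp.span_zero
        simp: sym_embed_zero sym_embed_add sym_embed_scale
        simp del: mp.span_eq_iff)
  then have "span A \<subseteq> {v \<in> F. ?f v \<in> mp.span (?f ` A)}"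
    using assms by (intro span_minimal) (auto intro: mp.span_base)
  then show "?f ` span A \<subseteq> mp.span (?f ` A)" by blast
qed

end

end

section \<open>The defining equation of a joint reduction in terms of the Rees algebra\<close>

lemma mp_subspace_submodule_sum:
  assumes "\<And>j. j \<in> J \<Longrightarrow> mp.subspace (P j)"
  shows "mp.subspace (submodule_sum J P)"
proof (rule mp.subspaceI)
  show "0 \<in> submodule_sum J P" unfolding submodule_sum_def
    by (intro CollectI exI[of _ "\<lambda>_. 0"]) (simp add: mp.subspace_0[OF assms])
  fix x y assume "x \<in> submodule_sum J P" "y \<in> submodule_sum J P"
  then obtain f h where "x = (\<Sum>j\<in>J. f j)" "\<forall>j\<in>J. f j \<in> P j" "y = (\<Sum>j\<in>J. h j)" "\<forall>j\<in>J. h j \<in> P j"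
    unfolding submodule_sum_def by blast
  then show "x + y \<in> submodule_sum J P" unfolding submodule_sum_def
    by (intro CollectI exI[of _ "\<lambda>j. f j + h j"]) (simp add: sum.distrib mp.subspace_add[OF assms])
next
  fix c x assume "x \<in> submodule_sum J P"
  then obtain f where "x = (\<Sum>j\<in>J. f j)" "\<forall>j\<in>J. f j \<in> P j" unfolding submodule_sum_def by blast
  then show "mpoly_scale c x \<in> submodule_sum J P" unfolding submodule_sum_def
    by (intro CollectI exI[of _ "\<lambda>j. mpoly_scale c (f j)"])
      (simp add: mp.scale_sum_right mp.subspace_scale[OF assms])
qed

lemma subset_submodule_sum:
  assumes "\<And>j. j \<in> J \<Longrightarrow> mp.subspace (P j)" "finite J" "i \<in> J"
  shows "P i \<subseteq> submodule_sum J P"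
proof
  fix x assume x: "x \<in> P i"
  have "x = (\<Sum>j\<in>J. if j = i then x else 0)" using assms(2,3) by simp
  then show "x \<in> submodule_sum J P" unfolding submodule_sum_def
    by (intro CollectI exI[of _ "\<lambda>j. if j = i then x else 0"])
      (use x mp.subspace_0[OF assms(1)] in auto)
qed

context finite_colength_forms
begin

abbreviation sym_pow :: "nat \<Rightarrow> nat \<Rightarrow> (nat \<times> nat, 'a) mpoly set" where
  "sym_pow k j \<equiv> submodule_prod {..<k} (\<lambda>_. E j)"

lemma sym_pow_subset_Rees:
  assumes "j < q"
  shows "sym_pow k j \<subseteq> Rees (\<lambda>i. k * \<delta> j i)"
  unfolding submodule_prod_def
proof (intro mp.span_minimal subspace_Rees subsetI)
  fix x assume "x \<in> {\<Prod>t<k. f t | f. \<forall>t\<in>{..<k}. f t \<in> E j}"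
  then obtain f where "x = (\<Prod>t<k. f t)" "\<forall>t\<in>{..<k}. f t \<in> E j" by blast
  then show "x \<in> Rees (\<lambda>i. k * \<delta> j i)"
    using Rees_prod[of "{..<k}" f "\<lambda>_. \<delta> j"] E_Rees[OF assms] by simp
qed

lemma submodule_prod_sym_pow_subset:
  assumes "finite J" "J \<subseteq> {..<q}"
  shows "submodule_prod J (\<lambda>j. sym_pow (D j) j) \<subseteq> Rees (\<lambda>i. \<Sum>j\<in>J. D j * \<delta> j i)"
  unfolding submodule_prod_def[of J]
proof (intro mp.span_minimal subspace_Rees subsetI)
  fix x assume "x \<in> {\<Prod>j\<in>J. f j | f. \<forall>j\<in>J. f j \<in> sym_pow (D j) j}"
  then obtain f where "x = (\<Prod>j\<in>J. f j)" "\<forall>j\<in>J. f j \<in> sym_pow (D j) j" by blast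
  then show "x \<in> Rees (\<lambda>i. \<Sum>j\<in>J. D j * \<delta> j i)"
    using Rees_prod[OF assms(1), of f "\<lambda>j i. D j * \<delta> j i"] sym_pow_subset_Rees assms(2) by blast
qed

lemma prod_mem_sym_pow: "\<forall>t<k. h t \<in> E j \<Longrightarrow> (\<Prod>t<k. h t) \<in> sym_pow k j"
  unfolding submodule_prod_def by (intro mp.span_base) auto

lemma Rees_eq_submodule_prod: "Rees D = submodule_prod {..<q} (\<lambda>j. sym_pow (D j) j)"
proof
  show "Rees D \<subseteq> submodule_prod {..<q} (\<lambda>j. sym_pow (D j) j)"
    unfolding Rees_def submodule_prod_def[of "{..<q}"]
  proof (rule mp.span_mono, rule subsetI)
    fix x assume "x \<in> pure_prods D"
    then obtain h where h: "x = (\<Prod>j<q. \<Prod>t<D j. h j t)" "\<forall>j<q. \<forall>t<D j. h j t \<in> E j"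
      by (auto simp: pure_prods_def)
    then show "x \<in> {\<Prod>j<q. f j | f. \<forall>j\<in>{..<q}. f j \<in> sym_pow (D j) j}"
      by (intro CollectI exI[of _ "\<lambda>j. \<Prod>t<D j. h j t"]) (auto intro: prod_mem_sym_pow)
  qed
  have "Rees (\<lambda>i. \<Sum>j<q. D j * \<delta> j i) = Rees D"
  proof (rule Rees_cong)
    fix i assume "i < q"
    have "(\<Sum>j<q. D j * \<delta> j i) = (\<Sum>j<q. if j = i then D i else 0)"
      by (intro sum.cong) (auto simp: \<delta>_def)
    then show "(\<Sum>j<q. D j * \<delta> j i) = D i" using \<open>i < q\<close> by simp
  qed
  then show "submodule_prod {..<q} (\<lambda>j. sym_pow (D j) j) \<subseteq> Rees D"
    using submodule_prod_sym_pow_subset[of "{..<q}" D] by simp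
qed

text \<open>Both sides are compared in diagonal degree \<open>n + 1\<close>. The right-hand side
  lies in this degree since each summand has the correct multidegree; conversely each generator of
  \<open>col_ideal\<close> lies in one summand. \<open>B\<close> consists of the columns alone,
  \<open>B'\<close> of the modules containing them.\<close>

lemma joint_reduction_equation:
  assumes B: "\<And>i. i < q \<Longrightarrow> B i \<subseteq> B' i" "\<And>i. i < q \<Longrightarrow> B' i \<subseteq> E i"
    and n: "T (Suc n) \<subseteq> col_ideal B (Suc n)"
  shows "submodule_prod {..<q} (\<lambda>j. sym_pow (n + 1) j) =
    submodule_sum {..<q} (\<lambda>i. submodule_mult (submodule_mult (B' i) (sym_pow n i))
      (submodule_prod ({..<q} - {i}) (\<lambda>j. sym_pow (n + 1) j)))" (is "?L = submodule_sum {..<q} ?R")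
proof
  have L: "?L = T (Suc n)" unfolding T_def Rees_eq_submodule_prod by simp
  have subR: "mp.subspace (?R i)" for i by (simp add: submodule_mult_def)
  have mult_Rees: "submodule_mult P Q \<subseteq> Rees (\<lambda>j. D j + D' j)" if "P \<subseteq> Rees D" "Q \<subseteq> Rees D'" for P Q D D'
    unfolding submodule_mult_def using that by (intro mp.span_minimal subspace_Rees) (auto intro: Rees_mult)
  have "?R i \<subseteq> T (Suc n)" if i: "i < q" for i
  proof -
    have "?R i \<subseteq> Rees (\<lambda>i'. (\<delta> i i' + n * \<delta> i i') + (\<Sum>j\<in>{..<q} - {i}. (n + 1) * \<delta> j i'))"
      by (intro mult_Rees sym_pow_subset_Rees submodule_prod_sym_pow_subset i) (use B(2)[OF i] E_Rees[OF i] in auto)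
    also have "\<dots> = Rees (\<lambda>_. Suc n)"
    proof (rule Rees_cong)
      fix j assume "j < q"
      have "(\<delta> i j + n * \<delta> i j) + (\<Sum>j'\<in>{..<q} - {i}. (n + 1) * \<delta> j' j) = (n + 1) * (codeg i j + \<delta> i j)"
        unfolding codeg_def sum_distrib_left[symmetric] by (simp add: algebra_simps)
      then show "(\<delta> i j + n * \<delta> i j) + (\<Sum>j'\<in>{..<q} - {i}. (n + 1) * \<delta> j' j) = Suc n"
        using codeg_add[OF i \<open>j < q\<close>] by simp
    qed
    finally show ?thesis by (simp add: T_def)
  qed
  then show "submodule_sum {..<q} ?R \<subseteq> ?L"
    unfolding L by (auto simp: submodule_sum_def intro!: mp.subspace_sum[OF subspace_T])
  have "col_ideal B (Suc n) \<subseteq> submodule_sum {..<q} ?R"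
    unfolding col_ideal_def
  proof (intro mp.span_minimal mp_subspace_submodule_sum subR, safe)
    fix i b D w assume i: "i < q" "b \<in> B i" "w \<in> Rees D" "\<forall>j<q. D j + \<delta> i j = Suc n"
    \<comment> \<open>The condition on \<open>D\<close> leaves exactly the degrees that occur in the
      i-th summand: \<open>n\<close> at \<open>i\<close>, and \<open>n + 1\<close>
      elsewhere.\<close>
    have Di: "D i = n" "\<And>j. j < q \<Longrightarrow> j \<noteq> i \<Longrightarrow> D j = n + 1"
      using i by (auto simp: \<delta>_def)
    have "pure_prods D \<subseteq> {w. b * w \<in> ?R i}"
    proof
      fix w assume "w \<in> pure_prods D"
      then obtain h where h: "w = (\<Prod>j<q. \<Prod>t<D j. h j t)" "\<forall>j<q. \<forall>t<D j. h j t \<in> E j"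
        by (auto simp: pure_prods_def)
      let ?s = "\<Prod>t<n. h i t" and ?w = "\<Prod>j\<in>{..<q} - {i}. \<Prod>t<n + 1. h j t"
      have "w = (\<Prod>t<D i. h i t) * (\<Prod>j\<in>{..<q} - {i}. \<Prod>t<D j. h j t)"
        unfolding h(1) using i(1) by (intro prod.remove) auto
      also have "(\<Prod>j\<in>{..<q} - {i}. \<Prod>t<D j. h j t) = ?w"
        using Di(2) by (intro prod.cong) auto
      finally have "b * w = (b * ?s) * ?w" by (simp add: Di(1) mult.assoc)
      moreover have "?s \<in> sym_pow n i" using h(2) i(1) Di(1) by (intro prod_mem_sym_pow) auto
      then have "b * ?s \<in> submodule_mult (B' i) (sym_pow n i)"
        unfolding submodule_mult_def using i B(1)[OF i(1)] by (intro mp.span_base) blast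
      moreover have "?w \<in> submodule_prod ({..<q} - {i}) (\<lambda>j. sym_pow (n + 1) j)"
        unfolding submodule_prod_def[of "{..<q} - {i}"]
      proof (intro mp.span_base CollectI exI[of _ "\<lambda>j. \<Prod>t<n + 1. h j t"] conjI ballI refl)
        fix j assume "j \<in> {..<q} - {i}"
        then show "(\<Prod>t<n + 1. h j t) \<in> sym_pow (n + 1) j"
          using h(2) Di(2)[of j] by (intro prod_mem_sym_pow) auto
      qed
      ultimately have "b * w \<in> {f * g | f g. f \<in> submodule_mult (B' i) (sym_pow n i) \<and>
          g \<in> submodule_prod ({..<q} - {i}) (\<lambda>j. sym_pow (n + 1) j)}" by blast
      then show "w \<in> {w. b * w \<in> ?R i}"
        unfolding submodule_mult_def[of "submodule_mult (B' i) (sym_pow n i)"] by (simp add: mp.span_base)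
    qed
    then have "Rees D \<subseteq> {w. b * w \<in> ?R i}"
      unfolding Rees_def by (intro mp.span_minimal mp_subspace_mult_vimage subR)
    then have "b * w \<in> ?R i" using i(3) by blast
    then show "b * w \<in> submodule_sum {..<q} ?R"
      using subset_submodule_sum[of "{..<q}" ?R i] subR i(1) by blast
  qed
  then show "?L \<subseteq> submodule_sum {..<q} ?R" using n L by simp
qed

end

section \<open>The theorem\<close>

definition monomial_of :: "'v set \<Rightarrow> ('v \<Rightarrow> nat) \<Rightarrow> 'v \<Rightarrow>\<^sub>0 nat" where
  "monomial_of V \<tau> = (\<Sum>v\<in>V. Poly_Mapping.single v (\<tau> v))"

lemma lookup_monomial_of:
  assumes "finite V"
  shows "Poly_Mapping.lookup (monomial_of V \<tau>) w = (if w \<in> V then \<tau> w else 0)"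
proof -
  have "Poly_Mapping.lookup (monomial_of V \<tau>) w = (\<Sum>v\<in>V. if v = w then \<tau> w else 0)"
    unfolding monomial_of_def lookup_sum by (intro sum.cong) (auto simp: lookup_single when_def)
  then show ?thesis using assms by simp
qed

lemma keys_monomial_of: "finite V \<Longrightarrow> Poly_Mapping.keys (monomial_of V \<tau>) \<subseteq> V"
  by (auto simp: in_keys_iff lookup_monomial_of split: if_splits)

lemma monomial_eval_monomial_of:
  "finite V \<Longrightarrow> monomial_eval x (monomial_of V \<tau>) = (\<Prod>v\<in>V. x v ^ \<tau> v)"
  by (simp add: monomial_eval_superset[OF _ keys_monomial_of] lookup_monomial_of)

lemma mpoly_eval_cong:
  assumes "mpoly_vars_in V f" "\<And>v. v \<in> V \<Longrightarrow> x v = y v"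
  shows "mpoly_eval x f = mpoly_eval y f"
  unfolding mpoly_eval_def
proof (intro sum.cong prod.cong arg_cong2[where f = "(*)"] refl)
  fix t v assume "t \<in> Poly_Mapping.keys f" "v \<in> Poly_Mapping.keys t"
  then have "v \<in> V" using assms(1) by (auto simp: mpoly_vars_in_def)
  then show "x v ^ Poly_Mapping.lookup t v = y v ^ Poly_Mapping.lookup t v" using assms(2) by simp
qed

context finite_colength_forms
begin

definition reduced_coeff_poly :: "('a \<Rightarrow> 'k::field) \<Rightarrow> ((nat \<times> nat \<times> nat \<Rightarrow> nat) \<Rightarrow> 'a) \<Rightarrow> (nat \<times> nat \<times> nat, 'k) mpoly" where
  "reduced_coeff_poly \<pi> F = (\<Sum>\<tau>\<in>box bound. Poly_Mapping.single (monomial_of entries \<tau>) (\<pi> (F \<tau>)))"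

lemma reduced_coeff_poly_vars: "mpoly_vars_in entries (reduced_coeff_poly \<pi> F)"
  unfolding mpoly_vars_in_def
proof
  fix t assume "t \<in> Poly_Mapping.keys (reduced_coeff_poly \<pi> F)"
  then obtain \<tau> where "t = monomial_of entries \<tau>"
    unfolding reduced_coeff_poly_def using keys_sum by (fastforce split: if_splits)
  then show "Poly_Mapping.keys t \<subseteq> entries" using keys_monomial_of[OF finite_entries] by simp
qed

text \<open>Exponent functions in \<open>box\<close> are extensional, hence determined by their
  monomials; nothing can cancel the coefficient at \<open>\<tau>0\<close>.\<close>

lemma reduced_coeff_poly_nonzero:
  assumes "\<tau>0 \<in> box bound" "\<pi> (F \<tau>0) \<noteq> 0"
  shows "reduced_coeff_poly \<pi> F \<noteq> 0"
proof -
  have inj: "\<tau> = \<tau>0" if "\<tau> \<in> box bound" "monomial_of entries \<tau> = monomial_of entries \<tau>0" for \<tau>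
  proof (rule PiE_ext)
    show "\<tau> \<in> (\<Pi>\<^sub>E v\<in>entries. {..<bound})" "\<tau>0 \<in> (\<Pi>\<^sub>E v\<in>entries. {..<bound})"
      using that(1) assms(1) by (simp_all add: box_def)
    fix v assume "v \<in> entries"
    then show "\<tau> v = \<tau>0 v"
      using arg_cong[OF that(2), of "\<lambda>t. Poly_Mapping.lookup t v"] by (simp add: lookup_monomial_of)
  qed
  have "Poly_Mapping.lookup (reduced_coeff_poly \<pi> F) (monomial_of entries \<tau>0) = (\<Sum>\<tau>\<in>box bound. if \<tau> = \<tau>0 then \<pi> (F \<tau>0) else 0)"
    unfolding reduced_coeff_poly_def lookup_sum
  proof (intro sum.cong refl)
    fix \<tau> assume "\<tau> \<in> box bound"
    then show "Poly_Mapping.lookup (Poly_Mapping.single (monomial_of entries \<tau>) (\<pi> (F \<tau>))) (monomial_of entries \<tau>0) =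
        (if \<tau> = \<tau>0 then \<pi> (F \<tau>0) else 0)"
      using inj[of \<tau>] by (auto simp: lookup_single when_def)
  qed
  then show ?thesis using assms by auto
qed

lemma reduced_coeff_poly_eval:
  assumes "comm_ring_hom \<pi>"
  shows "mpoly_eval (\<lambda>v. \<pi> (A v)) (reduced_coeff_poly \<pi> F) = \<pi> (coeff_fun F A)"
proof -
  interpret comm_ring_hom \<pi> by fact
  show ?thesis
    by (simp add: reduced_coeff_poly_def coeff_fun_def mpoly_eval_sum mpoly_eval_single monomial_eval_monomial_of
        hom_sum hom_mult hom_prod hom_power)
qed

end

context
  fixes \<mm> :: "'a::comm_ring_1 set" and \<pi> :: "'a \<Rightarrow> 'k::field"
    and scale :: "'a \<Rightarrow> 'f::ab_group_add \<Rightarrow> 'f"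
    and d q :: nat and r :: "nat \<Rightarrow> nat" and e :: "nat \<Rightarrow> nat \<Rightarrow> 'f" and F M :: "nat \<Rightarrow> 'f set"
  assumes nl: "noetherian_local_ring \<mm> \<pi>"
    and inf: "infinite (UNIV :: 'k set)"
    and kd: "krull_dim (ring_of_type_algebra :: 'a ring) = enat d"
    and d_pos: "d > 0"
    and mod: "Modules.module scale"
    and r_pos: "\<And>i. i < q \<Longrightarrow> r i \<ge> 1"
    and basis: "\<And>i. i < q \<Longrightarrow> free_module_basis scale (F i) (r i) (e i)"
    and colength: "\<And>i. i < q \<Longrightarrow> finite_colength_submodule scale (F i) (M i)"
    and d_le: "d \<le> q"
begin

interpretation V: Modules.module scale by (rule mod)

lemma subspace_F: "i < q \<Longrightarrow> V.subspace (F i)"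
  using V.free_module_basisD(3)[OF basis] V.subspace_span by metis

lemma basis_in_F: "i < q \<Longrightarrow> a < r i \<Longrightarrow> e i a \<in> F i"
  using V.free_module_basisD(3)[OF basis, of i] V.span_base[of "e i a" "e i ` {..<r i}"] by auto

lemma subspace_M: "i < q \<Longrightarrow> V.subspace (M i)" and M_subset_F: "i < q \<Longrightarrow> M i \<subseteq> F i"
  using colength by (auto simp: finite_colength_submodule_def)

abbreviation "emb \<equiv> sym_embed scale r e"

lemma generic_column_modules:
  fixes m :: "nat \<Rightarrow> nat" and G :: "nat \<Rightarrow> 'a mat"
  assumes G: "\<And>i. i < q \<Longrightarrow> G i \<in> carrier_mat (r i) (m i)"
    and MG: "\<And>i. i < q \<Longrightarrow> column_module scale (e i) (G i) = M i"
  shows "\<exists>U :: (nat \<Rightarrow> 'k mat) set. zariski_open q m r U \<and> U \<noteq> {} \<and>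
          (\<forall>A :: nat \<Rightarrow> 'a mat.
             (\<forall>i<q. A i \<in> carrier_mat (m i) (r i)) \<and>
             (\<lambda>i\<in>{..<q}. map_mat \<pi> (A i)) \<in> U \<longrightarrow>
             joint_reduction scale q r e M
               (\<lambda>i. column_module scale (e i) (G i * A i)))"
proof -
  have pih: "comm_ring_hom \<pi>" "surj \<pi>" and ker: "\<And>x. \<pi> x = 0 \<longleftrightarrow> x \<in> \<mm>"
    and noeth: "noetherian_ring (ring_of_type_algebra :: 'a ring)"
    using nl by (auto simp: noetherian_local_ring_def)
  interpret \<pi>: comm_ring_hom \<pi> by (rule pih)
  note unit = local_unit[OF nl]
  have subm: "rg.subspace \<mm>" and one: "1 \<notin> \<mm>"
    using local_prime_ideal[OF nl] by (auto simp: prime_ideal_def)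
  obtain Z where Z: "finite Z" "rg.span Z = \<mm>" using noetherian_fin_gen[OF noeth subm] by auto
  obtain p c1 where p: "\<And>i. i < d \<Longrightarrow> p i \<in> \<mm>"
    and c1: "\<And>w. set w \<subseteq> \<mm> \<Longrightarrow> length w = c1 \<Longrightarrow> prod_list w \<in> rg.span (p ` {..<d})"
    using system_of_parameters[OF nl kd] by blast
  have "\<forall>i. \<exists>c. i < q \<longrightarrow> (\<forall>w v. set w \<subseteq> \<mm> \<longrightarrow> c \<le> length w \<longrightarrow> v \<in> F i \<longrightarrow> scale (prod_list w) v \<in> M i)"
    using V.finite_colength_absorbs[OF unit subm one colength subspace_F] by blast
  then obtain c2 where c2: "\<And>i w v. i < q \<Longrightarrow> set w \<subseteq> \<mm> \<Longrightarrow> c2 i \<le> length w \<Longrightarrow> v \<in> F i \<Longrightarrow>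
      scale (prod_list w) v \<in> M i" by metis
  \<comment> \<open>One exponent for all purposes: at least \<open>c1\<close> and every
    \<open>c2 i\<close>, and positive.\<close>
  define c where "c = Suc (c1 + (\<Sum>i<q. c2 i))"
  define cv where "cv i j = (\<Sum>a<r i. scale (G i $$ (a, j)) (e i a))" for i j
  define g where "g i a = emb i (cv i a)" for i a
  have cvF: "cv i j \<in> F i" if "i < q" for i j
    unfolding cv_def using that
    by (intro V.subspace_sum[OF subspace_F] V.subspace_scale[OF subspace_F] basis_in_F) auto
  have M_span: "M i = V.span (cv i ` {..<m i})" if "i < q" for i
    using MG[OF that] G[OF that] unfolding column_module_def cv_def by auto
  interpret finite_colength_forms \<mm> Z p c d q r m "\<lambda>i. emb i ` M i" g
  proof
    show "prod_list w \<in> rg.span (p ` {..<d})" if "set w \<subseteq> \<mm>" "length w = c" for w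
    proof -
      have "prod_list (take c1 w) \<in> rg.span (p ` {..<d})"
        using that set_take_subset[of c1 w] by (intro c1) (auto simp: c_def)
      then have "prod_list (drop c1 w) * prod_list (take c1 w) \<in> rg.span (p ` {..<d})" by (rule rg.span_scale)
      then show ?thesis by (metis append_take_drop_id mult.commute prod_list.append)
    qed
    show "\<exists>w. set w \<subseteq> \<mm> \<and> length w = n \<and> prod_list w \<noteq> 0" for n
      using local_not_nilpotent[OF nl kd d_pos] .
    show "emb i ` M i = mp.span (g i ` {..<m i})" if "i < q" for i
      unfolding M_span[OF that]
      using V.sym_embed_span[where F = "F i" and r = r and e = e, OF basis[OF that], of "cv i ` {..<m i}"] cvF[OF that]
      by (auto simp: g_def[abs_def] image_image)
    show "emb i ` M i \<subseteq> mp.span ((\<lambda>a. mpoly_var (i, a)) ` {..<r i})" if "i < q" for i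
      unfolding sym_embed_def
      by (rule image_subsetI) (rule mp.span_sum, rule mp.span_scale, rule mp.span_base, simp)
    fix i a w assume w: "i < q" "a < r i" "set w \<subseteq> \<mm>" "length w = c"
    have "c2 i \<le> c" unfolding c_def using member_le_sum[of i "{..<q}" c2] w(1) by simp
    then have "scale (prod_list w) (e i a) \<in> M i" using w by (intro c2 basis_in_F) auto
    moreover have "emb i (scale (prod_list w) (e i a)) = mpoly_const (prod_list w) * mpoly_var (i, a)"
      using V.sym_embed_scale[where F = "F i" and r = r and e = e, OF basis[OF w(1)] basis_in_F[OF w(1,2)]]
        V.sym_embed_basis[where F = "F i" and r = r and e = e, OF basis[OF w(1)] w(2)]
      by (simp add: mpoly_scale_def)
    ultimately show "mpoly_const (prod_list w) * mpoly_var (i, a) \<in> emb i ` M i" by (metis image_eqI)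
  qed (use unit subm one Z p d_pos d_le r_pos in \<open>auto simp: c_def\<close>)
  obtain H where H: "\<And>\<sigma> i. \<sigma> \<in> choices \<Longrightarrow> i < d \<Longrightarrow> \<exists>\<tau>\<in>box bound. H \<sigma> i \<tau> = 1"
    "\<And>A. (\<forall>\<sigma>\<in>choices. \<forall>i<d. coeff_fun (H \<sigma> i) A \<notin> \<mm>) \<Longrightarrow> \<exists>n. T (Suc n) \<subseteq> col_ideal (col_forms A) (Suc n)"
    using generic_joint_reduction by blast
  \<comment> \<open>The conditions for all selections and all parameters are collected in one
    product, so the open set is the complement of a hypersurface.\<close>
  define \<Delta> where "\<Delta> = (\<Prod>(\<sigma>, i)\<in>choices \<times> {..<d}. reduced_coeff_poly \<pi> (H \<sigma> i))"
  have fin: "finite (choices \<times> {..<d})" by (simp add: finite_choices)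
  have \<Delta>_vars: "mpoly_vars_in entries \<Delta>"
    unfolding \<Delta>_def by (rule mpoly_vars_in_prod) (auto intro: reduced_coeff_poly_vars)
  have \<Delta>_eval: "mpoly_eval x \<Delta> \<noteq> 0 \<longleftrightarrow> (\<forall>\<sigma>\<in>choices. \<forall>i<d. mpoly_eval x (reduced_coeff_poly \<pi> (H \<sigma> i)) \<noteq> 0)" for x
    unfolding \<Delta>_def mpoly_eval_prod using fin by (auto simp: prod_zero_iff)
  define U where "U = {Z \<in> matrix_tuples q m r. mpoly_eval (\<lambda>(i, a, b). Z i $$ (a, b)) \<Delta> \<noteq> 0}"
  have entries_eq: "entries = {(i, a, b). i < q \<and> a < m i \<and> b < r i}" by (auto simp: entries_def)
  have "zariski_open q m r U"
    unfolding zariski_open_def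
    using \<Delta>_vars by (intro exI[of _ "{\<Delta>}"]) (auto simp: U_def mpoly_vars_in_def entries_eq)
  moreover have "U \<noteq> {}"
  proof -
    have "\<exists>x. \<forall>f\<in>(\<lambda>(\<sigma>, i). reduced_coeff_poly \<pi> (H \<sigma> i)) ` (choices \<times> {..<d}). mpoly_eval x f \<noteq> 0"
    proof (rule common_nonvanishing_point[OF inf finite_entries])
      show "0 \<notin> (\<lambda>(\<sigma>, i). reduced_coeff_poly \<pi> (H \<sigma> i)) ` (choices \<times> {..<d})"
      proof
        assume "0 \<in> (\<lambda>(\<sigma>, i). reduced_coeff_poly \<pi> (H \<sigma> i)) ` (choices \<times> {..<d})"
        then obtain \<sigma> i where si: "\<sigma> \<in> choices" "i < d" "reduced_coeff_poly \<pi> (H \<sigma> i) = 0" by auto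
        obtain \<tau> where "\<tau> \<in> box bound" "H \<sigma> i \<tau> = 1" using H(1)[OF si(1,2)] by blast
        then show False using reduced_coeff_poly_nonzero[of \<tau> \<pi> "H \<sigma> i"] si(3) by simp
      qed
    qed (use fin reduced_coeff_poly_vars in auto)
    then obtain x where x: "mpoly_eval x \<Delta> \<noteq> 0" unfolding \<Delta>_eval by force
    define Z where "Z = (\<lambda>i\<in>{..<q}. mat (m i) (r i) (\<lambda>(a, b). x (i, a, b)))"
    have "mpoly_eval (\<lambda>(i, a, b). Z i $$ (a, b)) \<Delta> = mpoly_eval x \<Delta>"
      by (rule mpoly_eval_cong[OF \<Delta>_vars]) (auto simp: entries_eq Z_def)
    then have "Z \<in> U" using x by (auto simp: U_def matrix_tuples_def Z_def)
    then show ?thesis by blast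
  qed
  moreover have "joint_reduction scale q r e M (\<lambda>i. column_module scale (e i) (G i * A i))"
    if A: "\<And>i. i < q \<Longrightarrow> A i \<in> carrier_mat (m i) (r i)" and AU: "(\<lambda>i\<in>{..<q}. map_mat \<pi> (A i)) \<in> U" for A
  proof -
    define A' where "A' = (\<lambda>(i, a, b). A i $$ (a, b))"
    have dim: "dim_row (A i) = m i" "dim_col (A i) = r i" if "i < q" for i using A[OF that] by auto
    have "mpoly_eval (\<lambda>v. \<pi> (A' v)) \<Delta> = mpoly_eval (\<lambda>(i, a, b). (\<lambda>i\<in>{..<q}. map_mat \<pi> (A i)) i $$ (a, b)) \<Delta>"
      by (rule mpoly_eval_cong[OF \<Delta>_vars]) (auto simp: entries_eq A'_def dim)
    then have "mpoly_eval (\<lambda>v. \<pi> (A' v)) \<Delta> \<noteq> 0" using AU by (simp add: U_def)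
    then have "\<forall>\<sigma>\<in>choices. \<forall>i<d. coeff_fun (H \<sigma> i) A' \<notin> \<mm>"
      unfolding \<Delta>_eval reduced_coeff_poly_eval[OF pih(1)] ker by blast
    then obtain n where n: "T (Suc n) \<subseteq> col_ideal (col_forms A') (Suc n)" using H(2) by blast
    define B where "B i = column_module scale (e i) (G i * A i)" for i
    \<comment> \<open>The columns of the product matrix, rewritten as combinations of the generators
      of M_i with coefficients from \<open>A i\<close>; under the embedding they become the forms
      \<open>col_form\<close>.\<close>
    define cb where "cb i b = (\<Sum>a<m i. scale (A i $$ (a, b)) (cv i a))" for i b
    have B_eq: "B i = V.span (cb i ` {..<r i})" if i: "i < q" for i
    proof -
      have dims: "dim_row (G i) = r i" "dim_col (G i) = m i" "dim_row (A i) = m i" "dim_col (A i) = r i"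
        using G[OF i] A[OF i] by auto
      have "(\<Sum>a<r i. scale ((G i * A i) $$ (a, b)) (e i a)) = cb i b" if b: "b < r i" for b
      proof -
        have "(G i * A i) $$ (a, b) = (\<Sum>j<m i. A i $$ (j, b) * G i $$ (a, j))" if "a < r i" for a
          using that b dims by (simp add: scalar_prod_def atLeast0LessThan mult.commute)
        then have "(\<Sum>a<r i. scale ((G i * A i) $$ (a, b)) (e i a)) =
            (\<Sum>a<r i. \<Sum>j<m i. scale (A i $$ (j, b)) (scale (G i $$ (a, j)) (e i a)))"
          by (simp add: V.scale_sum_left)
        also have "\<dots> = cb i b"
          unfolding cb_def cv_def V.scale_sum_right by (rule sum.swap)
        finally show ?thesis .
      qed
      then show ?thesis unfolding B_def column_module_def using dims by (auto intro!: arg_cong[where f = V.span])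
    qed
    have cbM: "cb i b \<in> M i" if "i < q" for i b
      unfolding cb_def using that
      by (intro V.subspace_sum[OF subspace_M] V.subspace_scale[OF subspace_M])
        (auto simp: M_span intro: V.span_base)
    have BM: "B i \<subseteq> M i" if "i < q" for i
      unfolding B_eq[OF that] by (rule V.span_minimal) (use cbM subspace_M that in auto)
    have "col_forms A' i \<subseteq> emb i ` B i" if i: "i < q" for i
    proof -
      have "col_form A' i b = emb i (cb i b)" for b
        unfolding cb_def col_form_def
        using V.sym_embed_sum[where F = "F i" and r = r and e = e, OF basis[OF i], of "{..<m i}" "\<lambda>a. scale (A i $$ (a, b)) (cv i a)"]
          V.sym_embed_scale[where F = "F i" and r = r and e = e, OF basis[OF i] cvF[OF i]] V.subspace_scale[OF subspace_F[OF i] cvF[OF i]]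
        by (simp add: g_def A'_def mpoly_scale_def)
      then show ?thesis unfolding col_forms_def B_eq[OF i] by (auto intro: V.span_base)
    qed
    from joint_reduction_equation[of "col_forms A'" "\<lambda>i. emb i ` B i", OF this _ n]
    have eq: "submodule_prod {..<q} (\<lambda>j. sym_pow (n + 1) j) =
      submodule_sum {..<q} (\<lambda>i. submodule_mult (submodule_mult (emb i ` B i) (sym_pow n i))
        (submodule_prod ({..<q} - {i}) (\<lambda>j. sym_pow (n + 1) j)))"
      using BM by blast
    show ?thesis
      unfolding joint_reduction_def B_def[symmetric] sym_power_image_def
    proof (intro conjI allI impI exI)
      fix i assume i: "i < q"
      show "V.subspace (B i)" "B i \<subseteq> M i" using BM[OF i] by (simp_all add: B_eq[OF i])
      show "B i = V.span (cb i ` {..<r i})" by (rule B_eq[OF i])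
    qed (rule eq)
  qed
  ultimately show ?thesis by blast
qed

lemma exists_generating_matrices:
  "\<exists>(m :: nat \<Rightarrow> nat) (G :: nat \<Rightarrow> 'a mat).
     \<forall>i<q. G i \<in> carrier_mat (r i) (m i) \<and> column_module scale (e i) (G i) = M i"
proof -
  have noeth: "noetherian_ring (ring_of_type_algebra :: 'a ring)"
    using nl by (simp add: noetherian_local_ring_def)
  have "\<exists>m G. G \<in> carrier_mat (r i) m \<and> column_module scale (e i) G = M i" if i: "i < q" for i
  proof -
    have "M i \<subseteq> V.span (e i ` {..<r i})" using M_subset_F[OF i] V.free_module_basisD(3)[OF basis[OF i]] by simp
    from V.noetherian_subspace_fin_gen[OF noeth subspace_M[OF i] this]
    obtain S where S: "finite S" "M i = V.span S" by blast
    obtain v where v: "bij_betw v {..<card S} S"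
      using ex_bij_betw_nat_finite[OF S(1)] by (auto simp: atLeast0LessThan)
    define G where "G = mat (r i) (card S) (\<lambda>(a, j). V.representation (e i ` {..<r i}) (v j) (e i a))"
    have "(\<Sum>a<r i. scale (G $$ (a, j)) (e i a)) = v j" if j: "j < card S" for j
    proof -
      have "v j \<in> S" using v j by (auto simp: bij_betw_def)
      then have "v j \<in> F i" using S(2) M_subset_F[OF i] V.span_base by blast
      from V.free_module_basis_expand[OF basis[OF i] this] show ?thesis using j by (simp add: G_def)
    qed
    then have "column_module scale (e i) G = V.span (v ` {..<card S})"
      unfolding column_module_def by (auto simp: G_def intro!: arg_cong[where f = V.span])
    also have "v ` {..<card S} = S" using v by (simp add: bij_betw_def)
    finally have "column_module scale (e i) G = M i" using S by simp
    moreover have "G \<in> carrier_mat (r i) (card S)" by (simp add: G_def)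
    ultimately show ?thesis by blast
  qed
  then have "\<forall>i. \<exists>m G. i < q \<longrightarrow> G \<in> carrier_mat (r i) m \<and> column_module scale (e i) G = M i" by blast
  then show ?thesis by metis
qed

text \<open>Finite generation supplies matrices for the M_i, and a point of the nonempty set
  \<open>U\<close> is lifted entry by entry through the surjection \<open>\<pi>\<close>.\<close>

lemma exists_joint_reduction: "\<exists>B. joint_reduction scale q r e M B"
proof -
  obtain m and G :: "nat \<Rightarrow> 'a mat" where
    G: "\<And>i. i < q \<Longrightarrow> G i \<in> carrier_mat (r i) (m i)" "\<And>i. i < q \<Longrightarrow> column_module scale (e i) (G i) = M i"
    using exists_generating_matrices by blast
  obtain U where U: "zariski_open q m r U" "U \<noteq> {}"
    "\<And>A. (\<forall>i<q. A i \<in> carrier_mat (m i) (r i)) \<and> (\<lambda>i\<in>{..<q}. map_mat \<pi> (A i)) \<in> U \<Longrightarrow>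
       joint_reduction scale q r e M (\<lambda>i. column_module scale (e i) (G i * A i))"
    using generic_column_modules[of G m, OF G] by blast
  obtain Z where Z: "Z \<in> U" using U(2) by blast
  then have Zm: "Z \<in> matrix_tuples q m r" using U(1) by (auto simp: zariski_open_def)
  define A where "A i = map_mat (inv_into UNIV \<pi>) (Z i)" for i
  have Zi: "Z i \<in> carrier_mat (m i) (r i)" if "i < q" for i using Zm that by (auto simp: matrix_tuples_def)
  have surj: "surj \<pi>" using nl by (simp add: noetherian_local_ring_def)
  have "(\<lambda>i\<in>{..<q}. map_mat \<pi> (A i)) = Z"
  proof
    fix i
    show "(\<lambda>i\<in>{..<q}. map_mat \<pi> (A i)) i = Z i"
    proof (cases "i < q")
      case True
      then show ?thesis by (simp add: A_def mat_eq_iff surj_f_inv_f[OF surj])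
    next
      case False
      then show ?thesis using PiE_arb[OF Zm[unfolded matrix_tuples_def], of i] by simp
    qed
  qed
  then show ?thesis using U(3)[of A] Z Zi by (auto simp: A_def)
qed

end

theorem proposition3:
  fixes \<mm> :: "'a::comm_ring_1 set"
    and \<pi> :: "'a \<Rightarrow> 'k::field"
    and scale :: "'a \<Rightarrow> 'f::ab_group_add \<Rightarrow> 'f"
    and d q :: nat
    and r :: "nat \<Rightarrow> nat"
    and e :: "nat \<Rightarrow> nat \<Rightarrow> 'f"
    and F M :: "nat \<Rightarrow> 'f set"
  assumes "noetherian_local_ring \<mm> \<pi>"
    and "infinite (UNIV :: 'k set)"
    and "krull_dim (ring_of_type_algebra :: 'a ring) = enat d"
    and "d > 0"
    and "Modules.module scale"
    and "\<And>i. i < q \<Longrightarrow> r i \<ge> 1"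
    and "\<And>i. i < q \<Longrightarrow> free_module_basis scale (F i) (r i) (e i)"
    and "\<And>i. i < q \<Longrightarrow> finite_colength_submodule scale (F i) (M i)"
    and "q \<ge> d"
  shows "(\<exists>B. joint_reduction scale q r e M B) \<and>
    (\<forall>(m :: nat \<Rightarrow> nat) (G :: nat \<Rightarrow> 'a mat).
       (\<forall>i<q. G i \<in> carrier_mat (r i) (m i) \<and> column_module scale (e i) (G i) = M i) \<longrightarrow>
       (\<exists>U :: (nat \<Rightarrow> 'k mat) set. zariski_open q m r U \<and> U \<noteq> {} \<and>
          (\<forall>A :: nat \<Rightarrow> 'a mat.
             (\<forall>i<q. A i \<in> carrier_mat (m i) (r i)) \<and>
             (\<lambda>i\<in>{..<q}. map_mat \<pi> (A i)) \<in> U \<longrightarrow>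
             joint_reduction scale q r e M
               (\<lambda>i. column_module scale (e i) (G i * A i)))))"
proof (intro conjI allI impI)
  show "\<exists>B. joint_reduction scale q r e M B"
    by (rule exists_joint_reduction[where F = F, OF assms(1-5)]) (use assms(6-9) in simp_all)
  fix m :: "nat \<Rightarrow> nat" and G :: "nat \<Rightarrow> 'a mat"
  assume "\<forall>i<q. G i \<in> carrier_mat (r i) (m i) \<and> column_module scale (e i) (G i) = M i"
  then show "\<exists>U :: (nat \<Rightarrow> 'k mat) set. zariski_open q m r U \<and> U \<noteq> {} \<and>
      (\<forall>A :: nat \<Rightarrow> 'a mat.
         (\<forall>i<q. A i \<in> carrier_mat (m i) (r i)) \<and>
         (\<lambda>i\<in>{..<q}. map_mat \<pi> (A i)) \<in> U \<longrightarrow>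
         joint_reduction scale q r e M
           (\<lambda>i. column_module scale (e i) (G i * A i)))"
    by (intro generic_column_modules[where F = F, OF assms(1-5)]) (use assms(6-9) in simp_all)
qed

end
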